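(* Let $l>0$, $\Omega=(0,\pi)\times(-l,l)$, $\sigma\in(0,1)$, $\Omega_O\subset\overline\Omega$ nonempty closed, $\alpha\in(0,1)$ fixed, and $\kappa_\pm\ge\gamma_\pm>0$. Let $$\Psi_\pm:=\{\psi\in O_\pm(\gamma_\pm)\cap C^{0,\alpha}(\Omega_O):\|\psi\|_{C^{0,\alpha}(\Omega_O)}\le\kappa_\pm\}.$$ Then the problem $$\mathcal{G}^\infty:=\min_{(\psi_-,\psi_+)\in\Psi_-\times\Psi_+}\mathcal{G}^\infty_{\psi_-,\psi_+},\qquad\mathcal{G}^\infty_{\psi_-,\psi_+}:=\max_{f\in\mathcal{F}}\mathcal{G}^\infty_{f,\psi_-,\psi_+},$$ with $\mathcal{F}:=\{f\in(C^0(\overline\Omega))':\|f\|_{(C^0(\overline\Omega))'}\le1\}$, admits a solution.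
   Context: $H^2_*(\Omega):=\{v\in H^2(\Omega): v=0\text{ on }\{0,\pi\}\times(-l,l)\}$ with scalar product $(u,v)_{H^2_*(\Omega)}:=\int_\Omega\big(\Delta u\Delta v+(1-\sigma)(2u_{xy}v_{xy}-u_{xx}v_{yy}-u_{yy}v_{xx})\big)$; elements are identified with continuous functions on $\overline\Omega$. $(C^0(\overline\Omega))'$: dual of $C^0(\overline\Omega)$ with pairing $\langle f,u\rangle$. $O_+(\gamma):=\{\psi\in C^0(\Omega_O):\psi\ge\gamma\}$, $O_-(\gamma):=\{\psi\in C^0(\Omega_O):\psi\le-\gamma\}$. $\|v\|_{C^{0,\alpha}(\Omega_O)}:=\|v\|_{L^\infty(\Omega_O)}+\sup_{x\ne y\in\Omega_O}|v(x)-v(y)|/|x-y|^\alpha$. $H^2_{*,\psi_-,\psi_+}(\Omega):=\{v\in H^2_*(\Omega):\psi_-\le v\le\psi_+\text{ on }\Omega_O\}$; $u_{f,\psi_-,\psi_+}$ is the unique $u\in H^2_{*,\psi_-,\psi_+}(\Omega)$ with $(u,\varphi-u)_{H^2_*(\Omega)}\ge\langle f,\varphi-u\rangle$ for all $\varphi\in H^2_{*,\psi_-,\psi_+}(\Omega)$. $\mathcal{G}^\infty_{f,\psi_-,\psi_+}:=\max_{x\in[0,\pi]}|u_{f,\psi_-,\psi_+}(x,l)-u_{f,\psi_-,\psi_+}(x,-l)|$. (The inner maximum over $\mathcal{F}$ is attained for each $(\psi_-,\psi_+)$.) *)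

theory Defs
  imports "HOL-Analysis.Analysis"
begin

definition Om :: "real \<Rightarrow> (real \<times> real) set" where
  "Om l = {0<..<pi} \<times> {-l<..<l}"

definition Omc :: "real \<Rightarrow> (real \<times> real) set" where
  "Omc l = {0..pi} \<times> {-l..l}"

definition pd :: "bool \<Rightarrow> (real \<times> real \<Rightarrow> real) \<Rightarrow> (real \<times> real \<Rightarrow> real)" where
  "pd b \<phi> = (\<lambda>p. if b then deriv (\<lambda>t. \<phi> (fst p, t)) (snd p)
                    else deriv (\<lambda>t. \<phi> (t, snd p)) (fst p))"

definition iter_pd :: "bool list \<Rightarrow> (real \<times> real \<Rightarrow> real) \<Rightarrow> (real \<times> real \<Rightarrow> real)" where
  "iter_pd ds \<phi> = foldr pd ds \<phi>"

definition smooth_fun :: "(real \<times> real \<Rightarrow> real) \<Rightarrow> bool" where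
  "smooth_fun \<phi> \<longleftrightarrow> (\<forall>ds p. iter_pd ds \<phi> differentiable (at p))"

definition test_fun :: "real \<Rightarrow> (real \<times> real \<Rightarrow> real) \<Rightarrow> bool" where
  "test_fun l \<phi> \<longleftrightarrow> smooth_fun \<phi> \<and> compact (closure {p. \<phi> p \<noteq> 0})
      \<and> closure {p. \<phi> p \<noteq> 0} \<subseteq> Om l"

definition L2 :: "real \<Rightarrow> (real \<times> real \<Rightarrow> real) \<Rightarrow> bool" where
  "L2 l v \<longleftrightarrow> set_borel_measurable lborel (Om l) v
      \<and> set_integrable lborel (Om l) (\<lambda>p. (v p)\<^sup>2)"

definition weak_deriv :: "real \<Rightarrow> bool list \<Rightarrow> (real \<times> real \<Rightarrow> real) \<Rightarrow> (real \<times> real \<Rightarrow> real) \<Rightarrow> bool" where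
  "weak_deriv l ds v g \<longleftrightarrow> (\<forall>\<phi>. test_fun l \<phi> \<longrightarrow>
      (LINT p:Om l|lborel. v p * iter_pd ds \<phi> p) = (-1) ^ length ds * (LINT p:Om l|lborel. g p * \<phi> p))"

definition H2 :: "real \<Rightarrow> (real \<times> real \<Rightarrow> real) \<Rightarrow> bool" where
  "H2 l v \<longleftrightarrow> L2 l v \<and> (\<forall>ds. length ds \<le> 2 \<longrightarrow> (\<exists>g. L2 l g \<and> weak_deriv l ds v g))"

text \<open>H^2_*(Omega), elements represented by their continuous representative on the closure,
  extended by 0 outside the closure (canonical representative).\<close>
definition H2s :: "real \<Rightarrow> (real \<times> real \<Rightarrow> real) \<Rightarrow> bool" where
  "H2s l v \<longleftrightarrow> H2 l v \<and> continuous_on (Omc l) v \<and> (\<forall>p. p \<notin> Omc l \<longrightarrow> v p = 0)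
      \<and> (\<forall>y\<in>{-l<..<l}. v (0, y) = 0 \<and> v (pi, y) = 0)"

definition wd :: "real \<Rightarrow> bool list \<Rightarrow> (real \<times> real \<Rightarrow> real) \<Rightarrow> (real \<times> real \<Rightarrow> real)" where
  "wd l ds v = (SOME g. L2 l g \<and> weak_deriv l ds v g)"

definition H2s_inner :: "real \<Rightarrow> real \<Rightarrow> (real \<times> real \<Rightarrow> real) \<Rightarrow> (real \<times> real \<Rightarrow> real) \<Rightarrow> real" where
  "H2s_inner l \<sigma> u v = (LINT p:Om l|lborel.
     (wd l [False,False] u p + wd l [True,True] u p) * (wd l [False,False] v p + wd l [True,True] v p)
     + (1 - \<sigma>) * (2 * wd l [False,True] u p * wd l [False,True] v p
                  - wd l [False,False] u p * wd l [True,True] v p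
                  - wd l [True,True] u p * wd l [False,False] v p))"

definition dual_ball :: "real \<Rightarrow> ((real \<times> real \<Rightarrow> real) \<Rightarrow> real) set" where
  "dual_ball l = {f.
     (\<forall>u v. (\<forall>p\<in>Omc l. u p = v p) \<longrightarrow> f u = f v)
   \<and> (\<forall>u v a b. continuous_on (Omc l) u \<and> continuous_on (Omc l) v \<longrightarrow>
        f (\<lambda>p. a * u p + b * v p) = a * f u + b * f v)
   \<and> (\<forall>u. continuous_on (Omc l) u \<longrightarrow> \<bar>f u\<bar> \<le> (SUP p\<in>Omc l. \<bar>u p\<bar>))}"

definition hoelder_quots :: "real \<Rightarrow> (real \<times> real) set \<Rightarrow> (real \<times> real \<Rightarrow> real) \<Rightarrow> real set" where
  "hoelder_quots \<alpha> S v = {\<bar>v x - v y\<bar> / (dist x y) powr \<alpha> | x y. x \<in> S \<and> y \<in> S \<and> x \<noteq> y}"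

definition in_C0alpha :: "real \<Rightarrow> (real \<times> real) set \<Rightarrow> (real \<times> real \<Rightarrow> real) \<Rightarrow> bool" where
  "in_C0alpha \<alpha> S v \<longleftrightarrow> continuous_on S v \<and> bounded (v ` S) \<and> bdd_above (hoelder_quots \<alpha> S v)"

definition hoelder_norm :: "real \<Rightarrow> (real \<times> real) set \<Rightarrow> (real \<times> real \<Rightarrow> real) \<Rightarrow> real" where
  "hoelder_norm \<alpha> S v = (SUP x\<in>S. \<bar>v x\<bar>) + Sup (insert 0 (hoelder_quots \<alpha> S v))"

definition Psi_plus :: "real \<Rightarrow> (real \<times> real) set \<Rightarrow> real \<Rightarrow> real \<Rightarrow> (real \<times> real \<Rightarrow> real) set" where
  "Psi_plus \<alpha> ObsSet \<gamma> \<kappa> = {\<psi>. continuous_on ObsSet \<psi> \<and> (\<forall>x\<in>ObsSet. \<psi> x \<ge> \<gamma>)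
      \<and> in_C0alpha \<alpha> ObsSet \<psi> \<and> hoelder_norm \<alpha> ObsSet \<psi> \<le> \<kappa>}"

definition Psi_minus :: "real \<Rightarrow> (real \<times> real) set \<Rightarrow> real \<Rightarrow> real \<Rightarrow> (real \<times> real \<Rightarrow> real) set" where
  "Psi_minus \<alpha> ObsSet \<gamma> \<kappa> = {\<psi>. continuous_on ObsSet \<psi> \<and> (\<forall>x\<in>ObsSet. \<psi> x \<le> -\<gamma>)
      \<and> in_C0alpha \<alpha> ObsSet \<psi> \<and> hoelder_norm \<alpha> ObsSet \<psi> \<le> \<kappa>}"

definition Kset :: "real \<Rightarrow> (real \<times> real) set \<Rightarrow> (real \<times> real \<Rightarrow> real) \<Rightarrow> (real \<times> real \<Rightarrow> real) \<Rightarrow> (real \<times> real \<Rightarrow> real) set" where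
  "Kset l ObsSet \<psi>m \<psi>p = {v. H2s l v \<and> (\<forall>x\<in>ObsSet. \<psi>m x \<le> v x \<and> v x \<le> \<psi>p x)}"

definition u_sol :: "real \<Rightarrow> real \<Rightarrow> (real \<times> real) set \<Rightarrow> ((real \<times> real \<Rightarrow> real) \<Rightarrow> real)
     \<Rightarrow> (real \<times> real \<Rightarrow> real) \<Rightarrow> (real \<times> real \<Rightarrow> real) \<Rightarrow> (real \<times> real \<Rightarrow> real)" where
  "u_sol l \<sigma> ObsSet f \<psi>m \<psi>p = (THE u. u \<in> Kset l ObsSet \<psi>m \<psi>p \<and>
      (\<forall>\<phi>\<in>Kset l ObsSet \<psi>m \<psi>p. H2s_inner l \<sigma> u (\<lambda>p. \<phi> p - u p) \<ge> f (\<lambda>p. \<phi> p - u p)))"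

definition G_f :: "real \<Rightarrow> real \<Rightarrow> (real \<times> real) set \<Rightarrow> ((real \<times> real \<Rightarrow> real) \<Rightarrow> real)
     \<Rightarrow> (real \<times> real \<Rightarrow> real) \<Rightarrow> (real \<times> real \<Rightarrow> real) \<Rightarrow> real" where
  "G_f l \<sigma> ObsSet f \<psi>m \<psi>p = (SUP x\<in>{0..pi}.
      \<bar>u_sol l \<sigma> ObsSet f \<psi>m \<psi>p (x, l) - u_sol l \<sigma> ObsSet f \<psi>m \<psi>p (x, -l)\<bar>)"

definition G_psi :: "real \<Rightarrow> real \<Rightarrow> (real \<times> real) set
     \<Rightarrow> (real \<times> real \<Rightarrow> real) \<Rightarrow> (real \<times> real \<Rightarrow> real) \<Rightarrow> real" where
  "G_psi l \<sigma> ObsSet \<psi>m \<psi>p = (SUP f\<in>dual_ball l. G_f l \<sigma> ObsSet f \<psi>m \<psi>p)"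

end

(* The plate energy is coercive on H^2_* and dominates the supremum norm, so the variational inequality
   is uniquely solvable by minimising the energy over the closed convex constraint set. Obstacles that
   stay away from 0 allow scaling: if the obstacles move by at most delta, then (1 - delta/gamma) times
   the solution is admissible for the new obstacles, and testing both inequalities this way bounds the
   energy of the difference of the two solutions by a multiple of delta/gamma, uniformly in the load.
   Hence the worst-case gap depends continuously on the obstacles in the supremum norm, and the
   admissible obstacles are compact by Arzela-Ascoli.

   The embedding into continuous functions needs no regularity theory on the rectangle: testing with
   tensor products recovers v from v_xy and v_xx by one-dimensional integration. The same formulas give
   the first weak derivatives of a limit, hence completeness. *)

theory Submission
  imports Defs "HOL-Real_Asymp.Real_Asymp" "HOL-Complex_Analysis.Great_Picard"
begin

section \<open>Smooth functions of one variable\<close>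

text \<open>Three features of the setting shape the argument. \<open>u_sol\<close> is a
  \<open>THE\<close> over functions, so uniqueness must hold at every point and not just almost
  everywhere; the bound of the supremum norm by the energy gives this, and it also controls v on the
  horizontal edges, where the gap is measured and no boundary condition is imposed. It rests on a
  splitting: v_xy bounds the oscillation of v along each vertical line, while v_xx and the zero
  values at x = 0 and x = pi bound the mean over that line. Next, the obstacles are only Hoelder
  continuous: adding the difference of two obstacles to a solution may leave the space, and adding a
  constant violates the condition on the vertical edges, whereas multiplication by a number stays
  inside. The price is a square root in the modulus of continuity. Finally, the embedding constant C
  bounds the loads of the dual unit ball relative to the energy norm, hence the energy and the
  supremum of every solution; this makes the estimates uniform in the load.\<close>

primrec diff_times :: "nat \<Rightarrow> (real \<Rightarrow> real) \<Rightarrow> bool" where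
  "diff_times 0 f \<longleftrightarrow> True"
| "diff_times (Suc n) f \<longleftrightarrow> (\<exists>f'. (\<forall>x. (f has_real_derivative f' x) (at x)) \<and> diff_times n f')"

text \<open>Smoothness is coded by the existence of a chain of derivative functions, not by
  iterating \<open>deriv\<close>, so that the closure rules are plain inductions;
  \<open>smooth1_deriv\<close> recovers \<open>deriv\<close> afterwards.\<close>

definition smooth1 :: "(real \<Rightarrow> real) \<Rightarrow> bool" where
  "smooth1 f \<longleftrightarrow> (\<forall>n. diff_times n f)"

lemma diff_times_mono: "diff_times (Suc n) f \<Longrightarrow> diff_times n f"
  by (induction n arbitrary: f) (simp, metis diff_times.simps(2))

lemma diff_times_add: "diff_times n f \<Longrightarrow> diff_times n g \<Longrightarrow> diff_times n (\<lambda>x. f x + g x)"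
proof (induction n arbitrary: f g)
  case (Suc n)
  then obtain f' g' where "\<forall>x. (f has_real_derivative f' x) (at x)" "diff_times n f'"
    "\<forall>x. (g has_real_derivative g' x) (at x)" "diff_times n g'" by auto
  then show ?case using Suc.IH[of f' g']
    by (auto intro!: exI[of _ "\<lambda>x. f' x + g' x"] DERIV_add)
qed simp

lemma diff_times_mult: "diff_times n f \<Longrightarrow> diff_times n g \<Longrightarrow> diff_times n (\<lambda>x. f x * g x)"
proof (induction n arbitrary: f g)
  case (Suc n)
  then obtain f' g' where d: "\<forall>x. (f has_real_derivative f' x) (at x)" "diff_times n f'"
    "\<forall>x. (g has_real_derivative g' x) (at x)" "diff_times n g'" by auto
  have "diff_times n (\<lambda>x. f' x * g x + g' x * f x)"
    using Suc.IH[of f' g] Suc.IH[of g' f] d diff_times_mono Suc.prems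
    by (intro diff_times_add) auto
  then show ?case using d
    by (auto intro!: exI[of _ "\<lambda>x. f' x * g x + g' x * f x"] DERIV_mult)
qed simp

lemma diff_times_const: "diff_times n (\<lambda>_. c)"
proof (induction n arbitrary: c)
  case (Suc n)
  then show ?case by (auto intro!: exI[of _ "\<lambda>_. 0"])
qed simp

lemma diff_times_affine: "diff_times n f \<Longrightarrow> diff_times n (\<lambda>x. f (a + b * x))"
proof (induction n arbitrary: f)
  case (Suc n)
  then obtain f' where d: "\<forall>x. (f has_real_derivative f' x) (at x)" "diff_times n f'" by auto
  have "((\<lambda>x. f (a + b * x)) has_real_derivative f' (a + b * x) * b) (at x)" for x
    by (rule DERIV_chain2[of f]) (use d in \<open>auto intro!: derivative_eq_intros\<close>)
  moreover have "diff_times n (\<lambda>x. f' (a + b * x) * b)"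
    by (intro diff_times_mult diff_times_const Suc.IH d)
  ultimately show ?case by (auto intro!: exI[of _ "\<lambda>x. f' (a + b * x) * b"])
qed simp

lemma smooth1_const: "smooth1 (\<lambda>_. c)"
  and smooth1_add: "smooth1 f \<Longrightarrow> smooth1 g \<Longrightarrow> smooth1 (\<lambda>x. f x + g x)"
  and smooth1_mult: "smooth1 f \<Longrightarrow> smooth1 g \<Longrightarrow> smooth1 (\<lambda>x. f x * g x)"
  and smooth1_affine: "smooth1 f \<Longrightarrow> smooth1 (\<lambda>x. f (a + b * x))"
  by (simp_all add: smooth1_def diff_times_const diff_times_add diff_times_mult diff_times_affine)

lemma smooth1_diff: "smooth1 f \<Longrightarrow> smooth1 g \<Longrightarrow> smooth1 (\<lambda>x. f x - g x)"
  using smooth1_add[of f "\<lambda>x. (-1) * g x"] smooth1_mult[OF smooth1_const[of "-1"], of g] by simp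

lemma smooth1_antiderivative:
  assumes "\<And>x. (F has_real_derivative f x) (at x)" "smooth1 f"
  shows "smooth1 F"
  unfolding smooth1_def
proof
  fix n show "diff_times n F" using assms by (cases n) (auto simp: smooth1_def)
qed

lemma smooth1_deriv:
  assumes "smooth1 f"
  shows "(f has_real_derivative deriv f x) (at x)" and "smooth1 (deriv f)"
proof -
  have *: "(\<forall>x. (f has_real_derivative deriv f x) (at x)) \<and> diff_times n (deriv f)" for n
  proof -
    have "diff_times (Suc n) f" using assms by (simp add: smooth1_def)
    then obtain f' where d: "\<forall>x. (f has_real_derivative f' x) (at x)" "diff_times n f'" by auto
    then have "deriv f = f'" using DERIV_imp_deriv by blast
    with d show ?thesis by simp
  qed
  show "(f has_real_derivative deriv f x) (at x)" "smooth1 (deriv f)"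
    using * by (auto simp: smooth1_def)
qed

lemma smooth1_continuous: "smooth1 f \<Longrightarrow> continuous_on S f"
  using smooth1_deriv(1) by (meson DERIV_isCont continuous_at_imp_continuous_on)

section \<open>The flat function exp (-1/x) and smoothed step functions\<close>

definition flat_exp :: "nat \<Rightarrow> real \<Rightarrow> real" where
  "flat_exp n x = (if x > 0 then exp (- 1 / x) / x ^ n else 0)"

lemma flat_exp_tendsto_0: "((flat_exp n) \<longlongrightarrow> 0) (at_right 0)"
proof -
  have "((\<lambda>x::real. exp (- 1 / x) / x ^ n) \<longlongrightarrow> 0) (at_right 0)"
    by real_asymp
  then show ?thesis
    by (rule Lim_transform_eventually)
       (auto simp: flat_exp_def eventually_at_right_less eventually_at_filter)
qed

text \<open>Dividing by powers of x gives a family whose derivatives are again combinations of its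
  members, so smoothness follows by induction with n arbitrary. At 0 the right difference quotient
  is \<open>flat_exp (Suc n)\<close>, which tends to 0.\<close>

lemma flat_exp_deriv:
  "(flat_exp n has_real_derivative flat_exp (n + 2) x - of_nat n * flat_exp (Suc n) x) (at x)"
proof -
  consider "x > 0" | "x < 0" | "x = 0" by linarith
  then show ?thesis
  proof cases
    case 1
    have "((\<lambda>x. exp (- 1 / x) / x ^ n) has_real_derivative
       (exp (- 1 / x) * (1 / x\<^sup>2) * x ^ n - exp (- 1 / x) * (of_nat n * x ^ (n - 1))) / (x ^ n * x ^ n)) (at x)"
      using 1 by (auto intro!: derivative_eq_intros simp: power2_eq_square)
    also have "(exp (- 1 / x) * (1 / x\<^sup>2) * x ^ n - exp (- 1 / x) * (of_nat n * x ^ (n - 1))) / (x ^ n * x ^ n)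
       = flat_exp (n + 2) x - of_nat n * flat_exp (Suc n) x"
      using 1 by (cases n) (simp_all add: flat_exp_def field_simps power2_eq_square)
    finally have "((\<lambda>x. exp (- 1 / x) / x ^ n) has_real_derivative
       flat_exp (n + 2) x - of_nat n * flat_exp (Suc n) x) (at x)" .
    then show ?thesis
      by (rule DERIV_cong_ev[THEN iffD1, rotated 3, OF _ refl])
         (use 1 in \<open>auto simp: flat_exp_def eventually_nhds intro!: exI[of _ "{0<..}"]\<close>)
  next
    case 2
    have "((\<lambda>x. 0) has_real_derivative 0) (at x)" by simp
    then have "(flat_exp n has_real_derivative 0) (at x)"
      by (rule DERIV_cong_ev[THEN iffD1, rotated 3, OF _ refl])
         (use 2 in \<open>auto simp: flat_exp_def eventually_nhds intro!: exI[of _ "{..<0}"]\<close>)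
    then show ?thesis using 2 by (simp add: flat_exp_def)
  next
    case 3
    have r: "((\<lambda>y. flat_exp n y / y) \<longlongrightarrow> 0) (at_right 0)"
    proof (rule Lim_transform_eventually[OF flat_exp_tendsto_0[of "Suc n"]])
      show "\<forall>\<^sub>F x in at_right 0. flat_exp (Suc n) x = flat_exp n x / x"
        by (auto simp: flat_exp_def eventually_at_filter)
    qed
    have "((\<lambda>y. flat_exp n y / y) \<longlongrightarrow> 0) (at_left 0)"
      by (rule Lim_transform_eventually[OF tendsto_const])
         (auto simp: flat_exp_def eventually_at_filter)
    with r have "((\<lambda>y. flat_exp n y / y) \<longlongrightarrow> 0) (at 0)"
      by (simp add: filterlim_split_at)
    then show ?thesis using 3
      by (simp add: has_field_derivative_iff flat_exp_def)
  qed
qed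

lemma diff_times_flat_exp: "diff_times m (flat_exp n)"
proof (induction m arbitrary: n)
  case (Suc m)
  have "diff_times m (\<lambda>x. flat_exp (n + 2) x + (- of_nat n) * flat_exp (Suc n) x)"
    by (intro diff_times_add diff_times_mult diff_times_const Suc)
  then show ?case
    using flat_exp_deriv[of n] by (auto intro!: exI[of _ "\<lambda>x. flat_exp (n + 2) x - of_nat n * flat_exp (Suc n) x"])
qed simp

lemma smooth1_flat_exp: "smooth1 (flat_exp n)"
  by (simp add: smooth1_def diff_times_flat_exp)

lemma continuous_has_antiderivative:
  fixes f :: "real \<Rightarrow> real"
  assumes "continuous_on UNIV f"
  obtains F where "\<And>x. (F has_real_derivative f x) (at x)" "F 0 = 0"
proof -
  obtain F where F: "\<And>x. (F has_vector_derivative f x) (at x)"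
    using einterval_antiderivative[of "-\<infinity>" "\<infinity>" f] assms
    by (auto simp: continuous_on_eq_continuous_at)
  then have "((\<lambda>x. F x - F 0) has_real_derivative f x) (at x)" for x
    using F[of x] by (auto simp: has_real_derivative_iff_has_vector_derivative intro!: derivative_eq_intros)
  then show ?thesis using that by force
qed

lemma DERIV_zero_interval_const:
  fixes F :: "real \<Rightarrow> real"
  assumes "\<And>x. (F has_real_derivative f x) (at x)" "convex S" "\<And>x. x \<in> S \<Longrightarrow> f x = 0"
    "x \<in> S" "y \<in> S"
  shows "F x = F y"
proof -
  have "\<exists>c. \<forall>x\<in>S. F x = c"
    by (rule has_field_derivative_zero_constant[OF assms(2)])
       (metis assms(1,3) has_field_derivative_at_within)
  with assms(4,5) show ?thesis by auto
qed

text \<open>\<open>\<rho>\<close> is a mollifier supported in the unit interval, \<open>H\<close> a smoothed Heaviside function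
  and \<open>R\<close> a smoothed positive part.\<close>
lemma mollifier_exists:
  obtains \<rho> H R :: "real \<Rightarrow> real" and c where
    "smooth1 \<rho>" "smooth1 H" "smooth1 R"
    "\<And>x. (H has_real_derivative \<rho> x) (at x)" "\<And>x. (R has_real_derivative H x) (at x)"
    "\<And>x. \<rho> x \<ge> 0" "\<And>x. x \<notin> {0<..<1} \<Longrightarrow> \<rho> x = 0"
    "\<And>x. x \<le> 0 \<Longrightarrow> H x = 0" "\<And>x. x \<ge> 1 \<Longrightarrow> H x = 1" "\<And>x. 0 \<le> H x \<and> H x \<le> 1"
    "\<And>x. x \<le> 0 \<Longrightarrow> R x = 0" "\<And>x. x \<ge> 1 \<Longrightarrow> R x = x + c"
proof -
  \<comment> \<open>The second factor is the reflected flat function, which makes the product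
    positive exactly on (0, 1). Its total mass F 1 is divided out below.\<close>
  define r where "r x = flat_exp 0 x * flat_exp 0 (1 + (-1) * x)" for x
  have r: "smooth1 r" unfolding r_def
    by (intro smooth1_mult smooth1_flat_exp smooth1_affine)
  have r0: "r x \<ge> 0" for x by (auto simp: r_def flat_exp_def)
  have rpos: "r x > 0" if "0 < x" "x < 1" for x using that by (auto simp: r_def flat_exp_def)
  have rz: "r x = 0" if "x \<notin> {0<..<1}" for x using that by (auto simp: r_def flat_exp_def)
  obtain F where F: "\<And>x. (F has_real_derivative r x) (at x)" "F 0 = 0"
    using continuous_has_antiderivative[OF smooth1_continuous[OF r]] by blast
  have "F 0 < F 1"
    by (rule DERIV_pos_imp_increasing_open[of 0 1 F])
       (use F rpos in \<open>auto intro!: continuous_at_imp_continuous_on DERIV_isCont\<close>)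
  then have F1: "F 1 > 0" using F by simp
  have Fmono: "F x \<le> F y" if "x \<le> y" for x y
    by (rule DERIV_nonneg_imp_nondecreasing[OF that]) (use F r0 in blast)
  have F0: "F x = 0" if "x \<le> 0" for x
    using DERIV_zero_interval_const[of F r "{..0}" x 0] F rz that by simp
  have F1': "F x = F 1" if "x \<ge> 1" for x
    using DERIV_zero_interval_const[of F r "{1..}" x 1] F rz that by simp
  define \<rho> where "\<rho> x = r x * (1 / F 1)" for x
  define H where "H x = F x * (1 / F 1)" for x
  have \<rho>: "smooth1 \<rho>" unfolding \<rho>_def by (intro smooth1_mult r smooth1_const)
  have dH: "(H has_real_derivative \<rho> x) (at x)" for x
    unfolding H_def \<rho>_def by (rule DERIV_cmult_right[OF F(1)])
  have H: "smooth1 H" using smooth1_antiderivative[OF dH \<rho>] .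
  obtain R where R: "\<And>x. (R has_real_derivative H x) (at x)" "R 0 = 0"
    using continuous_has_antiderivative[OF smooth1_continuous[OF H]] by blast
  have sR: "smooth1 R" using smooth1_antiderivative[OF R(1) H] .
  have H0: "H x = 0" if "x \<le> 0" for x using F0 that by (simp add: H_def)
  have H1: "H x = 1" if "x \<ge> 1" for x using F1'[OF that] F1 by (simp add: H_def)
  have H01: "0 \<le> H x \<and> H x \<le> 1" for x
  proof -
    have "0 \<le> F x" "F x \<le> F 1"
      using Fmono[of x "max x 1"] F1'[of "max x 1"] Fmono[of "min x 0" x] F0[of "min x 0"] by linarith+
    then show ?thesis using F1 by (simp add: H_def)
  qed
  have R0: "R x = 0" if "x \<le> 0" for x
    using DERIV_zero_interval_const[of R H "{..0}" x 0] R H0 that by simp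
  have R1: "R x = x + (R 1 - 1)" if "x \<ge> 1" for x
  proof -
    have "((\<lambda>x. R x - x) has_real_derivative H x - 1) (at x)" for x
      by (intro derivative_intros R)
    then show ?thesis
      using DERIV_zero_interval_const[of "\<lambda>x. R x - x" "\<lambda>x. H x - 1" "{1..}" x 1] H1 that by simp
  qed
  have \<rho>0: "\<rho> x \<ge> 0" "x \<notin> {0<..<1} \<Longrightarrow> \<rho> x = 0" for x
    using r0[of x] F1 rz[of x] by (auto simp: \<rho>_def)
  show ?thesis
    by (rule that[of \<rho> H R "R 1 - 1"]) (fact \<rho> H sR dH R(1) \<rho>0 H0 H1 H01 R0 R1)+
qed

section \<open>Du Bois-Reymond lemmas\<close>

lemma integrable_mult_bounded:
  fixes f g :: "'a \<Rightarrow> real"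
  assumes "integrable M f" "g \<in> borel_measurable M" "\<And>x. \<bar>g x\<bar> \<le> C"
  shows "integrable M (\<lambda>x. f x * g x)"
proof (rule Bochner_Integration.integrable_bound[of M "\<lambda>x. C * f x"])
  have "\<bar>f x\<bar> * \<bar>g x\<bar> \<le> \<bar>C\<bar> * \<bar>f x\<bar>" for x
    using mult_right_mono[of "\<bar>g x\<bar>" "\<bar>C\<bar>" "\<bar>f x\<bar>"] assms(3)[of x] by (simp add: mult.commute)
  then show "AE x in M. norm (f x * g x) \<le> norm (C * f x)" by (simp add: abs_mult)
qed (use assms in auto)

lemma integrable_continuous_support:
  fixes f :: "real \<Rightarrow> real"
  assumes "continuous_on UNIV f" "\<And>x. x \<notin> {a..b} \<Longrightarrow> f x = 0"
  shows "integrable lborel f"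
proof -
  have "integrable lborel (\<lambda>x. indicator {a..b} x *\<^sub>R f x)"
    by (intro borel_integrable_compact continuous_on_subset[OF assms(1)]) auto
  also have "(\<lambda>x. indicator {a..b} x *\<^sub>R f x) = f" using assms(2) by (auto simp: fun_eq_iff indicator_def)
  finally show ?thesis .
qed

lemma continuous_support_bounded:
  fixes f :: "real \<Rightarrow> real"
  assumes "continuous_on UNIV f" "\<And>x. x \<notin> {a..b} \<Longrightarrow> f x = 0"
  obtains M where "M \<ge> 0" "\<And>x. \<bar>f x\<bar> \<le> M"
proof -
  have "compact (f ` {a..b})"
    by (intro compact_continuous_image continuous_on_subset[OF assms(1)]) auto
  then obtain M where M: "\<And>x. x \<in> {a..b} \<Longrightarrow> \<bar>f x\<bar> \<le> M"
    by (meson bounded_real compact_imp_bounded imageI)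
  have "\<bar>f x\<bar> \<le> max M 0" for x
    using M[of x] assms(2)[of x] by (cases "x \<in> {a..b}") auto
  then show ?thesis using that[of "max M 0"] by auto
qed

section \<open>Test functions on an interval and approximate step functions\<close>

definition test1 :: "real \<Rightarrow> real \<Rightarrow> (real \<Rightarrow> real) \<Rightarrow> bool" where
  "test1 A B \<eta> \<longleftrightarrow> smooth1 \<eta> \<and> (\<exists>a b. A < a \<and> a < b \<and> b < B \<and> (\<forall>x. x \<notin> {a..b} \<longrightarrow> \<eta> x = 0))"

lemma deriv_eq_0_outside:
  assumes "\<And>x. x \<notin> {a..b} \<Longrightarrow> \<eta> x = (0::real)" "x \<notin> {a..b::real}"
  shows "deriv \<eta> x = 0"
proof (rule DERIV_imp_deriv)
  have "((\<lambda>_. 0) has_real_derivative 0) (at x)" by simp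
  then show "(\<eta> has_real_derivative 0) (at x)"
  proof (rule has_field_derivative_transform_within_open)
    show "open (- {a..b})" by (simp add: open_Compl)
  qed (use assms in auto)
qed

lemma test1_deriv: "test1 A B \<eta> \<Longrightarrow> test1 A B (deriv \<eta>)"
  unfolding test1_def by (meson deriv_eq_0_outside smooth1_deriv(2))

lemma test1_smooth: "test1 A B \<eta> \<Longrightarrow> smooth1 \<eta>"
  by (simp add: test1_def)

lemma test1_outside: "test1 A B \<eta> \<Longrightarrow> x \<notin> {A<..<B} \<Longrightarrow> \<eta> x = 0"
  by (auto simp: test1_def)

lemma test1_continuous: "test1 A B \<eta> \<Longrightarrow> continuous_on S \<eta>"
  by (simp add: smooth1_continuous test1_def)

lemma test1_measurable: "test1 A B \<eta> \<Longrightarrow> \<eta> \<in> borel_measurable borel"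
  by (intro borel_measurable_continuous_onI test1_continuous)

lemma test1_bounded:
  assumes "test1 A B \<eta>" obtains M where "M \<ge> 0" "\<And>x. \<bar>\<eta> x\<bar> \<le> M"
  using continuous_support_bounded[of \<eta> A B] test1_continuous[OF assms] test1_outside[OF assms]
  by (metis atLeastAtMost_iff greaterThanLessThan_iff order_less_imp_le)

text \<open>Substituting s = N (x - t) moves the scaling into W, and dominated convergence applies.
  The centres t n may move, so that the limit point can be an end point of an interval while the
  bumps stay inside it.\<close>

lemma mollifier_tendsto:
  fixes W \<rho> :: "real \<Rightarrow> real" and t N :: "nat \<Rightarrow> real"
  assumes W: "continuous_on UNIV W" and \<rho>: "continuous_on UNIV \<rho>" "\<And>x. x \<notin> {0<..<1} \<Longrightarrow> \<rho> x = 0"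
    and int: "(LBINT x. \<rho> x) = 1"
    and t: "t \<longlonglongrightarrow> a" and N: "filterlim N at_top sequentially" "\<And>n. N n \<ge> 1"
  shows "(\<lambda>n. LBINT x. W x * (N n * \<rho> (N n * (x - t n)))) \<longlonglongrightarrow> W a"
proof -
  have \<rho>i: "integrable lborel \<rho>" by (rule integrable_continuous_support[OF \<rho>(1), of 0 1]) (rule \<rho>(2), auto)
  have eq: "(LBINT x. W x * (N n * \<rho> (N n * (x - t n)))) = (LBINT s. W (t n + s / N n) * \<rho> s)" for n
  proof -
    have n0: "N n > 0" using N(2)[of n] by linarith
    have "(LBINT x. W x * (N n * \<rho> (N n * (x - t n))))
      = \<bar>1 / N n\<bar> *\<^sub>R (LBINT s. W (t n + 1 / N n * s) * (N n * \<rho> (N n * (t n + 1 / N n * s - t n))))"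
      by (rule lborel_integral_real_affine) (use n0 in simp)
    also have "\<dots> = (LBINT s. W (t n + s / N n) * \<rho> s)"
      using n0 by (simp flip: integral_mult_right_zero)
    finally show ?thesis .
  qed
  have "Bseq t" using t by (meson convergentI convergent_imp_Bseq)
  then obtain b where b: "\<And>n. \<bar>t n\<bar> \<le> b" by (auto simp: Bseq_def)
  \<comment> \<open>Where \<open>\<rho>\<close> is nonzero, s lies in (0, 1); together with N n
    \<ge> 1 this keeps t n + s / N n in [-b, b + 1].\<close>
  have "compact (W ` {-b..b+1})" by (intro compact_continuous_image continuous_on_subset[OF W]) auto
  then obtain M where M: "\<And>x. x \<in> {-b..b+1} \<Longrightarrow> \<bar>W x\<bar> \<le> M"
    by (meson bounded_real compact_imp_bounded imageI)
  have [measurable]: "W \<in> borel_measurable borel" "\<rho> \<in> borel_measurable borel"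
    using W \<rho> by (auto intro: borel_measurable_continuous_onI)
  have bd: "\<bar>W (t n + s / N n) * \<rho> s\<bar> \<le> M * \<bar>\<rho> s\<bar>" for n s
  proof (cases "s \<in> {0<..<1}")
    case True
    then have "0 \<le> s / N n" "s / N n \<le> 1" using N(2)[of n] by (auto simp: field_simps)
    then have "t n + s / N n \<in> {-b..b+1}" using b[of n] by auto
    then show ?thesis using M by (simp add: abs_mult mult_right_mono)
  qed (use \<rho>(2) in simp)
  have lim: "(\<lambda>n. W (t n + s / N n) * \<rho> s) \<longlonglongrightarrow> W a * \<rho> s" for s
  proof -
    have "(\<lambda>n. t n + s / N n) \<longlonglongrightarrow> a + 0"
      by (intro tendsto_add t real_tendsto_divide_at_top[OF tendsto_const] N)
    then have "(\<lambda>n. W (t n + s / N n)) \<longlonglongrightarrow> W a"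
      using W by (intro isCont_tendsto_compose[of _ W]) (auto simp: continuous_on_eq_continuous_at)
    then show ?thesis by (intro tendsto_mult tendsto_const)
  qed
  have "(\<lambda>n. LBINT s. W (t n + s / N n) * \<rho> s) \<longlonglongrightarrow> (LBINT s. W a * \<rho> s)"
  proof (rule integral_dominated_convergence[where w="\<lambda>s. M * \<bar>\<rho> s\<bar>"])
    show "integrable lborel (\<lambda>s. M * \<bar>\<rho> s\<bar>)" using \<rho>i by auto
  qed (use bd lim in auto)
  then show ?thesis using int by (simp add: eq)
qed

lemma mollifier_integral:
  assumes "\<And>x. (H has_real_derivative \<rho> x) (at x)" "continuous_on UNIV \<rho>"
    "\<And>x. x \<notin> {0<..<1} \<Longrightarrow> \<rho> x = 0" "H 0 = 0" "H 1 = 1"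
  shows "(LBINT x. \<rho> x) = (1::real)"
proof -
  have "(LBINT x. \<rho> x * indicator {0..1} x) = H 1 - H 0"
    by (rule integral_FTC_Icc_real) (use assms in \<open>auto simp: continuous_on_eq_continuous_at\<close>)
  also have "(\<lambda>x. \<rho> x * indicator {0..1} x) = \<rho>"
  proof
    show "\<rho> x * indicator {0..1} x = \<rho> x" for x
      using assms(3)[of x] by (cases "x \<in> {0..1}") auto
  qed
  finally show ?thesis using assms by simp
qed

text \<open>Clamping the argument to [A, B] extends W to the whole line, as the mollifier limit
  requires.\<close>

lemma clamp_extension:
  fixes W :: "real \<Rightarrow> real"
  assumes "continuous_on {A..B} W" "A \<le> B"
  obtains W' where "continuous_on UNIV W'" "\<And>x. x \<in> {A..B} \<Longrightarrow> W' x = W x"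
proof (rule that[of "\<lambda>x. W (max A (min B x))"])
  show "continuous_on UNIV (\<lambda>x. W (max A (min B x)))"
    by (rule continuous_on_compose2[OF assms(1)]) (use assms in \<open>auto intro!: continuous_intros\<close>)
qed auto

text \<open>The tests are differences of two smoothed Heaviside functions, and their derivatives are
  two opposite approximate Dirac masses. These approach a and b from inside the interval, so a = A
  and b = B are allowed.\<close>

lemma test1_step_approximation:
  assumes "A \<le> a" "a < b" "b \<le> B"
  obtains \<eta> :: "nat \<Rightarrow> real \<Rightarrow> real" where
    "\<And>n. test1 A B (\<eta> n)" "\<And>n x. \<bar>\<eta> n x\<bar> \<le> 1" "\<And>x. (\<lambda>n. \<eta> n x) \<longlonglongrightarrow> indicator {a<..<b} x"
    "\<And>W. continuous_on {A..B} W \<Longrightarrow> (\<lambda>n. LBINT x. W x * deriv (\<eta> n) x) \<longlonglongrightarrow> W a - W b"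
proof -
  obtain \<rho> H R :: "real \<Rightarrow> real" and c where m:
    "smooth1 \<rho>" "smooth1 H" "\<And>x. (H has_real_derivative \<rho> x) (at x)"
    "\<And>x. \<rho> x \<ge> 0" "\<And>x. x \<notin> {0<..<1} \<Longrightarrow> \<rho> x = 0"
    "\<And>x. x \<le> 0 \<Longrightarrow> H x = 0" "\<And>x. x \<ge> 1 \<Longrightarrow> H x = 1" "\<And>x. 0 \<le> H x \<and> H x \<le> 1"
    by (rule mollifier_exists) blast
  obtain n0 :: nat where n0: "n0 \<ge> 1" "n0 * (b - a) \<ge> 3"
  proof -
    obtain k :: nat where "k > 3 / (b - a)" using reals_Archimedean2 by blast
    then have "real (Suc k) * (b - a) \<ge> 3" using assms by (simp add: field_simps)
    then show ?thesis using that[of "Suc k"] by simp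
  qed
  define N where "N n = real n + real n0" for n
  have N1: "N n \<ge> 1" for n using n0 by (simp add: N_def)
  have Nb: "N n * (b - a) \<ge> 3" for n
    using n0 assms by (simp add: N_def distrib_right) (smt (verit) mult_nonneg_nonneg of_nat_0_le_iff)
  have Ninf: "filterlim N at_top sequentially" unfolding N_def by real_asymp
  \<comment> \<open>The rise occupies [a + 1/N, a + 2/N] and the fall [b - 2/N, b - 1/N], so the
    support stays strictly inside (a, b). The bound N (b - a) \<ge> 3 is exactly s n \<le> t
    n.\<close>
  define s t where "s n = a + 1 / N n" and "t n = b - 2 / N n" for n
  have st: "s \<longlonglongrightarrow> a" "t \<longlonglongrightarrow> b"
  proof -
    have "(\<lambda>n. a + 1 / N n) \<longlonglongrightarrow> a + 0" "(\<lambda>n. b - 2 / N n) \<longlonglongrightarrow> b - 0"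
      by (intro tendsto_add tendsto_diff tendsto_const real_tendsto_divide_at_top[OF tendsto_const] Ninf)+
    then show "s \<longlonglongrightarrow> a" "t \<longlonglongrightarrow> b" by (simp_all add: s_def t_def[abs_def] s_def[abs_def])
  qed
  have sN: "N n * (x - s n) = N n * (x - a) - 1" "N n * (x - t n) = N n * (x - b) + 2" for n x
    using N1[of n] by (auto simp: s_def t_def field_simps)
  define \<eta> where "\<eta> n x = H (N n * (x - s n)) - H (N n * (x - t n))" for n x
  have aff: "smooth1 (\<lambda>x. H (k * (x - u)))" for k u
    using smooth1_affine[OF m(2), of "- k * u" k] by (simp add: algebra_simps)
  have sm: "smooth1 (\<eta> n)" for n
    unfolding \<eta>_def by (intro smooth1_diff aff)
  have out: "\<eta> n x = 0" if "x \<notin> {a + 1 / N n..b - 1 / N n}" for n x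
  proof -
    have p: "N n > 0" using N1[of n] by linarith
    from that consider "x < a + 1 / N n" | "x > b - 1 / N n" by fastforce
    then show ?thesis
    proof cases
      case 1
      then have "N n * (x - a) \<le> 1" using p by (simp add: field_simps)
      moreover have "N n * (x - b) = N n * (x - a) - N n * (b - a)" by (simp add: algebra_simps)
      ultimately have "H (N n * (x - s n)) = 0" "H (N n * (x - t n)) = 0"
        using Nb[of n] unfolding sN by (intro m(6); linarith)+
      then show ?thesis by (simp add: \<eta>_def)
    next
      case 2
      then have "N n * (x - b) \<ge> - 1" using p by (simp add: field_simps)
      moreover have "N n * (x - b) = N n * (x - a) - N n * (b - a)" by (simp add: algebra_simps)
      ultimately have "H (N n * (x - s n)) = 1" "H (N n * (x - t n)) = 1"
        using Nb[of n] unfolding sN by (intro m(7); linarith)+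
      then show ?thesis by (simp add: \<eta>_def)
    qed
  qed
  have t1: "test1 A B (\<eta> n)" for n
  proof -
    have p: "N n > 0" using N1[of n] by linarith
    have "b - a \<ge> 3 / N n" using Nb[of n] p by (simp add: field_simps)
    moreover have "1 / N n > 0" "3 / N n = 3 * (1 / N n)" using p by auto
    ultimately have "A < a + 1 / N n" "a + 1 / N n < b - 1 / N n" "b - 1 / N n < B"
      using assms by linarith+
    then show ?thesis unfolding test1_def using sm out by blast
  qed
  have bd: "\<bar>\<eta> n x\<bar> \<le> 1" for n x
    using m(8)[of "N n * (x - s n)"] m(8)[of "N n * (x - t n)"] by (auto simp: \<eta>_def)
  have lim: "(\<lambda>n. \<eta> n x) \<longlonglongrightarrow> indicator {a<..<b} x" for x
  proof (cases "x \<in> {a<..<b}")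
    case True
    have "eventually (\<lambda>n. N n > 2 / (x - a) \<and> N n > 2 / (b - x)) sequentially"
      using Ninf by (auto simp: filterlim_at_top_dense eventually_conj_iff)
    then have "eventually (\<lambda>n. indicator {a<..<b} x = \<eta> n x) sequentially"
    proof eventually_elim
      case (elim n)
      then have "N n * (x - a) \<ge> 2" "N n * (x - b) \<le> - 2" using True by (auto simp: field_simps)
      then have "H (N n * (x - s n)) = 1" "H (N n * (x - t n)) = 0"
        unfolding sN by (intro m(6,7); linarith)+
      then show ?case using True by (simp add: \<eta>_def)
    qed
    then show ?thesis by (rule Lim_transform_eventually[OF tendsto_const])
  next
    case False
    then have "\<eta> n x = 0" for n
    proof -
      have "1 / N n > 0" using N1[of n] by simp
      with False show ?thesis by (intro out, unfold atLeastAtMost_iff greaterThanLessThan_iff) linarith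
    qed
    then show ?thesis using False by simp
  qed
  have int1: "(LBINT x. \<rho> x) = 1"
    by (rule mollifier_integral[of H]) (use m smooth1_continuous in auto)
  have dchi: "deriv (\<eta> n) x = N n * \<rho> (N n * (x - s n)) - N n * \<rho> (N n * (x - t n))" for n x
  proof (rule DERIV_imp_deriv)
    have "((\<lambda>x. H (N n * (x - u))) has_real_derivative \<rho> (N n * (x - u)) * N n) (at x)" for u
      by (rule DERIV_chain2[of H]) (auto intro!: derivative_eq_intros m)
    then have "((\<lambda>x. H (N n * (x - u))) has_real_derivative N n * \<rho> (N n * (x - u))) (at x)" for u
      by (simp add: mult.commute)
    then show "(\<eta> n has_real_derivative N n * \<rho> (N n * (x - s n)) - N n * \<rho> (N n * (x - t n))) (at x)"
      unfolding \<eta>_def by (intro DERIV_diff)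
  qed
  have dlim: "(\<lambda>n. LBINT x. W x * deriv (\<eta> n) x) \<longlonglongrightarrow> W a - W b" if W: "continuous_on {A..B} W" for W
  proof -
    have "A \<le> B" using assms by linarith
    then obtain V where V: "continuous_on UNIV V" "\<And>x. x \<in> {A..B} \<Longrightarrow> V x = W x"
      by (rule clamp_extension[OF W]) blast
    have WV: "W x * deriv (\<eta> n) x = V x * deriv (\<eta> n) x" for n x
      using test1_outside[OF test1_deriv[OF t1[of n]], of x] V(2)[of x] by fastforce
    have VI: "(LBINT x. V x * deriv (\<eta> n) x)
       = (LBINT x. V x * (N n * \<rho> (N n * (x - s n)))) - (LBINT x. V x * (N n * \<rho> (N n * (x - t n))))" for n
    proof -
      have p: "N n > 0" using N1[of n] by linarith
      have *: "integrable lborel (\<lambda>x. V x * (N n * \<rho> (N n * (x - u))))" for u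
      proof (rule integrable_continuous_support[of _ u "u + 1 / N n"])
        show "continuous_on UNIV (\<lambda>x. V x * (N n * \<rho> (N n * (x - u))))"
          by (intro continuous_intros V continuous_on_compose2[OF smooth1_continuous[OF m(1), of UNIV]]) auto
        show "V x * (N n * \<rho> (N n * (x - u))) = 0" if "x \<notin> {u..u + 1 / N n}" for x
        proof -
          have "N n * (x - u) \<notin> {0<..<1}" using that p by (auto simp: field_simps zero_less_mult_iff)
          then show ?thesis using m(5) by simp
        qed
      qed
      show ?thesis
        unfolding dchi right_diff_distrib[of "V _"] by (rule Bochner_Integration.integral_diff[OF * *])
    qed
    moreover have "A \<le> B" using assms by linarith
    moreover have "(\<lambda>n. (LBINT x. V x * (N n * \<rho> (N n * (x - s n))))
        - (LBINT x. V x * (N n * \<rho> (N n * (x - t n))))) \<longlonglongrightarrow> V a - V b"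
      by (intro tendsto_diff mollifier_tendsto V smooth1_continuous m(1) m(5) int1 st Ninf N1)
    ultimately show ?thesis unfolding WV VI using V(2)[of a] V(2)[of b] assms by simp
  qed
  show ?thesis by (rule that[OF t1 bd lim dlim])
qed

section \<open>Continuous functions with integrable weak derivatives in one variable\<close>

lemma du_Bois_Reymond_first:
  fixes W G :: "real \<Rightarrow> real"
  assumes W: "continuous_on {A..B} W" and G: "integrable lborel G"
    and eq: "\<And>\<eta>. test1 A B \<eta> \<Longrightarrow> (LBINT x. W x * deriv \<eta> x) = - (LBINT x. G x * \<eta> x)"
    and ab: "A \<le> a" "a < b" "b \<le> B"
  shows "W b - W a = (LBINT x. G x * indicator {a<..<b} x)"
proof -
  obtain \<eta> where \<eta>: "\<And>n. test1 A B (\<eta> n)" "\<And>n x. \<bar>\<eta> n x\<bar> \<le> 1" "\<And>x. (\<lambda>n. \<eta> n x) \<longlonglongrightarrow> indicator {a<..<b} x"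
    "\<And>W. continuous_on {A..B} W \<Longrightarrow> (\<lambda>n. LBINT x. W x * deriv (\<eta> n) x) \<longlonglongrightarrow> W a - W b"
    by (rule test1_step_approximation[OF ab]) blast
  have [measurable]: "\<eta> n \<in> borel_measurable borel" for n by (rule test1_measurable[OF \<eta>(1)])
  have [measurable]: "G \<in> borel_measurable borel" using G by auto
  have "(\<lambda>n. LBINT x. G x * \<eta> n x) \<longlonglongrightarrow> (LBINT x. G x * indicator {a<..<b} x)"
  proof (rule integral_dominated_convergence[where w="\<lambda>x. \<bar>G x\<bar>"])
    show "AE x in lborel. norm (G x * \<eta> n x) \<le> \<bar>G x\<bar>" for n
      using \<eta>(2) by (auto simp: abs_mult intro!: mult_left_le)
    show "AE x in lborel. (\<lambda>n. G x * \<eta> n x) \<longlonglongrightarrow> G x * indicator {a<..<b} x"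
      using \<eta>(3) by (auto intro!: tendsto_mult)
  qed (use G in auto)
  then have "(\<lambda>n. LBINT x. W x * deriv (\<eta> n) x) \<longlonglongrightarrow> - (LBINT x. G x * indicator {a<..<b} x)"
    unfolding eq[OF \<eta>(1)] by (rule tendsto_minus)
  from LIMSEQ_unique[OF this \<eta>(4)[OF W]] show ?thesis by simp
qed

text \<open>Rescaled as R (N x) / N, the function differs from max 0 x by at most C / N, and its
  second derivative is a mollifier. Shifted copies therefore smooth piecewise linear
  functions.\<close>

lemma smooth_positive_part:
  obtains R H \<rho> :: "real \<Rightarrow> real" and C where
    "smooth1 R" "smooth1 \<rho>" "\<And>x. (R has_real_derivative H x) (at x)" "\<And>x. (H has_real_derivative \<rho> x) (at x)"
    "\<And>x. x \<notin> {0<..<1} \<Longrightarrow> \<rho> x = 0" "(LBINT x. \<rho> x) = 1"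
    "\<And>x. \<bar>R x - max 0 x\<bar> \<le> C" "\<And>x. x \<le> 0 \<Longrightarrow> R x = 0" "\<And>x. x \<ge> 1 \<Longrightarrow> R x = R 1 + (x - 1)"
proof -
  obtain \<rho> H R :: "real \<Rightarrow> real" and c where m:
    "smooth1 \<rho>" "smooth1 H" "smooth1 R"
    "\<And>x. (H has_real_derivative \<rho> x) (at x)" "\<And>x. (R has_real_derivative H x) (at x)"
    "\<And>x. \<rho> x \<ge> 0" "\<And>x. x \<notin> {0<..<1} \<Longrightarrow> \<rho> x = 0"
    "\<And>x. x \<le> 0 \<Longrightarrow> H x = 0" "\<And>x. x \<ge> 1 \<Longrightarrow> H x = 1" "\<And>x. 0 \<le> H x \<and> H x \<le> 1"
    "\<And>x. x \<le> 0 \<Longrightarrow> R x = 0" "\<And>x. x \<ge> 1 \<Longrightarrow> R x = x + c"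
    by (rule mollifier_exists) blast
  have "compact (R ` {0..1})"
    by (intro compact_continuous_image smooth1_continuous m) auto
  then obtain M where M: "\<And>x. x \<in> {0..1} \<Longrightarrow> \<bar>R x\<bar> \<le> M"
    by (meson bounded_real compact_imp_bounded imageI)
  have bd: "\<bar>R x - max 0 x\<bar> \<le> \<bar>M\<bar> + \<bar>c\<bar> + 1" for x
  proof -
    consider "x \<le> 0" | "0 \<le> x" "x \<le> 1" | "x \<ge> 1" by linarith
    then show ?thesis
    proof cases
      case 2
      then have "\<bar>R x\<bar> \<le> M" using M[of x] by auto
      then show ?thesis using 2 by linarith
    qed (simp_all add: m(11) m(12))
  qed
  have i1: "(LBINT x. \<rho> x) = 1"
    by (rule mollifier_integral[of H]) (use m smooth1_continuous in auto)
  have R1: "R x = R 1 + (x - 1)" if "x \<ge> 1" for x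
    using m(12)[OF that] m(12)[of 1] by linarith
  show ?thesis by (rule that[OF m(3,1,5,4,7) i1 bd m(11) R1])
qed

text \<open>The kernel is minus the Green function of the Dirichlet problem on \<open>(0, L)\<close>.\<close>
lemma du_Bois_Reymond_second:
  fixes W G :: "real \<Rightarrow> real"
  assumes W: "continuous_on {0..L} W" "W 0 = 0" "W L = 0" and G: "integrable lborel G"
    and eq: "\<And>\<eta>. test1 0 L \<eta> \<Longrightarrow> (LBINT x. W x * deriv (deriv \<eta>) x) = (LBINT x. G x * \<eta> x)"
    and m: "0 < m" "m < L"
  shows "W m = (LBINT s. G s * (indicator {0<..<L} s * (m * s / L - min m s)))"
proof -
  obtain R H \<rho> :: "real \<Rightarrow> real" and C where
    R: "smooth1 R" "smooth1 \<rho>" "\<And>x. (R has_real_derivative H x) (at x)" "\<And>x. (H has_real_derivative \<rho> x) (at x)"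
    "\<And>x. x \<notin> {0<..<1} \<Longrightarrow> \<rho> x = 0" "(LBINT x. \<rho> x) = 1"
    "\<And>x. \<bar>R x - max 0 x\<bar> \<le> C" "\<And>x. x \<le> 0 \<Longrightarrow> R x = 0" "\<And>x. x \<ge> 1 \<Longrightarrow> R x = R 1 + (x - 1)"
    by (rule smooth_positive_part) blast
  have C0: "C \<ge> 0" using R(7)[of 0] by linarith
  obtain n0 :: nat where n0: "n0 \<ge> 1" "n0 * m \<ge> 3" "n0 * (L - m) \<ge> 3"
  proof -
    obtain k :: nat where "k > 3 / m" using reals_Archimedean2 by blast
    moreover obtain j :: nat where "j > 3 / (L - m)" using reals_Archimedean2 by blast
    ultimately have "k * m \<ge> 3" "j * (L - m) \<ge> 3" using m by (simp_all add: field_simps)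
    moreover have "Suc (k + j) * m \<ge> k * m" "Suc (k + j) * (L - m) \<ge> j * (L - m)"
      using m by (intro mult_right_mono; simp)+
    ultimately show ?thesis using that[of "Suc (k + j)"] by linarith
  qed
  define N where "N n = real n + real n0" for n
  have N1: "N n \<ge> 1" for n using n0 by (simp add: N_def)
  have Np: "N n > 0" for n using N1[of n] by linarith
  have Nm: "N n * m \<ge> 3" "N n * (L - m) \<ge> 3" for n
  proof -
    have "real n0 * m \<le> N n * m" "real n0 * (L - m) \<le> N n * (L - m)"
      using m by (intro mult_right_mono; simp add: N_def)+
    then show "N n * m \<ge> 3" "N n * (L - m) \<ge> 3" using n0 by linarith+
  qed
  have Ninf: "filterlim N at_top sequentially" unfolding N_def by real_asymp
  \<comment> \<open>Since t n + 1 / N n = L - 1 / N n, the three smoothing intervals stay inside (0,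
    L) while the outer kinks tend to 0 and L.\<close>
  define s t where "s n = 1 / N n" and "t n = L - 2 / N n" for n
  have st: "s \<longlonglongrightarrow> 0" "t \<longlonglongrightarrow> L"
  proof -
    have "(\<lambda>n. 1 / N n) \<longlonglongrightarrow> 0" "(\<lambda>n. L - 2 / N n) \<longlonglongrightarrow> L - 0"
      by (intro tendsto_diff tendsto_const real_tendsto_divide_at_top[OF tendsto_const] Ninf)+
    then show "s \<longlonglongrightarrow> 0" "t \<longlonglongrightarrow> L" by (simp_all add: t_def[abs_def] s_def[abs_def])
  qed
  have ord: "0 < s n" "s n < m" "m < t n" "t n + 1 / N n < L" for n
  proof -
    have "1 / N n < m" using Nm(1)[of n] Np[of n] by (simp add: field_simps)
    moreover have "m < L - 2 / N n" using Nm(2)[of n] Np[of n] by (simp add: field_simps)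
    moreover have "1 / N n > 0" "2 / N n = 2 * (1 / N n)" using Np[of n] by simp_all
    ultimately show "0 < s n" "s n < m" "m < t n" "t n + 1 / N n < L"
      unfolding s_def t_def by linarith+
  qed
  define r where "r n u x = R (N n * (x - u)) / N n" for n u x
  \<comment> \<open>A smoothed hat with kinks at s n, m and t n. The coefficients have zero sum and
    zero first moment, so both the linear parts and the constants (R 1 - 1) / N n cancel to the
    right of the last kink.\<close>
  define \<eta> where "\<eta> n x = (t n - m) * r n (s n) x - (t n - s n) * r n m x + (m - s n) * r n (t n) x" for n x
  have dr: "((\<lambda>x. r n u x) has_real_derivative H (N n * (x - u))) (at x)" for n u x
  proof -
    have "((\<lambda>x. R (N n * (x - u))) has_real_derivative H (N n * (x - u)) * N n) (at x)"
      by (rule DERIV_chain2[of R]) (auto intro!: derivative_eq_intros R)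
    from DERIV_cdivide[OF this, of "N n"] show ?thesis using Np[of n] by (simp add: r_def)
  qed
  have dH: "((\<lambda>x. H (N n * (x - u))) has_real_derivative N n * \<rho> (N n * (x - u))) (at x)" for n u x
  proof -
    have "((\<lambda>x. H (N n * (x - u))) has_real_derivative \<rho> (N n * (x - u)) * N n) (at x)"
      by (rule DERIV_chain2[of H]) (auto intro!: derivative_eq_intros R)
    then show ?thesis by (simp add: mult.commute)
  qed
  have d1: "deriv (\<eta> n) x = (t n - m) * H (N n * (x - s n)) - (t n - s n) * H (N n * (x - m))
     + (m - s n) * H (N n * (x - t n))" for n x
    unfolding \<eta>_def by (intro DERIV_imp_deriv DERIV_add DERIV_diff DERIV_cmult dr)
  define d where "d n u x = N n * \<rho> (N n * (x - u))" for n u x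
  have d2: "deriv (deriv (\<eta> n)) x = (t n - m) * d n (s n) x - (t n - s n) * d n m x
     + (m - s n) * d n (t n) x" for n x
    unfolding d1[abs_def] d_def by (intro DERIV_imp_deriv DERIV_add DERIV_diff DERIV_cmult dH)
  have sr: "smooth1 (r n u)" for n u
  proof -
    have "smooth1 (\<lambda>x. R (- N n * u + N n * x) * (1 / N n))"
      by (rule smooth1_mult[OF smooth1_affine[OF R(1)] smooth1_const])
    moreover have "(\<lambda>x. R (- N n * u + N n * x) * (1 / N n)) = r n u"
      by (simp add: r_def fun_eq_iff algebra_simps)
    ultimately show ?thesis by simp
  qed
  have s\<eta>: "smooth1 (\<eta> n)" for n
    unfolding \<eta>_def
    by (rule smooth1_add[OF smooth1_diff]; rule smooth1_mult[OF smooth1_const sr])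
  have r0: "r n u x = 0" if "x \<le> u" for n u x
    using R(8)[of "N n * (x - u)"] that Np[of n] by (simp add: r_def mult_nonneg_nonpos)
  have r1: "r n u x = (R 1 - 1) / N n + (x - u)" if "x \<ge> u + 1 / N n" for n u x
  proof -
    have "N n * (x - u) \<ge> 1" using that Np[of n] by (simp add: field_simps)
    from R(9)[OF this] show ?thesis using Np[of n] by (simp add: r_def field_simps)
  qed
  have out: "\<eta> n x = 0" if "x \<notin> {s n..t n + 1 / N n}" for n x
  proof -
    from that consider "x < s n" | "x > t n + 1 / N n" by fastforce
    then show ?thesis
    proof cases
      case 1
      then have "r n (s n) x = 0" "r n m x = 0" "r n (t n) x = 0"
        using ord[of n] by (intro r0; linarith)+
      then show ?thesis by (simp add: \<eta>_def)
    next
      case 2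
      have "r n (s n) x = (R 1 - 1) / N n + (x - s n)" "r n m x = (R 1 - 1) / N n + (x - m)"
        "r n (t n) x = (R 1 - 1) / N n + (x - t n)"
        using ord[of n] 2 by (intro r1; linarith)+
      then show ?thesis unfolding \<eta>_def by algebra
    qed
  qed
  have t1: "test1 0 L (\<eta> n)" for n
  proof -
    have "1 / N n > 0" using Np[of n] by simp
    then have "s n < t n + 1 / N n" using ord[of n] by linarith
    then show ?thesis unfolding test1_def
      by (intro conjI exI[of _ "s n"] exI[of _ "t n + 1 / N n"] allI impI s\<eta> out ord)
  qed
  \<comment> \<open>The limit hat: slopes L - m and - m, peak m (L - m) at m, zero outside (0, L).
    Then - \<open>\<tau>\<close> / L is the kernel in the claim.\<close>
  define \<tau> where "\<tau> x = (L - m) * max 0 x - L * max 0 (x - m) + m * max 0 (x - L)" for x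
  have rl: "(\<lambda>n. r n (v n) x) \<longlonglongrightarrow> max 0 (x - u)" if "v \<longlonglongrightarrow> u" for v u x
  proof -
    have c: "\<bar>r n (v n) x - max 0 (x - v n)\<bar> \<le> C / N n" for n
    proof -
      have "max 0 (x - v n) = max 0 (N n * (x - v n)) / N n"
        using Np[of n] by (simp add: max_def field_simps zero_le_mult_iff mult_le_0_iff)
      then have "r n (v n) x - max 0 (x - v n) = (R (N n * (x - v n)) - max 0 (N n * (x - v n))) / N n"
        by (simp add: r_def diff_divide_distrib)
      then show ?thesis using R(7) Np[of n] by (simp add: abs_divide divide_right_mono)
    qed
    have c0: "(\<lambda>n. C / N n) \<longlonglongrightarrow> 0"
      by (intro real_tendsto_divide_at_top[OF tendsto_const] Ninf)
    have "(\<lambda>n. r n (v n) x - max 0 (x - v n)) \<longlonglongrightarrow> 0"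
      by (rule Lim_null_comparison[OF _ c0]) (simp only: real_norm_def c eventually_True)
    moreover have "(\<lambda>n. max 0 (x - v n)) \<longlonglongrightarrow> max 0 (x - u)"
      by (intro tendsto_max tendsto_diff tendsto_const that)
    ultimately show ?thesis using tendsto_add by fastforce
  qed
  have lim: "(\<lambda>n. \<eta> n x) \<longlonglongrightarrow> \<tau> x" for x
  proof -
    have "(\<lambda>n. \<eta> n x) \<longlonglongrightarrow> (L - m) * max 0 (x - 0) - (L - 0) * max 0 (x - m) + (m - 0) * max 0 (x - L)"
      unfolding \<eta>_def by (intro tendsto_intros st rl)
    then show ?thesis by (simp add: \<tau>_def)
  qed
  \<comment> \<open>Three terms, each with a coefficient of at most L and a smoothed kink of at most
    L + C.\<close>
  have bd: "\<bar>\<eta> n x\<bar> \<le> 3 * (L * (L + C))" for n x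
  proof (cases "x \<in> {s n..t n + 1 / N n}")
    case True
    have x: "0 < x" "x < L" using True ord[of n] by auto
    have rb: "\<bar>r n u x\<bar> \<le> L + C" if "0 \<le> u" for u
    proof -
      have "\<bar>R (N n * (x - u))\<bar> \<le> max 0 (N n * (x - u)) + C"
        using R(7)[of "N n * (x - u)"] by linarith
      also have "\<dots> \<le> N n * L + C * N n"
      proof -
        have "N n * (x - u) \<le> N n * L" using x that Np[of n] by simp
        moreover have "0 \<le> N n * L" using x Np[of n] by simp
        moreover have "C * 1 \<le> C * N n" using N1[of n] C0 by (intro mult_left_mono)
        ultimately show ?thesis by simp
      qed
      finally have "\<bar>R (N n * (x - u))\<bar> \<le> (L + C) * N n" by (simp add: algebra_simps)
      then show ?thesis using Np[of n] by (simp add: r_def abs_divide divide_le_eq)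
    qed
    have LC: "0 \<le> L + C" using m C0 by linarith
    have p: "\<bar>a * r n u x\<bar> \<le> L * (L + C)" if "0 \<le> u" "0 \<le> a" "a \<le> L" for a u
      unfolding abs_mult using that rb[OF that(1)] LC by (intro mult_mono) auto
    have "1 / N n > 0" using Np[of n] by simp
    then have "\<bar>(t n - m) * r n (s n) x\<bar> \<le> L * (L + C)" "\<bar>(t n - s n) * r n m x\<bar> \<le> L * (L + C)"
      "\<bar>(m - s n) * r n (t n) x\<bar> \<le> L * (L + C)"
      using ord[of n] m by (intro p; linarith)+
    then show ?thesis unfolding \<eta>_def by linarith
  next
    case False
    have "0 \<le> L * (L + C)" using m C0 by simp
    then show ?thesis using out[OF False] by simp
  qed
  have [measurable]: "\<eta> n \<in> borel_measurable borel" for n by (rule test1_measurable[OF t1])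
  have [measurable]: "G \<in> borel_measurable borel" using G by auto
  have "(\<lambda>n. LBINT x. G x * \<eta> n x) \<longlonglongrightarrow> (LBINT x. G x * \<tau> x)"
  proof (rule integral_dominated_convergence[where w="\<lambda>x. \<bar>G x\<bar> * (3 * (L * (L + C)))"])
    show "AE x in lborel. norm (G x * \<eta> n x) \<le> \<bar>G x\<bar> * (3 * (L * (L + C)))" for n
      using bd by (auto simp: abs_mult intro!: mult_left_mono)
    show "AE x in lborel. (\<lambda>n. G x * \<eta> n x) \<longlonglongrightarrow> G x * \<tau> x"
      using lim by (auto intro!: tendsto_mult)
    show "(\<lambda>x. G x * \<tau> x) \<in> borel_measurable lborel" unfolding \<tau>_def by measurable
  qed (use G in auto)
  \<comment> \<open>The second derivatives of the tests are combinations of three approximate Dirac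
    masses, so in the limit only W 0, W m and W L enter; the outer two are zero by
    hypothesis.\<close>
  moreover have "(\<lambda>n. LBINT x. W x * deriv (deriv (\<eta> n)) x) \<longlonglongrightarrow> (L - m) * W 0 - L * W m + m * W L"
  proof -
    have "0 \<le> L" using m by linarith
    then obtain V where V: "continuous_on UNIV V" "\<And>x. x \<in> {0..L} \<Longrightarrow> V x = W x"
      by (rule clamp_extension[OF W(1)]) blast
    have WV: "W x * deriv (deriv (\<eta> n)) x = V x * deriv (deriv (\<eta> n)) x" for n x
      using test1_outside[OF test1_deriv[OF test1_deriv[OF t1[of n]]], of x] V(2)[of x] by fastforce
    have i: "integrable lborel (\<lambda>x. V x * d n u x)" for n u
    proof (rule integrable_continuous_support[of _ u "u + 1 / N n"])
      show "continuous_on UNIV (\<lambda>x. V x * d n u x)" unfolding d_def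
        by (intro continuous_intros V continuous_on_compose2[OF smooth1_continuous[OF R(2), of UNIV]]) auto
      show "V x * d n u x = 0" if "x \<notin> {u..u + 1 / N n}" for x
      proof -
        have "N n * (x - u) \<notin> {0<..<1}" using that Np[of n] by (auto simp: field_simps zero_less_mult_iff)
        then show ?thesis using R(5) by (simp add: d_def)
      qed
    qed
    have "(LBINT x. W x * deriv (deriv (\<eta> n)) x)
      = (LBINT x. (t n - m) * (V x * d n (s n) x) - (t n - s n) * (V x * d n m x) + (m - s n) * (V x * d n (t n) x))" for n
      by (rule Bochner_Integration.integral_cong[OF refl]) (unfold WV, unfold d2, algebra)
    also have "\<dots> n = (t n - m) * (LBINT x. V x * d n (s n) x) - (t n - s n) * (LBINT x. V x * d n m x)
       + (m - s n) * (LBINT x. V x * d n (t n) x)" for n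
      using i by (simp add: Bochner_Integration.integral_add Bochner_Integration.integral_diff)
    finally have e: "(LBINT x. W x * deriv (deriv (\<eta> n)) x)
      = (t n - m) * (LBINT x. V x * d n (s n) x) - (t n - s n) * (LBINT x. V x * d n m x)
       + (m - s n) * (LBINT x. V x * d n (t n) x)" for n .
    have dl: "(\<lambda>n. LBINT x. V x * d n (v n) x) \<longlonglongrightarrow> V u" if "v \<longlonglongrightarrow> u" for v u
      unfolding d_def by (intro mollifier_tendsto V smooth1_continuous R that Ninf N1)
    have "(\<lambda>n. (t n - m) * (LBINT x. V x * d n (s n) x) - (t n - s n) * (LBINT x. V x * d n m x)
       + (m - s n) * (LBINT x. V x * d n (t n) x)) \<longlonglongrightarrow> (L - m) * V 0 - (L - 0) * V m + (m - 0) * V L"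
      by (intro tendsto_intros st dl)
    then show ?thesis unfolding e using V(2)[of 0] V(2)[of m] V(2)[of L] m by simp
  qed
  ultimately have "(L - m) * W 0 - L * W m + m * W L = (LBINT x. G x * \<tau> x)"
    unfolding eq[OF t1] by (rule LIMSEQ_unique[rotated])
  then have "W m = (LBINT x. G x * \<tau> x) * (- 1 / L)" using W m by (simp add: field_simps)
  also have "\<dots> = (LBINT x. G x * (- \<tau> x / L))"
    by (subst integral_mult_left_zero[symmetric]) (simp add: algebra_simps)
  also have "(\<lambda>x. - \<tau> x / L) = (\<lambda>s. indicator {0<..<L} s * (m * s / L - min m s))"
  proof
    fix x
    show "- \<tau> x / L = indicator {0<..<L} x * (m * x / L - min m x)"
    proof -
      consider "x \<le> 0" | "0 < x" "x \<le> m" | "m < x" "x < L" | "x \<ge> L" by linarith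
      then show ?thesis
        using m by cases (simp_all add: \<tau>_def indicator_def field_simps)
    qed
  qed
  finally show ?thesis .
qed

section \<open>Tensor product test functions\<close>

text \<open>The positive and negative parts of h, taken as densities, define measures that agree on
  all boxes. Boxes form an intersection-stable generator, so the measures coincide, and uniqueness
  of densities equates the two parts.\<close>

lemma integral_box_zero_imp_AE_zero:
  fixes h :: "'a::euclidean_space \<Rightarrow> real"
  assumes h: "integrable lborel h"
    and box: "\<And>a b. (LBINT x. h x * indicator (box a b) x) = 0"
  shows "AE x in lborel. h x = 0"
proof -
  have [measurable]: "h \<in> borel_measurable borel" using h by auto
  \<comment> \<open>\<open>ennreal\<close> sends negative numbers to 0, so these are the densities
    max 0 h and max 0 (- h).\<close>
  define P Q where "P = density lborel (\<lambda>x. ennreal (h x))" and "Q = density lborel (\<lambda>x. ennreal (- h x))"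
  have i: "integrable lborel (\<lambda>x. max 0 (h x) * indicator (box a b) x)"
    "integrable lborel (\<lambda>x. max 0 (- h x) * indicator (box a b) x)" for a b
    using h by (auto intro!: integrable_real_mult_indicator)
  have e: "emeasure P (box a b) = ennreal (LBINT x. max 0 (h x) * indicator (box a b) x)"
    "emeasure Q (box a b) = ennreal (LBINT x. max 0 (- h x) * indicator (box a b) x)" for a b
  proof -
    have "(\<integral>\<^sup>+x. ennreal (g x) * indicator (box a b) x \<partial>lborel)
      = (\<integral>\<^sup>+x. ennreal (max 0 (g x) * indicator (box a b) x) \<partial>lborel)" for g :: "'a \<Rightarrow> real"
      by (intro nn_integral_cong) (auto simp: indicator_def ennreal_eq_0_iff max_def)
    then show "emeasure P (box a b) = ennreal (LBINT x. max 0 (h x) * indicator (box a b) x)"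
      "emeasure Q (box a b) = ennreal (LBINT x. max 0 (- h x) * indicator (box a b) x)"
      unfolding P_def Q_def using i[of a b]
      by (simp_all add: emeasure_density nn_integral_eq_integral)
  qed
  have eq: "emeasure P (box a b) = emeasure Q (box a b)" for a b
  proof -
    have "(LBINT x. max 0 (h x) * indicator (box a b) x) - (LBINT x. max 0 (- h x) * indicator (box a b) x)
      = (LBINT x. max 0 (h x) * indicator (box a b) x - max 0 (- h x) * indicator (box a b) x)"
      using i by (simp add: Bochner_Integration.integral_diff)
    also have "\<dots> = (LBINT x. h x * indicator (box a b) x)"
      by (intro Bochner_Integration.integral_cong) (auto simp: max_def indicator_def)
    finally show ?thesis using box e by simp
  qed
  have "P = Q"
  proof (rule measure_eqI_generator_eq)
    let ?E = "range (\<lambda>(a, b). box a b::'a set)"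
    show "Int_stable ?E" by (auto simp: Int_stable_def box_Int_box)
    show "?E \<subseteq> Pow UNIV" "sets P = sigma_sets UNIV ?E" "sets Q = sigma_sets UNIV ?E"
      by (simp_all add: borel_eq_box P_def Q_def)
    let ?A = "\<lambda>n::nat. box (- (real n *\<^sub>R One)) (real n *\<^sub>R One) :: 'a set"
    show "range ?A \<subseteq> ?E" "(\<Union>i. ?A i) = UNIV" unfolding UN_box_eq_UNIV by auto
    show "emeasure P (?A i) \<noteq> \<infinity>" for i by (simp add: e)
    show "emeasure P X = emeasure Q X" if "X \<in> ?E" for X using that eq by auto
  qed
  then have "AE x in lborel. ennreal (h x) = ennreal (- h x)"
    unfolding P_def Q_def by (intro sigma_finite_measure.density_unique[OF sigma_finite_lborel]) auto
  then show ?thesis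
  proof eventually_elim
    case (elim x)
    show ?case
    proof (cases "h x \<ge> 0")
      case True
      then have "ennreal (- h x) = 0" by (intro ennreal_neg) simp
      with elim have "h x \<le> 0" by (simp only: ennreal_eq_0_iff)
      with True show ?thesis by simp
    next
      case False
      then have "ennreal (h x) = 0" by (intro ennreal_neg) simp
      with elim have "- h x \<le> 0" by (metis ennreal_eq_0_iff)
      with False show ?thesis by simp
    qed
  qed
qed

section \<open>Fubini in the plane and separation of functions by tensor products\<close>

lemma lborel_Fubini:
  fixes F :: "real \<times> real \<Rightarrow> real"
  assumes "integrable lborel F"
  shows "(LBINT p. F p) = (LBINT x. (LBINT y. F (x, y)))"
    "(LBINT p. F p) = (LBINT y. (LBINT x. F (x, y)))"
    "AE x in lborel. integrable lborel (\<lambda>y. F (x, y))"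
    "AE y in lborel. integrable lborel (\<lambda>x. F (x, y))"
    "integrable lborel (\<lambda>x. LBINT y. F (x, y))"
    "integrable lborel (\<lambda>y. LBINT x. F (x, y))"
proof -
  have F: "integrable (lborel \<Otimes>\<^sub>M lborel) (case_prod (\<lambda>x y. F (x, y)))" using assms by (simp add: lborel_prod)
  show "(LBINT p. F p) = (LBINT x. (LBINT y. F (x, y)))"
    "(LBINT p. F p) = (LBINT y. (LBINT x. F (x, y)))"
    using lborel_pair.integral_fst[OF F] lborel_pair.integral_snd[OF F] by (simp_all add: lborel_prod)
  show "AE x in lborel. integrable lborel (\<lambda>y. F (x, y))"
    "AE y in lborel. integrable lborel (\<lambda>x. F (x, y))"
    "integrable lborel (\<lambda>x. LBINT y. F (x, y))"
    "integrable lborel (\<lambda>y. LBINT x. F (x, y))"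
    using lborel_pair.AE_integrable_fst[OF F] lborel_pair.AE_integrable_snd[OF F]
      lborel_pair.integrable_fst[OF F] lborel_pair.integrable_snd[OF F] by simp_all
qed

lemma borel_measurable_slices:
  fixes F :: "real \<times> real \<Rightarrow> real"
  assumes [measurable]: "F \<in> borel_measurable borel"
  shows "(\<lambda>y. F (x, y)) \<in> borel_measurable borel" "(\<lambda>x. F (x, y)) \<in> borel_measurable borel"
  by (rule measurable_compose[OF _ assms], simp add: borel_prod[symmetric])+

lemma integrable_tensor:
  fixes f g :: "real \<Rightarrow> real"
  assumes "integrable lborel f" "integrable lborel g"
  shows "integrable lborel (\<lambda>p. f (fst p) * g (snd p))"
proof -
  have [measurable]: "f \<in> borel_measurable borel" "g \<in> borel_measurable borel" using assms by auto
  have "integrable (lborel \<Otimes>\<^sub>M lborel) (\<lambda>p. f (fst p) * g (snd p))"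
    by (rule lborel_pair.Fubini_integrable) (use assms in \<open>auto simp: abs_mult\<close>)
  then show ?thesis by (simp add: lborel_prod)
qed

definition tensor :: "(real \<Rightarrow> real) \<Rightarrow> (real \<Rightarrow> real) \<Rightarrow> real \<times> real \<Rightarrow> real" where
  "tensor f g = (\<lambda>p. f (fst p) * g (snd p))"

lemma tensor_measurable:
  assumes "f \<in> borel_measurable borel" "g \<in> borel_measurable borel"
  shows "tensor f g \<in> borel_measurable borel"
proof -
  have [measurable]: "fst \<in> borel_measurable (borel :: (real \<times> real) measure)"
    "snd \<in> borel_measurable (borel :: (real \<times> real) measure)"
    by (simp_all add: borel_prod[symmetric])
  show ?thesis unfolding tensor_def using assms by measurable
qed

lemma box_real_pair: "box (a, c) (b, d) = {a<..<b} \<times> {c<..<d::real}" for a :: real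
  by (auto simp: box_def Basis_prod_def)

text \<open>Products of approximate step functions converge boundedly to the indicator of a box, so
  vanishing on tensor tests gives vanishing on boxes.\<close>

lemma integral_tensor_zero_imp_AE_zero:
  fixes h :: "real \<times> real \<Rightarrow> real"
  assumes h: "integrable lborel h" and supp: "\<And>p. p \<notin> {A<..<B} \<times> {C<..<D} \<Longrightarrow> h p = 0"
    and zero: "\<And>\<eta> \<zeta>. test1 A B \<eta> \<Longrightarrow> test1 C D \<zeta> \<Longrightarrow> (LBINT p. h p * tensor \<eta> \<zeta> p) = 0"
  shows "AE p in lborel. h p = 0"
proof (rule integral_box_zero_imp_AE_zero[OF h])
  fix u v :: "real \<times> real"
  obtain a c b d where uv: "u = (a, c)" "v = (b, d)" by fastforce
  \<comment> \<open>The box is cut down to the rectangle carrying h, because the tests must be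
    supported there.\<close>
  define a' b' c' d' where "a' = max a A" and "b' = min b B" and "c' = max c C" and "d' = min d D"
  have ind: "h p * indicator (box u v) p = h p * tensor (indicator {a'<..<b'}) (indicator {c'<..<d'}) p" for p
    using supp[of p] by (cases "h p = 0")
      (auto simp: uv box_real_pair tensor_def a'_def b'_def c'_def d'_def indicator_def mem_Times_iff)
  show "(LBINT x. h x * indicator (box u v) x) = 0"
  proof (cases "a' < b' \<and> c' < d'")
    case False
    then have "tensor (indicator {a'<..<b'}) (indicator {c'<..<d'}) p = 0" for p
      by (auto simp: tensor_def indicator_def)
    then show ?thesis unfolding ind by simp
  next
    case True
    have "A \<le> a'" "a' < b'" "b' \<le> B" using True by (auto simp: a'_def b'_def)
    then obtain \<eta> where \<eta>: "\<And>n. test1 A B (\<eta> n)" "\<And>n x. \<bar>\<eta> n x\<bar> \<le> 1" "\<And>x. (\<lambda>n. \<eta> n x) \<longlonglongrightarrow> indicator {a'<..<b'} x"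
      by (rule test1_step_approximation) blast
    have "C \<le> c'" "c' < d'" "d' \<le> D" using True by (auto simp: c'_def d'_def)
    then obtain \<zeta> where \<zeta>: "\<And>n. test1 C D (\<zeta> n)" "\<And>n x. \<bar>\<zeta> n x\<bar> \<le> 1" "\<And>x. (\<lambda>n. \<zeta> n x) \<longlonglongrightarrow> indicator {c'<..<d'} x"
      by (rule test1_step_approximation) blast
    have [measurable]: "h \<in> borel_measurable borel" using h by auto
    have [measurable]: "tensor (\<eta> n) (\<zeta> n) \<in> borel_measurable borel" for n
      by (intro tensor_measurable test1_measurable[OF \<eta>(1)] test1_measurable[OF \<zeta>(1)])
    have [measurable]: "tensor (indicator {a'<..<b'}) (indicator {c'<..<d'}) \<in> borel_measurable borel"
      by (intro tensor_measurable) auto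
    have "(\<lambda>n. LBINT p. h p * tensor (\<eta> n) (\<zeta> n) p)
       \<longlonglongrightarrow> (LBINT p. h p * tensor (indicator {a'<..<b'}) (indicator {c'<..<d'}) p)"
    proof (rule integral_dominated_convergence[where w="\<lambda>x. \<bar>h x\<bar>"])
      show "AE p in lborel. norm (h p * tensor (\<eta> n) (\<zeta> n) p) \<le> \<bar>h p\<bar>" for n
      proof (rule AE_I2)
        fix p
        have "\<bar>\<eta> n (fst p) * \<zeta> n (snd p)\<bar> \<le> 1 * 1"
          unfolding abs_mult by (intro mult_mono \<eta> \<zeta>) auto
        then show "norm (h p * tensor (\<eta> n) (\<zeta> n) p) \<le> \<bar>h p\<bar>"
          by (simp add: tensor_def abs_mult mult_left_le)
      qed
      show "AE p in lborel. (\<lambda>n. h p * tensor (\<eta> n) (\<zeta> n) p) \<longlonglongrightarrow> h p * tensor (indicator {a'<..<b'}) (indicator {c'<..<d'}) p"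
        unfolding tensor_def by (intro AE_I2 tendsto_mult tendsto_const \<eta> \<zeta>)
    qed (use h in auto)
    then have "(\<lambda>n. 0) \<longlonglongrightarrow> (LBINT p. h p * tensor (indicator {a'<..<b'}) (indicator {c'<..<d'}) p)"
      unfolding zero[OF \<eta>(1) \<zeta>(1)] .
    then show ?thesis unfolding ind by (simp add: LIMSEQ_const_iff)
  qed
qed

text \<open>Integration by parts when W is only a primitive of an integrable function: Fubini over
  the triangle s < x leaves the integral of \<open>\<phi>'\<close> over [s, B], which is -
  \<open>\<phi>\<close> s. The constant c drops out because \<open>\<phi>\<close> vanishes at both
  ends.\<close>

lemma integral_by_parts_primitive:
  fixes G \<phi> \<phi>' W :: "real \<Rightarrow> real"
  assumes G: "integrable lborel G" "\<And>x. x \<notin> {A<..<B} \<Longrightarrow> G x = 0" and "A \<le> B"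
    and W: "AE x in lborel. x \<in> {A<..<B} \<longrightarrow> W x = c + (LBINT s. G s * indicator {..<x} s)"
    and \<phi>: "\<And>x. (\<phi> has_real_derivative \<phi>' x) (at x)" "continuous_on UNIV \<phi>'" "\<phi> A = 0" "\<phi> B = 0"
    and Wm: "W \<in> borel_measurable borel"
  shows "(LBINT x. indicator {A<..<B} x * (W x * \<phi>' x)) = - (LBINT x. G x * \<phi> x)"
proof -
  have [measurable]: "\<phi>' \<in> borel_measurable borel" "G \<in> borel_measurable borel" "W \<in> borel_measurable borel"
    using \<phi>(2) G Wm by (auto intro: borel_measurable_continuous_onI)
  have ftc: "(LBINT x. \<phi>' x * indicator {a..B} x) = - \<phi> a" if "a \<le> B" for a
    using integral_FTC_Icc_real[OF that, of \<phi> \<phi>'] \<phi> by (simp add: continuous_on_eq_continuous_at)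
  have "integrable lborel (\<lambda>x. indicator {A..B} x *\<^sub>R \<phi>' x)"
    by (intro borel_integrable_compact continuous_on_subset[OF \<phi>(2)]) auto
  then have i\<phi>: "integrable lborel (\<lambda>x. indicator {A..B} x * \<phi>' x)" by simp
  have iF: "integrable lborel (\<lambda>p. (indicator {A..B} (fst p) * \<phi>' (fst p)) * G (snd p) * indicator {p. snd p < fst p} p)"
  proof (rule integrable_mult_bounded[OF integrable_tensor[OF i\<phi> G(1)], of _ 1])
    have "{p::real \<times> real. snd p < fst p} \<in> sets borel"
      by (intro borel_open open_Collect_less continuous_intros)
    then show "(\<lambda>p::real \<times> real. indicator {p. snd p < fst p} p :: real) \<in> borel_measurable lborel"
      by (intro borel_measurable_indicator) (simp only: sets_lborel)
  qed (simp add: indicator_def)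
  have AEe: "AE x in lborel. x \<noteq> A \<and> x \<noteq> B"
    using AE_lborel_singleton[of A] AE_lborel_singleton[of B] by eventually_elim auto
  have "(LBINT x. indicator {A<..<B} x * (W x * \<phi>' x))
     = (LBINT x. c * (\<phi>' x * indicator {A..B} x) + (LBINT s. (indicator {A..B} x * \<phi>' x) * G s * indicator {p. snd p < fst p} (x, s)))"
  proof (rule integral_cong_AE)
    show "AE x in lborel. indicator {A<..<B} x * (W x * \<phi>' x)
      = c * (\<phi>' x * indicator {A..B} x) + (LBINT s. (indicator {A..B} x * \<phi>' x) * G s * indicator {p. snd p < fst p} (x, s))"
      using W AEe
    proof eventually_elim
      case (elim x)
      have "(LBINT s. (indicator {A..B} x * \<phi>' x) * G s * indicator {p. snd p < fst p} (x, s))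
        = (LBINT s. (indicator {A..B} x * \<phi>' x) * (G s * indicator {..<x} s))"
        by (intro Bochner_Integration.integral_cong) (auto simp: indicator_def)
      also have "\<dots> = (indicator {A..B} x * \<phi>' x) * (LBINT s. G s * indicator {..<x} s)"
        by (rule integral_mult_right_zero)
      finally have e: "(LBINT s. (indicator {A..B} x * \<phi>' x) * G s * indicator {p. snd p < fst p} (x, s))
        = (indicator {A..B} x * \<phi>' x) * (LBINT s. G s * indicator {..<x} s)" .
      show ?case unfolding e using elim by (cases "x \<in> {A<..<B}") (auto simp: algebra_simps)
    qed
    show "(\<lambda>x. c * (\<phi>' x * indicator {A..B} x) + (LBINT s. (indicator {A..B} x * \<phi>' x) * G s * indicator {p. snd p < fst p} (x, s)))
      \<in> borel_measurable lborel"
      using borel_measurable_integrable[OF lborel_Fubini(5)[OF iF]] by simp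
  qed measurable
  also have "\<dots> = c * (LBINT x. \<phi>' x * indicator {A..B} x)
    + (LBINT x. (LBINT s. (indicator {A..B} x * \<phi>' x) * G s * indicator {p. snd p < fst p} (x, s)))"
    using lborel_Fubini(5)[OF iF] i\<phi> by (subst Bochner_Integration.integral_add) (simp_all add: mult.commute)
  also have "(LBINT x. \<phi>' x * indicator {A..B} x) = 0" using ftc[of A] \<phi> assms(3) by simp
  also have "(LBINT x. (LBINT s. (indicator {A..B} x * \<phi>' x) * G s * indicator {p. snd p < fst p} (x, s)))
    = (LBINT s. (LBINT x. (indicator {A..B} x * \<phi>' x) * G s * indicator {p. snd p < fst p} (x, s)))"
    using lborel_Fubini(1,2)[OF iF] by simp
  also have "\<dots> = (LBINT s. - (G s * \<phi> s))"
  proof (rule Bochner_Integration.integral_cong[OF refl])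
    fix s
    show "(LBINT x. (indicator {A..B} x * \<phi>' x) * G s * indicator {p. snd p < fst p} (x, s)) = - (G s * \<phi> s)"
    proof (cases "s \<in> {A<..<B}")
      case True
      have "(LBINT x. (indicator {A..B} x * \<phi>' x) * G s * indicator {p. snd p < fst p} (x, s))
        = (LBINT x. G s * (\<phi>' x * indicator {s..B} x))"
      proof (rule integral_cong_AE)
        show "AE x in lborel. (indicator {A..B} x * \<phi>' x) * G s * indicator {p. snd p < fst p} (x, s) = G s * (\<phi>' x * indicator {s..B} x)"
          using AE_lborel_singleton[of s] by eventually_elim (use True in \<open>auto simp: indicator_def\<close>)
        have "(\<lambda>x. (indicator {A..B} x * \<phi>' x) * G s * indicator {p. snd p < fst p} (x, s))
          = (\<lambda>x. (indicator {A..B} x * \<phi>' x) * G s * indicator {s<..} x)" by (auto simp: indicator_def)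
        then show "(\<lambda>x. (indicator {A..B} x * \<phi>' x) * G s * indicator {p. snd p < fst p} (x, s)) \<in> borel_measurable lborel"
          by simp
      qed measurable
      then show ?thesis using ftc[of s] True by simp
    qed (use G(2) in simp)
  qed
  finally show ?thesis by simp
qed

section \<open>Tensor products and general test functions on the rectangle\<close>

lemma pd_tensor:
  assumes "smooth1 f" "smooth1 g"
  shows "pd True (tensor f g) = tensor f (deriv g)" "pd False (tensor f g) = tensor (deriv f) g"
proof -
  show "pd True (tensor f g) = tensor f (deriv g)"
    unfolding pd_def tensor_def fun_eq_iff
    by (auto intro!: DERIV_imp_deriv DERIV_cmult smooth1_deriv(1)[OF assms(2)])
  show "pd False (tensor f g) = tensor (deriv f) g"
    unfolding pd_def tensor_def fun_eq_iff
    by (auto intro!: DERIV_imp_deriv DERIV_cmult_right smooth1_deriv(1)[OF assms(1)])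
qed

lemma iter_pd_tensor:
  assumes "smooth1 f" "smooth1 g"
  shows "\<exists>f' g'. smooth1 f' \<and> smooth1 g' \<and> iter_pd ds (tensor f g) = tensor f' g'"
proof (induction ds)
  case (Cons d ds)
  then obtain f' g' where *: "smooth1 f'" "smooth1 g'" "iter_pd ds (tensor f g) = tensor f' g'" by blast
  have "iter_pd (d # ds) (tensor f g) = pd d (tensor f' g')" using * by (simp add: iter_pd_def)
  then show ?case using pd_tensor[OF *(1,2)] * smooth1_deriv(2)
    by (cases d) auto
qed (use assms in \<open>auto simp: iter_pd_def\<close>)

lemma tensor_differentiable:
  assumes "smooth1 f" "smooth1 g"
  shows "tensor f g differentiable (at p)"
proof -
  have "(f has_derivative (*) (deriv f (fst p))) (at (fst p))" "(g has_derivative (*) (deriv g (snd p))) (at (snd p))"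
    using smooth1_deriv(1)[OF assms(1)] smooth1_deriv(1)[OF assms(2)] by (simp_all add: has_field_derivative_def)
  note d = this(1)[THEN has_derivative_compose[OF has_derivative_fst[OF has_derivative_ident]]]
    this(2)[THEN has_derivative_compose[OF has_derivative_snd[OF has_derivative_ident]]]
  have "(\<lambda>p. f (fst p)) differentiable (at p)" by (rule differentiableI[OF d(1)])
  moreover have "(\<lambda>p. g (snd p)) differentiable (at p)" by (rule differentiableI[OF d(2)])
  ultimately show ?thesis unfolding tensor_def by (rule differentiable_mult)
qed

lemma test_fun_tensor:
  assumes "test1 0 pi \<eta>" "test1 (-l) l \<zeta>"
  shows "test_fun l (tensor \<eta> \<zeta>)"
proof -
  have sm: "smooth_fun (tensor \<eta> \<zeta>)" unfolding smooth_fun_def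
  proof (intro allI)
    fix ds p
    obtain f' g' where "smooth1 f'" "smooth1 g'" "iter_pd ds (tensor \<eta> \<zeta>) = tensor f' g'"
      using iter_pd_tensor[OF test1_smooth[OF assms(1)] test1_smooth[OF assms(2)]] by blast
    then show "iter_pd ds (tensor \<eta> \<zeta>) differentiable at p" using tensor_differentiable by simp
  qed
  obtain a b where ab: "0 < a" "b < pi" "\<And>x. x \<notin> {a..b} \<Longrightarrow> \<eta> x = 0" using assms(1) by (auto simp: test1_def)
  obtain c d where cd: "-l < c" "d < l" "\<And>x. x \<notin> {c..d} \<Longrightarrow> \<zeta> x = 0" using assms(2) unfolding test1_def by blast
  have "{p. tensor \<eta> \<zeta> p \<noteq> 0} \<subseteq> {a..b} \<times> {c..d}"
    using ab(3) cd(3) unfolding tensor_def by (intro subsetI, unfold mem_Times_iff) (metis (mono_tags, lifting) mem_Collect_eq mult_eq_0_iff)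
  then have sub: "closure {p. tensor \<eta> \<zeta> p \<noteq> 0} \<subseteq> {a..b} \<times> {c..d}"
    by (intro closure_minimal closed_Times) auto
  moreover have "compact ({a..b} \<times> {c..d})" by (intro compact_Times) auto
  ultimately have "compact (closure {p. tensor \<eta> \<zeta> p \<noteq> 0})"
    by (meson closed_closure compact_Int_closed inf.absorb_iff2 compact_closure bounded_subset compact_imp_bounded closure_subset order_trans)
  moreover have "{a..b} \<times> {c..d} \<subseteq> Om l" using ab(1,2) cd(1,2) by (auto simp: Om_def)
  ultimately show ?thesis unfolding test_fun_def using sm sub by blast
qed

text \<open>\<open>pd\<close> is built from \<open>deriv\<close>, which is meaningful only where a
  derivative exists; total differentiability, restricted to a coordinate line, provides it.\<close>

lemma smooth_fun_partial:
  assumes "smooth_fun \<phi>"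
  shows "((\<lambda>t. \<phi> (t, y)) has_real_derivative pd False \<phi> (x, y)) (at x)"
    "((\<lambda>t. \<phi> (x, t)) has_real_derivative pd True \<phi> (x, y)) (at y)"
proof -
  have "iter_pd [] \<phi> differentiable at (x, y)" using assms unfolding smooth_fun_def by blast
  then obtain D where D: "(\<phi> has_derivative D) (at (x, y))" by (auto simp: iter_pd_def differentiable_def)
  have "((\<lambda>t. \<phi> (t, y)) has_derivative (\<lambda>h. D (h, 0))) (at x)"
    by (rule has_derivative_compose[of "\<lambda>t. (t, y)" "\<lambda>h. (h, 0)" x UNIV \<phi> D])
       (use D in \<open>auto intro!: derivative_eq_intros\<close>)
  then have "(\<lambda>t. \<phi> (t, y)) differentiable at x" by (rule differentiableI)
  then show "((\<lambda>t. \<phi> (t, y)) has_real_derivative pd False \<phi> (x, y)) (at x)"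
    by (simp add: pd_def real_differentiable_def DERIV_deriv_iff_real_differentiable)
  have "((\<lambda>t. \<phi> (x, t)) has_derivative (\<lambda>h. D (0, h))) (at y)"
    by (rule has_derivative_compose[of "\<lambda>t. (x, t)" "\<lambda>h. (0, h)" y UNIV \<phi> D])
       (use D in \<open>auto intro!: derivative_eq_intros\<close>)
  then have "(\<lambda>t. \<phi> (x, t)) differentiable at y" by (rule differentiableI)
  then show "((\<lambda>t. \<phi> (x, t)) has_real_derivative pd True \<phi> (x, y)) (at y)"
    by (simp add: pd_def real_differentiable_def DERIV_deriv_iff_real_differentiable)
qed

lemma test_fun_continuous:
  assumes "test_fun l \<phi>" shows "continuous_on UNIV (iter_pd ds \<phi>)"
  using assms unfolding test_fun_def smooth_fun_def
  by (auto intro!: continuous_at_imp_continuous_on differentiable_imp_continuous_within)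

lemma test_fun_outside:
  assumes "test_fun l \<phi>" "p \<notin> Om l" shows "\<phi> p = 0"
  using assms closure_subset[of "{p. \<phi> p \<noteq> 0}"] by (auto simp: test_fun_def)

section \<open>Weak derivatives on the rectangle\<close>

text \<open>Extension by zero turns integrals over the open rectangle into integrals over the plane,
  to which Fubini applies directly.\<close>

definition zext :: "real \<Rightarrow> (real \<times> real \<Rightarrow> real) \<Rightarrow> real \<times> real \<Rightarrow> real" where
  "zext l g = (\<lambda>p. indicator (Om l) p * g p)"

lemma zext_outside: "p \<notin> Om l \<Longrightarrow> zext l g p = 0"
  by (simp add: zext_def)

lemma zext_inside: "p \<in> Om l \<Longrightarrow> zext l g p = g p"
  by (simp add: zext_def)

lemma Om_box: "Om l = box (0, -l) (pi, l)"
  by (simp add: Om_def box_real_pair)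

lemma Om_borel [measurable]: "Om l \<in> sets borel"
  unfolding Om_box by simp

lemma Om_finite: "emeasure lborel (Om l) < \<infinity>"
  unfolding Om_box by (rule emeasure_lborel_box_finite)

lemma L2_iff: "L2 l g \<longleftrightarrow> zext l g \<in> borel_measurable borel \<and> integrable lborel (\<lambda>p. (zext l g p)\<^sup>2)"
proof -
  have "(\<lambda>p. (zext l g p)\<^sup>2) = (\<lambda>p. indicator (Om l) p *\<^sub>R (g p)\<^sup>2)"
    by (auto simp: zext_def indicator_def)
  moreover have "zext l g = (\<lambda>p. indicator (Om l) p *\<^sub>R g p)" by (simp add: zext_def)
  ultimately show ?thesis
    by (simp add: L2_def set_borel_measurable_def set_integrable_def)
qed

lemma integrable_bounded_Om:
  assumes "z \<in> borel_measurable borel" "\<And>p. p \<notin> Om l \<Longrightarrow> z p = 0" "\<And>p. \<bar>z p\<bar> \<le> (C::real)"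
  shows "integrable lborel z"
proof -
  have "integrable lborel (\<lambda>p. indicator (Om l) p * z p)"
    using Om_finite by (intro integrable_mult_bounded[of _ _ _ C] assms) (auto simp: integrable_indicator_iff assms(1))
  also have "(\<lambda>p. indicator (Om l) p * z p) = z"
  proof
    show "indicator (Om l) p * z p = z p" for p using assms(2)[of p] by (cases "p \<in> Om l") auto
  qed
  finally show ?thesis .
qed

lemma L2_continuous:
  assumes cont: "continuous_on (Omc l) V"
  shows "L2 l V"
proof -
  have sub: "Om l \<subseteq> Omc l" by (auto simp: Om_def Omc_def)
  have K: "compact (V ` Omc l)"
    using cont by (intro compact_continuous_image) (auto simp: Omc_def intro!: compact_Times)
  then obtain M where M: "\<And>p. p \<in> Omc l \<Longrightarrow> \<bar>V p\<bar> \<le> M"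
    by (meson bounded_real compact_imp_bounded imageI)
  have [measurable]: "zext l V \<in> borel_measurable borel"
  proof -
    have "(\<lambda>p. indicator (Om l) p *\<^sub>R V p) \<in> borel_measurable borel"
      by (rule borel_measurable_continuous_on_indicator[OF Om_borel continuous_on_subset[OF cont sub]])
    then show ?thesis by (simp add: zext_def)
  qed
  have "integrable lborel (\<lambda>p. (zext l V p)\<^sup>2)"
  proof (rule integrable_bounded_Om[of _ l "M\<^sup>2"])
    show "\<bar>(zext l V p)\<^sup>2\<bar> \<le> M\<^sup>2" for p
    proof (cases "p \<in> Om l")
      case True
      then have "\<bar>V p\<bar> \<le> M" using M sub by blast
      then have "\<bar>V p\<bar>\<^sup>2 \<le> M\<^sup>2" by (intro power_mono) auto
      then show ?thesis using True by (simp add: zext_inside)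
    qed (simp add: zext_outside)
  qed (auto simp: zext_outside)
  then show ?thesis by (simp add: L2_iff)
qed

lemma L2_integrable:
  assumes "L2 l g" shows "integrable lborel (zext l g)"
proof (rule Bochner_Integration.integrable_bound)
  show "integrable lborel (\<lambda>p. indicator (Om l) p + (zext l g p)\<^sup>2)"
    using assms Om_finite by (auto simp: L2_iff intro!: Bochner_Integration.integrable_add)
  show "AE p in lborel. norm (zext l g p) \<le> norm (indicator (Om l) p + (zext l g p)\<^sup>2)"
  proof (rule AE_I2)
    fix p
    have "\<bar>z\<bar> \<le> 1 + z\<^sup>2" for z :: real
      using sum_squares_bound[of "\<bar>z\<bar>" 1] by simp
    then show "norm (zext l g p) \<le> norm (indicator (Om l) p + (zext l g p)\<^sup>2)"
      by (cases "p \<in> Om l") (auto simp: zext_outside)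
  qed
qed (use assms in \<open>simp add: L2_iff\<close>)

lemma L2_product_integrable:
  assumes "L2 l g" "L2 l h" shows "integrable lborel (\<lambda>p. zext l g p * zext l h p)"
proof (rule Bochner_Integration.integrable_bound)
  show "integrable lborel (\<lambda>p. (zext l g p)\<^sup>2 + (zext l h p)\<^sup>2)"
    using assms by (auto simp: L2_iff)
  show "AE p in lborel. norm (zext l g p * zext l h p) \<le> norm ((zext l g p)\<^sup>2 + (zext l h p)\<^sup>2)"
  proof (rule AE_I2)
    fix p
    have "\<bar>a * b\<bar> \<le> a\<^sup>2 + b\<^sup>2" for a b :: real
      using sum_squares_bound[of a b] sum_squares_bound[of a "-b"] by (simp add: abs_if)
    then show "norm (zext l g p * zext l h p) \<le> norm ((zext l g p)\<^sup>2 + (zext l h p)\<^sup>2)" by simp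
  qed
qed (use assms in \<open>auto simp: L2_iff\<close>)

lemma zext_lincomb: "zext l (\<lambda>p. a * g p + b * h p) p = a * zext l g p + b * zext l h p"
  by (simp add: zext_def algebra_simps)

lemma L2_lincomb:
  assumes "L2 l g" "L2 l h" shows "L2 l (\<lambda>p. a * g p + b * h p)"
proof -
  have "(\<lambda>p. (a * zext l g p + b * zext l h p)\<^sup>2)
     = (\<lambda>p. a\<^sup>2 * (zext l g p)\<^sup>2 + 2 * a * b * (zext l g p * zext l h p) + b\<^sup>2 * (zext l h p)\<^sup>2)"
    by (auto simp: power2_eq_square algebra_simps)
  then show ?thesis
    using assms L2_product_integrable[OF assms]
    unfolding L2_iff zext_lincomb[abs_def] by auto
qed

text \<open>The quadratic is evaluated at its minimiser t = I / \<open>\<mu>\<close>. This is the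
  common core of Cauchy-Schwarz for integrals and for the abstract energy form.\<close>

lemma quadratic_nonneg_imp_discriminant:
  fixes Q I \<mu> :: real
  assumes pos: "\<And>t. 0 \<le> Q - 2 * t * I + t\<^sup>2 * \<mu>" and \<mu>: "\<mu> \<ge> 0"
  shows "I\<^sup>2 \<le> \<mu> * Q"
proof (cases "\<mu> = 0")
  case True
  have "I = 0"
  proof (rule ccontr)
    assume "I \<noteq> 0"
    \<comment> \<open>Without a quadratic term the expression is affine in t, and this t gives it
      the value -1.\<close>
    then have "Q - 2 * ((Q + 1) / (2 * I)) * I = - 1" by (simp add: field_simps)
    with pos[of "(Q + 1) / (2 * I)"] True show False by simp
  qed
  then show ?thesis using True by simp
next
  case False
  with \<mu> have "\<mu> > 0" by simp
  have "0 \<le> \<mu> * (Q - 2 * (I / \<mu>) * I + (I / \<mu>)\<^sup>2 * \<mu>)" using pos \<mu> by (intro mult_nonneg_nonneg)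
  also have "\<dots> = \<mu> * Q - I\<^sup>2" using \<open>\<mu> > 0\<close> by (simp add: field_simps power2_eq_square)
  finally show ?thesis by simp
qed

text \<open>Cauchy-Schwarz against the indicator of A, read off from the integral of (z - t 1_A)^2,
  a nonnegative quadratic in t.\<close>

lemma square_integral_le:
  fixes z :: "'a \<Rightarrow> real"
  assumes A: "A \<in> sets M" "emeasure M A < \<infinity>" and z: "integrable M z" "integrable M (\<lambda>x. (z x)\<^sup>2)"
    and supp: "\<And>x. x \<notin> A \<Longrightarrow> z x = 0"
  shows "(\<integral>x. z x \<partial>M)\<^sup>2 \<le> measure M A * (\<integral>x. (z x)\<^sup>2 \<partial>M)"
proof -
  define \<mu> I Q where "\<mu> = measure M A" and "I = (\<integral>x. z x \<partial>M)" and "Q = (\<integral>x. (z x)\<^sup>2 \<partial>M)"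
  have pos: "0 \<le> Q - 2 * t * I + t\<^sup>2 * \<mu>" for t
  proof -
    have eq: "(z x - t * indicator A x)\<^sup>2 = (z x)\<^sup>2 - 2 * t * z x + t\<^sup>2 * indicator A x" for x
      using supp[of x] by (cases "x \<in> A") (auto simp: power2_eq_square algebra_simps)
    have "0 \<le> (\<integral>x. (z x - t * indicator A x)\<^sup>2 \<partial>M)" by simp
    also have "\<dots> = Q - 2 * t * I + t\<^sup>2 * \<mu>"
      using A z by (simp add: eq \<mu>_def I_def Q_def)
    finally show ?thesis .
  qed
  have "I\<^sup>2 \<le> \<mu> * Q"
    by (rule quadratic_nonneg_imp_discriminant[OF pos]) (simp add: \<mu>_def)
  then show ?thesis by (simp add: \<mu>_def I_def Q_def)
qed

lemma L1_le_L2: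
  assumes "L2 l g"
  shows "(LBINT p. \<bar>zext l g p\<bar>)\<^sup>2 \<le> measure lborel (Om l) * (LBINT p. (zext l g p)\<^sup>2)"
  using square_integral_le[of "Om l" lborel "\<lambda>p. \<bar>zext l g p\<bar>"] Om_finite L2_integrable[OF assms] assms
  by (simp add: L2_iff zext_outside)

lemma test_fun_bounded:
  assumes "test_fun l \<phi>"
  obtains M where "M \<ge> 0" "\<And>p. p \<in> Om l \<Longrightarrow> \<bar>iter_pd ds \<phi> p\<bar> \<le> M"
proof -
  have "compact (iter_pd ds \<phi> ` Omc l)" unfolding Omc_def
    by (intro compact_continuous_image continuous_on_subset[OF test_fun_continuous[OF assms]] compact_Times) auto
  then obtain M where M: "\<And>p. p \<in> Omc l \<Longrightarrow> \<bar>iter_pd ds \<phi> p\<bar> \<le> M"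
    by (meson bounded_real compact_imp_bounded imageI)
  have "Om l \<subseteq> Omc l" by (auto simp: Om_def Omc_def)
  then have "\<And>p. p \<in> Om l \<Longrightarrow> \<bar>iter_pd ds \<phi> p\<bar> \<le> max M 0" using M by (metis in_mono max.coboundedI1)
  then show ?thesis using that[of "max M 0"] by simp
qed

lemma test_fun_measurable:
  assumes "test_fun l \<phi>" shows "iter_pd ds \<phi> \<in> borel_measurable borel"
  by (rule borel_measurable_continuous_onI[OF test_fun_continuous[OF assms]])

lemma integrable_zext_test:
  assumes "integrable lborel (zext l g)" "test_fun l \<phi>"
  shows "integrable lborel (\<lambda>p. zext l g p * iter_pd ds \<phi> p)"
proof -
  obtain M where M: "M \<ge> 0" "\<And>p. p \<in> Om l \<Longrightarrow> \<bar>iter_pd ds \<phi> p\<bar> \<le> M" using test_fun_bounded[OF assms(2)] by blast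
  have "integrable lborel (\<lambda>p. zext l g p * (indicator (Om l) p * iter_pd ds \<phi> p))"
  proof (rule integrable_mult_bounded[OF assms(1), of _ M])
    show "\<bar>indicator (Om l) p * iter_pd ds \<phi> p\<bar> \<le> M" for p using M by (simp add: indicator_def)
    show "(\<lambda>p. indicator (Om l) p * iter_pd ds \<phi> p) \<in> borel_measurable lborel"
      using test_fun_measurable[OF assms(2)] by simp
  qed
  also have "(\<lambda>p. zext l g p * (indicator (Om l) p * iter_pd ds \<phi> p)) = (\<lambda>p. zext l g p * iter_pd ds \<phi> p)"
    by (auto simp: zext_def indicator_def)
  finally show ?thesis .
qed

lemma weak_deriv_iff:
  "weak_deriv l ds v g \<longleftrightarrow> (\<forall>\<phi>. test_fun l \<phi> \<longrightarrow>
     (LBINT p. zext l v p * iter_pd ds \<phi> p) = (-1) ^ length ds * (LBINT p. zext l g p * \<phi> p))"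
  by (simp add: weak_deriv_def set_lebesgue_integral_def zext_def mult.assoc)

lemma weak_deriv_lincomb:
  assumes "L2 l u" "L2 l v" "L2 l g" "L2 l h" "weak_deriv l ds u g" "weak_deriv l ds v h"
  shows "weak_deriv l ds (\<lambda>p. a * u p + b * v p) (\<lambda>p. a * g p + b * h p)"
  unfolding weak_deriv_iff
proof (intro allI impI)
  fix \<phi> assume \<phi>: "test_fun l \<phi>"
  have i: "integrable lborel (\<lambda>p. zext l f p * iter_pd ds \<phi> p)" if "L2 l f" for f ds
    using integrable_zext_test[OF L2_integrable[OF that] \<phi>] .
  have e: "(LBINT p. zext l (\<lambda>p. a * f p + b * k p) p * iter_pd ds \<phi> p)
    = a * (LBINT p. zext l f p * iter_pd ds \<phi> p) + b * (LBINT p. zext l k p * iter_pd ds \<phi> p)"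
    if "L2 l f" "L2 l k" for f k ds
    using i[OF that(1), of ds] i[OF that(2), of ds] by (simp add: zext_lincomb distrib_right mult.assoc)
  have "iter_pd [] \<phi> = \<phi>" by (simp add: iter_pd_def)
  then show "(LBINT p. zext l (\<lambda>p. a * u p + b * v p) p * iter_pd ds \<phi> p)
    = (-1) ^ length ds * (LBINT p. zext l (\<lambda>p. a * g p + b * h p) p * \<phi> p)"
    using e[OF assms(1,2), of ds] e[OF assms(3,4), of "[]"] assms(5,6) \<phi>
    by (simp add: weak_deriv_iff algebra_simps)
qed

text \<open>Identities between weak derivatives thus have to be checked only on tests whose
  variables are separated.\<close>

lemma AE_eq_of_tensor_tests:
  assumes "L2 l g" "L2 l h"
    and "\<And>\<eta> \<zeta>. test1 0 pi \<eta> \<Longrightarrow> test1 (-l) l \<zeta> \<Longrightarrow>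
      (LBINT p. zext l g p * tensor \<eta> \<zeta> p) = (LBINT p. zext l h p * tensor \<eta> \<zeta> p)"
  shows "AE p in lborel. zext l g p = zext l h p"
proof -
  have "AE p in lborel. zext l g p - zext l h p = 0"
  proof (rule integral_tensor_zero_imp_AE_zero)
    show "integrable lborel (\<lambda>p. zext l g p - zext l h p)" using assms L2_integrable by auto
    show "zext l g p - zext l h p = 0" if "p \<notin> {0<..<pi} \<times> {-l<..<l}" for p
      using that by (simp add: zext_outside Om_def)
    fix \<eta> \<zeta> assume t: "test1 0 pi \<eta>" "test1 (-l) l \<zeta>"
    have "integrable lborel (\<lambda>p. zext l f p * iter_pd [] (tensor \<eta> \<zeta>) p)" if "L2 l f" for f
      using integrable_zext_test[OF L2_integrable[OF that] test_fun_tensor[OF t]] .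
    then have "integrable lborel (\<lambda>p. zext l f p * tensor \<eta> \<zeta> p)" if "L2 l f" for f
      using that by (simp add: iter_pd_def)
    then show "(LBINT p. (zext l g p - zext l h p) * tensor \<eta> \<zeta> p) = 0"
      using assms(1,2) assms(3)[OF t] by (simp add: left_diff_distrib)
  qed
  then show ?thesis by simp
qed

lemma weak_deriv_unique:
  assumes "L2 l g" "L2 l h" "weak_deriv l ds v g" "weak_deriv l ds v h"
  shows "AE p in lborel. zext l g p = zext l h p"
  using assms by (intro AE_eq_of_tensor_tests) (simp_all add: weak_deriv_iff test_fun_tensor)

text \<open>On a tensor product the two mixed partial derivatives coincide by inspection, so
  symmetry of second derivatives of general test functions is avoided. This links the order
  [True, False] demanded by \<open>H2\<close> to the order [False, True] seen by the energy.\<close>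

lemma weak_deriv_commute:
  assumes "L2 l g" "L2 l h" "weak_deriv l [False, True] v g" "weak_deriv l [True, False] v h"
  shows "AE p in lborel. zext l g p = zext l h p"
proof (rule AE_eq_of_tensor_tests[OF assms(1,2)])
  fix \<eta> \<zeta> assume t: "test1 0 pi \<eta>" "test1 (-l) l \<zeta>"
  have s: "smooth1 \<eta>" "smooth1 \<zeta>" using t test1_smooth by auto
  have "iter_pd [False, True] (tensor \<eta> \<zeta>) = iter_pd [True, False] (tensor \<eta> \<zeta>)"
    using s smooth1_deriv(2) by (simp add: iter_pd_def pd_tensor)
  then show "(LBINT p. zext l g p * tensor \<eta> \<zeta> p) = (LBINT p. zext l h p * tensor \<eta> \<zeta> p)"
    using assms(3,4) test_fun_tensor[OF t] unfolding weak_deriv_iff by fastforce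
qed

section \<open>Integral operators acting in the first variable\<close>

lemma AE_snd:
  assumes "AE y in lborel. P (y::real)"
  shows "AE p in (lborel :: (real \<times> real) measure). P (snd p)"
proof -
  from AE_E[OF assms] obtain N where "{y \<in> space lborel. \<not> P y} \<subseteq> N" "emeasure lborel N = 0" "N \<in> sets lborel"
    by blast
  then have N: "{y. \<not> P y} \<subseteq> N" "N \<in> sets borel" "emeasure lborel N = 0" by simp_all
  have "emeasure (lborel \<Otimes>\<^sub>M lborel) ((UNIV::real set) \<times> N) = emeasure lborel (UNIV::real set) * emeasure lborel N"
    using N by (intro lborel.emeasure_pair_measure_Times) auto
  then have "UNIV \<times> N \<in> null_sets (lborel :: (real \<times> real) measure)"
    using N by (auto simp: null_sets_def lborel_prod intro!: borel_Times)
  then show ?thesis by (rule AE_I') (use N(1) in auto)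
qed

text \<open>The kernel j acts in the first variable and y is a parameter. One notion covers the
  formulas for v, v_x and v_y below.\<close>

definition kernel_int :: "(real \<Rightarrow> real \<Rightarrow> real) \<Rightarrow> (real \<times> real \<Rightarrow> real) \<Rightarrow> real \<times> real \<Rightarrow> real" where
  "kernel_int j G = (\<lambda>p. LBINT s. G (s, snd p) * j (fst p) s)"

lemma kernel_int_measurable:
  assumes G: "G \<in> borel_measurable borel" and j: "(\<lambda>p. j (fst p) (snd p)) \<in> borel_measurable borel"
  shows "kernel_int j G \<in> borel_measurable borel"
  unfolding kernel_int_def
proof (rule lborel.borel_measurable_lebesgue_integral)
  have [measurable]: "(\<lambda>q. G (snd q, snd (fst q))) \<in> borel_measurable ((borel :: (real \<times> real) measure) \<Otimes>\<^sub>M (lborel :: real measure))"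
    by (rule measurable_compose[OF _ G]) (simp add: borel_prod[symmetric])
  have [measurable]: "(\<lambda>q. j (fst (fst q)) (snd q)) \<in> borel_measurable ((borel :: (real \<times> real) measure) \<Otimes>\<^sub>M (lborel :: real measure))"
    using measurable_compose[of "\<lambda>q. (fst (fst q), snd q)" "(borel :: (real \<times> real) measure) \<Otimes>\<^sub>M (lborel :: real measure)" borel, OF _ j]
    by (simp add: borel_prod[symmetric])
  show "(\<lambda>(p, s). G (s, snd p) * j (fst p) s) \<in> borel_measurable (borel \<Otimes>\<^sub>M lborel)"
    unfolding case_prod_beta by measurable
qed

text \<open>Cauchy-Schwarz on the slice (0, pi) at almost every height y bounds the square by C^2 pi
  Q y, independently of x. This bound is integrable over the rectangle because Q is integrable in
  y.\<close>

lemma L2_kernel_int: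
  assumes g: "L2 l g" and j: "(\<lambda>p. j (fst p) (snd p)) \<in> borel_measurable borel" "\<And>x s. \<bar>j x s\<bar> \<le> C"
  shows "L2 l (kernel_int j (zext l g))"
proof -
  define G where "G = zext l g"
  have Gm [measurable]: "G \<in> borel_measurable borel" and G2: "integrable lborel (\<lambda>p. (G p)\<^sup>2)" using g by (auto simp: L2_iff G_def)
  have Gi: "integrable lborel G" using L2_integrable[OF g] by (simp add: G_def)
  have [measurable]: "kernel_int j G \<in> borel_measurable borel" by (rule kernel_int_measurable[OF Gm j(1)])
  have C0: "C \<ge> 0" using j(2)[of 0 0] by linarith
  define Q where "Q y = (LBINT s. (G (s, y))\<^sup>2)" for y
  have Qi: "integrable lborel Q" using lborel_Fubini(6)[OF G2] by (simp add: Q_def[abs_def])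
  have bound: "AE y in lborel. \<forall>x. (kernel_int j G (x, y))\<^sup>2 \<le> C\<^sup>2 * pi * Q y"
    using lborel_Fubini(4)[OF Gi] lborel_Fubini(4)[OF G2]
  proof eventually_elim
    case (elim y)
    have jm: "(\<lambda>s. j x s) \<in> borel_measurable borel" for x
      using borel_measurable_slices(1)[OF j(1), of x] by simp
    show ?case
    proof
      fix x
      have i1: "integrable lborel (\<lambda>s. G (s, y) * j x s)"
        by (rule integrable_mult_bounded[OF elim(1) _ j(2)]) (simp add: jm)
      have sq: "(G (s, y) * j x s)\<^sup>2 \<le> C\<^sup>2 * (G (s, y))\<^sup>2" for s
      proof -
        have "(j x s)\<^sup>2 \<le> C\<^sup>2" using j(2)[of x s] by (simp add: abs_le_square_iff[symmetric] C0)
        then show ?thesis by (simp add: power_mult_distrib mult.commute[of _ "(j x s)\<^sup>2"] mult_right_mono)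
      qed
      have i2: "integrable lborel (\<lambda>s. (G (s, y) * j x s)\<^sup>2)"
      proof (rule Bochner_Integration.integrable_bound)
        show "integrable lborel (\<lambda>s. C\<^sup>2 * (G (s, y))\<^sup>2)" using elim(2) by simp
        show "(\<lambda>s. (G (s, y) * j x s)\<^sup>2) \<in> borel_measurable lborel"
          using i1 by measurable
      qed (use sq in auto)
      have "(kernel_int j G (x, y))\<^sup>2 \<le> measure lborel {0<..<pi} * (LBINT s. (G (s, y) * j x s)\<^sup>2)"
        unfolding kernel_int_def fst_conv snd_conv
        by (rule square_integral_le[OF _ _ i1 i2]) (auto simp: G_def zext_def Om_def)
      also have "\<dots> \<le> pi * (LBINT s. C\<^sup>2 * (G (s, y))\<^sup>2)"
      proof (rule mult_mono)
        show "(LBINT s. (G (s, y) * j x s)\<^sup>2) \<le> (LBINT s. C\<^sup>2 * (G (s, y))\<^sup>2)"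
          by (rule integral_mono[OF i2 _ sq]) (use elim(2) in simp)
      qed simp_all
      finally show "(kernel_int j G (x, y))\<^sup>2 \<le> C\<^sup>2 * pi * Q y" by (simp add: Q_def ac_simps)
    qed
  qed
  have "integrable lborel (\<lambda>p. (zext l (kernel_int j G) p)\<^sup>2)"
  proof (rule Bochner_Integration.integrable_bound)
    show "integrable lborel (\<lambda>p. indicator {0<..<pi} (fst p) * (C\<^sup>2 * pi * Q (snd p)))"
      using Qi by (intro integrable_tensor) auto
    show "AE p in lborel. norm ((zext l (kernel_int j G) p)\<^sup>2) \<le> norm (indicator {0<..<pi} (fst p) * (C\<^sup>2 * pi * Q (snd p)))"
      using AE_snd[OF bound]
    proof eventually_elim
      case (elim p)
      then have "(kernel_int j G p)\<^sup>2 \<le> C\<^sup>2 * pi * Q (snd p)" by (metis prod.collapse)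
      then show ?case by (cases "p \<in> Om l") (auto simp: zext_outside zext_inside Om_def mem_Times_iff)
    qed
    show "(\<lambda>p. (zext l (kernel_int j G) p)\<^sup>2) \<in> borel_measurable lborel" unfolding zext_def by measurable
  qed
  then show ?thesis unfolding L2_iff G_def[symmetric] by (simp add: zext_def)
qed

section \<open>Recovering a function from its second weak derivatives\<close>

text \<open>Carries an estimate known only for smooth tests with values in [-1, 1] over to the
  indicator of an interval.\<close>

lemma integral_mult_indicator_lim:
  fixes u :: "real \<Rightarrow> real"
  assumes u: "integrable lborel u" and ab: "A \<le> a" "a < b" "b \<le> B"
    and bound: "\<And>\<zeta>. test1 A B \<zeta> \<Longrightarrow> (\<forall>y. \<bar>\<zeta> y\<bar> \<le> 1) \<Longrightarrow> \<bar>LBINT y. u y * \<zeta> y\<bar> \<le> K"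
  shows "\<bar>LBINT y. u y * indicator {a<..<b} y\<bar> \<le> K"
proof -
  obtain \<zeta> where \<zeta>: "\<And>n. test1 A B (\<zeta> n)"
    "\<And>n x. \<bar>\<zeta> n x\<bar> \<le> 1" "\<And>x. (\<lambda>n. \<zeta> n x) \<longlonglongrightarrow> indicator {a<..<b} x"
    by (rule test1_step_approximation[OF ab]) blast
  have [measurable]: "u \<in> borel_measurable borel" using u by auto
  have [measurable]: "\<zeta> n \<in> borel_measurable borel" for n by (rule test1_measurable[OF \<zeta>(1)])
  have "(\<lambda>n. LBINT y. u y * \<zeta> n y) \<longlonglongrightarrow> (LBINT y. u y * indicator {a<..<b} y)"
  proof (rule integral_dominated_convergence[where w="\<lambda>y. \<bar>u y\<bar>"])
    show "AE y in lborel. norm (u y * \<zeta> n y) \<le> \<bar>u y\<bar>" for n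
      using \<zeta>(2) by (auto simp: abs_mult intro!: mult_left_le)
    show "AE y in lborel. (\<lambda>n. u y * \<zeta> n y) \<longlonglongrightarrow> u y * indicator {a<..<b} y"
      by (intro AE_I2 tendsto_mult tendsto_const \<zeta>)
  qed (use u in auto)
  from tendsto_rabs[OF this] show ?thesis
    by (rule Lim_bounded) (use bound \<zeta> in blast)
qed

lemma integrable_indicator_interval:
  "integrable lborel (indicator {a<..<b} :: real \<Rightarrow> real)" "integrable lborel (indicator {a..b} :: real \<Rightarrow> real)"
  using emeasure_lborel_box_finite[of a b] emeasure_lborel_cbox_finite[of a b]
  by (auto intro: integrable_real_indicator)

text \<open>Integrating s / L - 1_(t < s) over t in (0, m) gives m s / L - min m s, and Fubini moves
  this integration outside. Hence the Green integral is a primitive in m, which will yield the weak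
  x-derivative.\<close>

lemma Green_kernel_primitive:
  fixes G :: "real \<Rightarrow> real"
  assumes G: "integrable lborel G" and m: "0 < m" "m < L"
  shows "(LBINT s. G s * (indicator {0<..<L} s * (m * s / L - min m s)))
    = (LBINT t. (indicator {0<..<L} t * (LBINT s. G s * (indicator {0<..<L} s * (s / L - indicator {t<..} s))))
        * indicator {..<m} t)"
proof -
  define K :: "real \<times> real \<Rightarrow> real" where "K p = indicator {0<..<L} (snd p) * (snd p / L - indicator {p. fst p < snd p} p)" for p
  have [measurable]: "{p::real \<times> real. fst p < snd p} \<in> sets borel"
    by (intro borel_open open_Collect_less continuous_intros)
  have Km: "K \<in> borel_measurable borel"
  proof -
    have [measurable]: "(\<lambda>p. snd p :: real) \<in> borel_measurable (borel :: (real \<times> real) measure)"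
      by (simp add: borel_prod[symmetric])
    show ?thesis unfolding K_def by measurable
  qed
  have iF: "integrable lborel (\<lambda>p. indicator {0<..<m} (fst p) * G (snd p) * K p)"
  proof (rule integrable_mult_bounded[OF integrable_tensor[OF _ G], of _ _ 2])
    show "\<bar>K p\<bar> \<le> 2" for p
    proof (cases "snd p \<in> {0<..<L}")
      case True
      then have "0 \<le> snd p / L" "snd p / L \<le> 1" by (auto simp: divide_le_eq)
      moreover have "(indicator {p. fst p < snd p} p :: real) \<in> {0..1}" by (simp add: indicator_def)
      ultimately have "\<bar>snd p / L - indicator {p. fst p < snd p} p\<bar> \<le> 2" unfolding atLeastAtMost_iff by linarith
      then show ?thesis using True by (simp add: K_def)
    qed (simp add: K_def)
    show "integrable lborel (indicator {0<..<m} :: real \<Rightarrow> real)" by (rule integrable_indicator_interval)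
  qed (use Km in auto)
  have inner: "(LBINT t. indicator {0<..<m} t * G s * K (t, s)) = G s * (indicator {0<..<L} s * (m * s / L - min m s))" for s
  proof (cases "s \<in> {0<..<L}")
    case True
    have "(LBINT t. indicator {0<..<m} t * G s * K (t, s))
      = (LBINT t. G s * (indicator {0<..<m} t * (s / L) - indicator {0<..<min m s} t))"
      using True by (intro Bochner_Integration.integral_cong) (auto simp: K_def indicator_def)
    also have "\<dots> = G s * ((LBINT t. indicator {0<..<m} t * (s / L)) - (LBINT t. indicator {0<..<min m s} t))"
      using integrable_indicator_interval(1)
      by (subst integral_mult_right_zero, subst Bochner_Integration.integral_diff) (auto intro: integrable_mult_left simp del: times_divide_eq_right)
    also have "\<dots> = G s * (m * s / L - min m s)" using True m by (simp add: min_def)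
    finally show ?thesis using True by simp
  qed (simp add: K_def)
  have "(LBINT s. G s * (indicator {0<..<L} s * (m * s / L - min m s)))
    = (LBINT s. (LBINT t. indicator {0<..<m} t * G s * K (t, s)))" by (simp add: inner)
  also have "\<dots> = (LBINT t. (LBINT s. indicator {0<..<m} t * G s * K (t, s)))"
    using lborel_Fubini(1,2)[OF iF] by simp
  also have "\<dots> = (LBINT t. (indicator {0<..<L} t * (LBINT s. G s * (indicator {0<..<L} s * (s / L - indicator {t<..} s))))
        * indicator {..<m} t)"
  proof (intro Bochner_Integration.integral_cong refl)
    fix t
    have "(LBINT s. indicator {0<..<m} t * G s * K (t, s))
      = (LBINT s. indicator {0<..<m} t * (G s * (indicator {0<..<L} s * (s / L - indicator {t<..} s))))"
      by (intro Bochner_Integration.integral_cong refl) (simp add: K_def indicator_def)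
    also have "\<dots> = indicator {0<..<m} t * (LBINT s. G s * (indicator {0<..<L} s * (s / L - indicator {t<..} s)))"
      by (rule integral_mult_right_zero)
    finally have e: "(LBINT s. indicator {0<..<m} t * G s * K (t, s))
      = indicator {0<..<m} t * (LBINT s. G s * (indicator {0<..<L} s * (s / L - indicator {t<..} s)))" .
    have "indicator {0<..<m} t = (indicator {0<..<L} t * indicator {..<m} t :: real)"
      using m by (auto simp: indicator_def)
    with e show "(LBINT s. indicator {0<..<m} t * G s * K (t, s))
      = (indicator {0<..<L} t * (LBINT s. G s * (indicator {0<..<L} s * (s / L - indicator {t<..} s)))) * indicator {..<m} t"
      by (simp only: ac_simps)
  qed
  finally show ?thesis .
qed

text \<open>Here g is v_xy and h is v_xx. Membership of v in \<open>H2\<close> is not assumed, so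
  the results also apply to a candidate limit whose first derivatives are still unknown.\<close>

locale hinged =
  fixes l :: real and v g h :: "real \<times> real \<Rightarrow> real"
  assumes l: "l > 0" and cont: "continuous_on (Omc l) v"
    and outside: "\<And>p. p \<notin> Omc l \<Longrightarrow> v p = 0"
    and edge: "\<And>y. y \<in> {-l<..<l} \<Longrightarrow> v (0, y) = 0 \<and> v (pi, y) = 0"
    and g: "L2 l g" "weak_deriv l [False, True] v g"
    and h: "L2 l h" "weak_deriv l [False, False] v h"
begin

lemma v_bounded: obtains M where "M \<ge> 0" "\<And>p. \<bar>v p\<bar> \<le> M"
proof -
  have "compact (v ` Omc l)"
    using cont by (intro compact_continuous_image) (auto simp: Omc_def intro!: compact_Times)
  then obtain M where M: "\<And>p. p \<in> Omc l \<Longrightarrow> \<bar>v p\<bar> \<le> M"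
    by (meson bounded_real compact_imp_bounded imageI)
  have "\<bar>v p\<bar> \<le> max M 0" for p using M[of p] outside[of p] by (cases "p \<in> Omc l") auto
  then show ?thesis using that[of "max M 0"] by auto
qed

lemma v_measurable [measurable]: "v \<in> borel_measurable borel"
proof -
  have "Omc l \<in> sets borel" by (auto simp: Omc_def intro!: borel_closed closed_Times)
  then have "(\<lambda>p. indicator (Omc l) p *\<^sub>R v p) \<in> borel_measurable borel"
    by (rule borel_measurable_continuous_on_indicator[OF _ cont])
  also have "(\<lambda>p. indicator (Omc l) p *\<^sub>R v p) = v"
  proof
    show "indicator (Omc l) p *\<^sub>R v p = v p" for p using outside[of p] by (cases "p \<in> Omc l") auto
  qed
  finally show ?thesis .
qed

lemma slice_continuous: "x \<in> {0..pi} \<Longrightarrow> continuous_on {-l..l} (\<lambda>y. v (x, y))"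
  by (rule continuous_on_compose2[OF cont]) (auto simp: Omc_def intro!: continuous_intros)

lemma L2_v: "L2 l v"
  by (rule L2_continuous[OF cont])

text \<open>Testing in y alone reduces the plane to the line: the moment is a function of x whose
  weak derivatives come from g or h, and continuity allows it to be evaluated at every x.\<close>

lemma moment_continuous:
  assumes "test1 (-l) l \<psi>"
  shows "continuous_on {0..pi} (\<lambda>x. LBINT y. v (x, y) * \<psi> y)"
  unfolding continuous_on_sequentially
proof (intro allI ballI impI)
  fix X x assume X: "x \<in> {0..pi}" "(\<forall>n. X n \<in> {0..pi}) \<and> X \<longlonglongrightarrow> x"
  obtain M where M: "M \<ge> 0" "\<And>p. \<bar>v p\<bar> \<le> M" using v_bounded by blast
  have [measurable]: "\<psi> \<in> borel_measurable borel" by (rule test1_measurable[OF assms])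
  have [measurable]: "(\<lambda>y. v (x, y)) \<in> borel_measurable borel" for x by (rule borel_measurable_slices) simp
  have i: "integrable lborel \<psi>"
    by (rule integrable_continuous_support[OF test1_continuous[OF assms], of "-l" l])
       (rule test1_outside[OF assms], auto)
  have "(\<lambda>n. LBINT y. v (X n, y) * \<psi> y) \<longlonglongrightarrow> (LBINT y. v (x, y) * \<psi> y)"
  proof (rule integral_dominated_convergence[where w="\<lambda>y. M * \<bar>\<psi> y\<bar>"])
    show "AE y in lborel. norm (v (X n, y) * \<psi> y) \<le> M * \<bar>\<psi> y\<bar>" for n
      using M by (auto simp: abs_mult intro!: mult_right_mono)
    show "AE y in lborel. (\<lambda>n. v (X n, y) * \<psi> y) \<longlonglongrightarrow> v (x, y) * \<psi> y"
    proof (rule AE_I2)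
      fix y
      show "(\<lambda>n. v (X n, y) * \<psi> y) \<longlonglongrightarrow> v (x, y) * \<psi> y"
      proof (cases "y \<in> {-l<..<l}")
        case True
        have c: "continuous_on {0..pi} (\<lambda>x. v (x, y))"
          by (rule continuous_on_compose2[OF cont]) (use True in \<open>auto simp: Omc_def intro!: continuous_intros\<close>)
        have "(\<lambda>n. v (X n, y)) \<longlonglongrightarrow> v (x, y)"
          by (rule continuous_on_tendsto_compose[OF c]) (use X in auto)
        then show ?thesis by (intro tendsto_mult tendsto_const)
      qed (use test1_outside[OF assms] in simp)
    qed
    show "integrable lborel (\<lambda>y. M * \<bar>\<psi> y\<bar>)" using i by simp
  qed auto
  then show "((\<lambda>x. LBINT y. v (x, y) * \<psi> y) \<circ> X) \<longlonglongrightarrow> (LBINT y. v (x, y) * \<psi> y)"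
    by (simp add: comp_def)
qed

lemma moment_edge:
  assumes "test1 (-l) l \<psi>"
  shows "(LBINT y. v (0, y) * \<psi> y) = 0" "(LBINT y. v (pi, y) * \<psi> y) = 0"
proof -
  have "v (0, y) * \<psi> y = 0" "v (pi, y) * \<psi> y = 0" for y
    using edge[of y] test1_outside[OF assms, of y] by (cases "y \<in> {-l<..<l}"; simp)+
  then show "(LBINT y. v (0, y) * \<psi> y) = 0" "(LBINT y. v (pi, y) * \<psi> y) = 0"
    by (simp_all only: Bochner_Integration.integral_zero)
qed

lemma tensor_integrable:
  assumes "L2 l f" "test1 0 pi \<eta>" "test1 (-l) l \<zeta>"
  shows "integrable lborel (\<lambda>p. zext l f p * tensor \<eta> \<zeta> p)"
  using integrable_zext_test[OF L2_integrable[OF assms(1)] test_fun_tensor[OF assms(2,3)], of "[]"]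
  by (simp add: iter_pd_def)

lemma tensor_Fubini:
  assumes "L2 l f" "test1 0 pi \<eta>" "test1 (-l) l \<zeta>"
  shows "(LBINT p. zext l f p * tensor \<eta> \<zeta> p) = (LBINT x. (LBINT y. zext l f (x, y) * \<zeta> y) * \<eta> x)"
proof -
  have "(LBINT y. zext l f (x, y) * tensor \<eta> \<zeta> (x, y)) = (LBINT y. zext l f (x, y) * \<zeta> y) * \<eta> x" for x
    by (subst integral_mult_left_zero[symmetric]) (simp add: tensor_def ac_simps)
  then show ?thesis using lborel_Fubini(1)[OF tensor_integrable[OF assms]] by simp
qed

text \<open>v is cut off to the open rectangle on one side only; the tests vanish wherever this
  makes a difference.\<close>

lemma tensor_Fubini_v:
  assumes "test1 0 pi \<eta>" "test1 (-l) l \<zeta>"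
  shows "(LBINT p. zext l v p * tensor \<eta> \<zeta> p) = (LBINT x. (LBINT y. v (x, y) * \<zeta> y) * \<eta> x)"
  unfolding tensor_Fubini[OF L2_v assms]
proof (intro Bochner_Integration.integral_cong refl)
  fix x
  show "(LBINT y. zext l v (x, y) * \<zeta> y) * \<eta> x = (LBINT y. v (x, y) * \<zeta> y) * \<eta> x"
  proof (cases "x \<in> {0<..<pi}")
    case True
    have "zext l v (x, y) * \<zeta> y = v (x, y) * \<zeta> y" for y
      using test1_outside[OF assms(2), of y] True by (cases "y \<in> {-l<..<l}") (auto simp: zext_def Om_def)
    then show ?thesis by (simp only:)
  qed (use test1_outside[OF assms(1)] in simp)
qed

lemma L2_moment:
  assumes "L2 l f" "test1 (-l) l \<zeta>"
  shows "integrable lborel (\<lambda>p. zext l f p * \<zeta> (snd p))"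
    "integrable lborel (\<lambda>x. LBINT y. zext l f (x, y) * \<zeta> y)"
proof -
  obtain M where M: "\<And>x. \<bar>\<zeta> x\<bar> \<le> M" using test1_bounded[OF assms(2)] by blast
  have m: "\<zeta> \<in> borel_measurable borel" by (rule test1_measurable[OF assms(2)])
  show i: "integrable lborel (\<lambda>p. zext l f p * \<zeta> (snd p))"
    by (rule integrable_mult_bounded[OF L2_integrable[OF assms(1)] _ M])
       (simp add: measurable_compose[OF _ m] borel_prod[symmetric])
  show "integrable lborel (\<lambda>x. LBINT y. zext l f (x, y) * \<zeta> y)"
    using lborel_Fubini(5)[OF i] by simp
qed

text \<open>Fubini: applying a kernel in x commutes with testing in y.\<close>

lemma kernel_moment:
  assumes f: "L2 l f" and \<zeta>: "test1 (-l) l \<zeta>"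
    and j: "j \<in> borel_measurable borel" "\<And>s. \<bar>j s\<bar> \<le> C"
  shows "(LBINT s. (LBINT y. zext l f (s, y) * \<zeta> y) * j s) = (LBINT y. (LBINT s. zext l f (s, y) * j s) * \<zeta> y)"
proof -
  have i: "integrable lborel (\<lambda>p. zext l f p * \<zeta> (snd p) * j (fst p))"
    by (rule integrable_mult_bounded[OF L2_moment(1)[OF f \<zeta>] _ j(2)])
       (simp add: measurable_compose[OF _ j(1)] borel_prod[symmetric])
  have "(LBINT s. (LBINT y. zext l f (s, y) * \<zeta> y) * j s) = (LBINT s. (LBINT y. zext l f (s, y) * \<zeta> y * j s))"
    by simp
  also have "\<dots> = (LBINT y. (LBINT s. zext l f (s, y) * \<zeta> y * j s))"
    using lborel_Fubini(1,2)[OF i] by simp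
  also have "\<dots> = (LBINT y. (LBINT s. zext l f (s, y) * j s * \<zeta> y))" by (simp add: ac_simps)
  also have "\<dots> = (LBINT y. (LBINT s. zext l f (s, y) * j s) * \<zeta> y)" by simp
  finally show ?thesis .
qed

text \<open>\<open>w\<close>, \<open>Z\<close> and \<open>\<omega>\<close> turn out to be \<open>v_y\<close>, \<open>v\<close> and \<open>v_x\<close>.\<close>
definition w :: "real \<times> real \<Rightarrow> real" where
  "w = kernel_int (\<lambda>x s. indicator {..<x} s) (zext l g)"

definition Z :: "real \<times> real \<Rightarrow> real" where
  "Z = kernel_int (\<lambda>x s. indicator {0<..<pi} x * (indicator {0<..<pi} s * (x * s / pi - min x s))) (zext l h)"

definition \<omega> :: "real \<times> real \<Rightarrow> real" where
  "\<omega> = kernel_int (\<lambda>x s. indicator {0<..<pi} s * (s / pi - indicator {x<..} s)) (zext l h)"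

lemma L2_w: "L2 l w"
  unfolding w_def
proof (rule L2_kernel_int[OF g(1), of _ 1])
  have [measurable]: "{p::real \<times> real. snd p < fst p} \<in> sets borel"
    by (intro borel_open open_Collect_less continuous_intros)
  have "(\<lambda>p. indicator {..<fst p} (snd p) :: real) = (\<lambda>p::real \<times> real. indicator {p. snd p < fst p} p)"
    by (auto simp: indicator_def)
  then show "(\<lambda>p::real \<times> real. indicator {..<fst p} (snd p) :: real) \<in> borel_measurable borel"
    by (simp only:) measurable
qed (simp add: indicator_def)

lemma fst_snd_measurable [measurable]:
  "(fst :: real \<times> real \<Rightarrow> real) \<in> borel_measurable borel" "(snd :: real \<times> real \<Rightarrow> real) \<in> borel_measurable borel"
  by (simp_all add: borel_prod[symmetric])

lemma Green_kernel_bound: "\<bar>indicator {0<..<pi} x * (indicator {0<..<pi} s * (x * s / pi - min x s))\<bar> \<le> pi"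
proof (cases "x \<in> {0<..<pi} \<and> s \<in> {0<..<pi}")
  case True
  then have "0 \<le> x * s / pi" "x * s / pi \<le> x" "x * s / pi \<le> s" by (auto simp: divide_le_eq mult_right_mono)
  moreover have "0 < min x s" "min x s < pi" using True by auto
  moreover have "x < pi" "s < pi" using True by auto
  ultimately have "\<bar>x * s / pi - min x s\<bar> \<le> pi" unfolding abs_le_iff by linarith
  then show ?thesis using True by simp
qed (auto simp: indicator_def)

lemma L2_Z: "L2 l Z"
  unfolding Z_def by (rule L2_kernel_int[OF h(1) _ Green_kernel_bound]) measurable

lemma \<omega>_kernel_bound: "\<bar>indicator {0<..<pi} s * (s / pi - indicator {x<..} s)\<bar> \<le> 1"
proof (cases "s \<in> {0<..<pi}")
  case True
  then have "0 \<le> s / pi" "s / pi \<le> 1" by (auto simp: divide_le_eq)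
  then show ?thesis using True by (auto simp: indicator_def)
qed simp

lemma L2_\<omega>: "L2 l \<omega>"
  unfolding \<omega>_def
proof (rule L2_kernel_int[OF h(1) _ \<omega>_kernel_bound])
  have [measurable]: "{p::real \<times> real. fst p < snd p} \<in> sets borel"
    by (intro borel_open open_Collect_less continuous_intros)
  have "(\<lambda>p::real \<times> real. indicator {0<..<pi} (snd p) * (snd p / pi - indicator {fst p<..} (snd p)))
    = (\<lambda>p. indicator {0<..<pi} (snd p) * (snd p / pi - indicator {p. fst p < snd p} p))"
    by (auto simp: indicator_def)
  then show "(\<lambda>p::real \<times> real. indicator {0<..<pi} (snd p) * (snd p / pi - indicator {fst p<..} (snd p))) \<in> borel_measurable borel"
    by (simp only:) measurable
qed

text \<open>The moment of v against \<open>deriv \<zeta>\<close> has, as a function of x, the weak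
  derivative given by minus the moment of g against \<open>\<zeta>\<close>. It vanishes at x = 0, so
  integrating from there identifies w (x, _) as the weak derivative of the slice v (x, _).\<close>

lemma v_moment_y:
  assumes x: "x \<in> {0<..<pi}" and \<zeta>: "test1 (-l) l \<zeta>"
  shows "(LBINT y. v (x, y) * deriv \<zeta> y) = - (LBINT y. w (x, y) * \<zeta> y)"
proof -
  define G where "G s = - (LBINT y. zext l g (s, y) * \<zeta> y)" for s
  have Gi: "integrable lborel G" unfolding G_def using L2_moment(2)[OF g(1) \<zeta>] by simp
  have "(LBINT y. v (x, y) * deriv \<zeta> y) - (LBINT y. v (0, y) * deriv \<zeta> y) = (LBINT s. G s * indicator {0<..<x} s)"
  proof (rule du_Bois_Reymond_first[OF moment_continuous[OF test1_deriv[OF \<zeta>]] Gi])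
    fix \<eta> assume \<eta>: "test1 0 pi \<eta>"
    have "(LBINT x. (LBINT y. v (x, y) * deriv \<zeta> y) * deriv \<eta> x) = (LBINT p. zext l v p * tensor (deriv \<eta>) (deriv \<zeta>) p)"
      by (simp add: tensor_Fubini_v test1_deriv \<eta> \<zeta>)
    also have "tensor (deriv \<eta>) (deriv \<zeta>) = iter_pd [False, True] (tensor \<eta> \<zeta>)"
      using test1_smooth[OF \<eta>] test1_smooth[OF \<zeta>] smooth1_deriv(2) by (simp add: iter_pd_def pd_tensor)
    also have "(LBINT p. zext l v p * iter_pd [False, True] (tensor \<eta> \<zeta>) p) = (LBINT p. zext l g p * tensor \<eta> \<zeta> p)"
      using g(2) test_fun_tensor[OF \<eta> \<zeta>] unfolding weak_deriv_iff by fastforce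
    also have "\<dots> = - (LBINT x. G x * \<eta> x)" unfolding tensor_Fubini[OF g(1) \<eta> \<zeta>] by (simp add: G_def)
    finally show "(LBINT x. (LBINT y. v (x, y) * deriv \<zeta> y) * deriv \<eta> x) = - (LBINT x. G x * \<eta> x)" .
  qed (use x in auto)
  moreover have "(LBINT s. G s * indicator {0<..<x} s) = - (LBINT s. (LBINT y. zext l g (s, y) * \<zeta> y) * indicator {0<..<x} s)"
    by (simp add: G_def)
  moreover have "\<dots> = - (LBINT y. (LBINT s. zext l g (s, y) * indicator {0<..<x} s) * \<zeta> y)"
    by (subst kernel_moment[OF g(1) \<zeta>, of _ 1]) (auto simp: indicator_def)
  moreover have "(LBINT s. zext l g (s, y) * indicator {0<..<x} s) = w (x, y)" for y
    unfolding w_def kernel_int_def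
    by (intro Bochner_Integration.integral_cong) (auto simp: indicator_def zext_def Om_def)
  ultimately show ?thesis using moment_edge(1)[OF test1_deriv[OF \<zeta>]] by simp
qed

text \<open>The moment of v vanishes at x = 0 and x = pi, so it solves a Dirichlet problem on (0,
  pi) whose right-hand side is the moment of h; the Green kernel then commutes with testing in
  y.\<close>

lemma v_moment_x:
  assumes x: "x \<in> {0<..<pi}" and \<zeta>: "test1 (-l) l \<zeta>"
  shows "(LBINT y. v (x, y) * \<zeta> y) = (LBINT y. Z (x, y) * \<zeta> y)"
proof -
  define G where "G s = (LBINT y. zext l h (s, y) * \<zeta> y)" for s
  have Gi: "integrable lborel G" unfolding G_def using L2_moment(2)[OF h(1) \<zeta>] by simp
  have "(LBINT y. v (x, y) * \<zeta> y) = (LBINT s. G s * (indicator {0<..<pi} s * (x * s / pi - min x s)))"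
  proof (rule du_Bois_Reymond_second[OF moment_continuous[OF \<zeta>] moment_edge[OF \<zeta>] Gi])
    fix \<eta> assume \<eta>: "test1 0 pi \<eta>"
    have "(LBINT x. (LBINT y. v (x, y) * \<zeta> y) * deriv (deriv \<eta>) x) = (LBINT p. zext l v p * tensor (deriv (deriv \<eta>)) \<zeta> p)"
      by (simp add: tensor_Fubini_v test1_deriv \<eta> \<zeta>)
    also have "tensor (deriv (deriv \<eta>)) \<zeta> = iter_pd [False, False] (tensor \<eta> \<zeta>)"
      using test1_smooth[OF \<eta>] test1_smooth[OF \<zeta>] smooth1_deriv(2) by (simp add: iter_pd_def pd_tensor)
    also have "(LBINT p. zext l v p * iter_pd [False, False] (tensor \<eta> \<zeta>) p) = (LBINT p. zext l h p * tensor \<eta> \<zeta> p)"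
      using h(2) test_fun_tensor[OF \<eta> \<zeta>] unfolding weak_deriv_iff by fastforce
    also have "\<dots> = (LBINT x. G x * \<eta> x)" unfolding tensor_Fubini[OF h(1) \<eta> \<zeta>] by (simp add: G_def)
    finally show "(LBINT x. (LBINT y. v (x, y) * \<zeta> y) * deriv (deriv \<eta>) x) = (LBINT x. G x * \<eta> x)" .
  qed (use x in auto)
  also have "\<dots> = (LBINT y. (LBINT s. zext l h (s, y) * (indicator {0<..<pi} s * (x * s / pi - min x s))) * \<zeta> y)"
    unfolding G_def by (rule kernel_moment[OF h(1) \<zeta>, of _ pi]) (use Green_kernel_bound[of x] x in auto)
  also have "\<dots> = (LBINT y. Z (x, y) * \<zeta> y)" using x by (simp add: Z_def kernel_int_def)
  finally show ?thesis .
qed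

end

text \<open>x is a frozen parameter of a kernel acting on a function integrable in both variables,
  so the bounds hold at each such x, not merely at almost every one.\<close>

lemma kernel_int_slice:
  assumes f: "L2 l f" and j: "j x \<in> borel_measurable borel" "\<And>s. \<bar>j x s\<bar> \<le> C"
  shows "integrable lborel (\<lambda>y. kernel_int j (zext l f) (x, y))"
    "(LBINT y. \<bar>kernel_int j (zext l f) (x, y)\<bar>) \<le> C * (LBINT p. \<bar>zext l f p\<bar>)"
    "y \<notin> {-l<..<l} \<Longrightarrow> kernel_int j (zext l f) (x, y) = 0"
proof -
  define F where "F p = zext l f p * j x (fst p)" for p
  have fi: "integrable lborel (zext l f)" by (rule L2_integrable[OF f])
  have iF: "integrable lborel F" unfolding F_def
    by (rule integrable_mult_bounded[OF fi _ j(2)]) (simp add: measurable_compose[OF _ j(1)] borel_prod[symmetric])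
  have eq: "kernel_int j (zext l f) (x, y) = (LBINT s. F (s, y))" for y by (simp add: kernel_int_def F_def)
  show i: "integrable lborel (\<lambda>y. kernel_int j (zext l f) (x, y))"
    unfolding eq by (rule lborel_Fubini(6)[OF iF])
  have iF': "integrable lborel (\<lambda>p. \<bar>F p\<bar>)" using iF by simp
  have "(LBINT y. \<bar>kernel_int j (zext l f) (x, y)\<bar>) \<le> (LBINT y. (LBINT s. \<bar>F (s, y)\<bar>))"
    unfolding eq
    by (rule integral_mono[OF integrable_abs[OF lborel_Fubini(6)[OF iF]] lborel_Fubini(6)[OF iF'] integral_abs_bound])
  also have "\<dots> = (LBINT p. \<bar>F p\<bar>)" using lborel_Fubini(2)[OF iF'] by simp
  also have "\<dots> \<le> (LBINT p. C * \<bar>zext l f p\<bar>)"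
  proof (rule integral_mono[OF iF'])
    show "integrable lborel (\<lambda>p. C * \<bar>zext l f p\<bar>)" using fi by simp
    show "\<bar>F p\<bar> \<le> C * \<bar>zext l f p\<bar>" for p
      unfolding F_def abs_mult using j(2)[of "fst p"] by (subst mult.commute) (rule mult_right_mono, simp_all)
  qed
  finally show "(LBINT y. \<bar>kernel_int j (zext l f) (x, y)\<bar>) \<le> C * (LBINT p. \<bar>zext l f p\<bar>)" by simp
  show "kernel_int j (zext l f) (x, y) = 0" if "y \<notin> {-l<..<l}"
    using that by (auto simp: kernel_int_def zext_def Om_def)
qed

lemma closure_Om: "l > 0 \<Longrightarrow> closure (Om l) = Omc l"
  by (simp add: Om_def Omc_def closure_Times)

section \<open>Pointwise bounds and first weak derivatives\<close>

context hinged
begin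

text \<open>The first-order lemma is used a second time, now in y on the continuous slice v (x, _),
  whose weak derivative is known from \<open>v_moment_y\<close>.\<close>

lemma v_increment:
  assumes x: "x \<in> {0<..<pi}" and ab: "- l \<le> a" "a < b" "b \<le> l"
  shows "v (x, b) - v (x, a) = (LBINT y. w (x, y) * indicator {a<..<b} y)"
proof (rule du_Bois_Reymond_first[OF slice_continuous _ _ ab])
  show "integrable lborel (\<lambda>y. w (x, y))"
    unfolding w_def by (rule kernel_int_slice(1)[OF g(1), of _ _ 1]) (auto simp: indicator_def)
qed (use v_moment_y[OF x] x in auto)

lemma v_oscillation:
  assumes x: "x \<in> {0<..<pi}" and ab: "a \<in> {-l..l}" "b \<in> {-l..l}"
  shows "\<bar>v (x, b) - v (x, a)\<bar> \<le> (LBINT p. \<bar>zext l g p\<bar>)"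
proof -
  have w: "integrable lborel (\<lambda>y. w (x, y))" "(LBINT y. \<bar>w (x, y)\<bar>) \<le> 1 * (LBINT p. \<bar>zext l g p\<bar>)"
    unfolding w_def by (rule kernel_int_slice(1,2)[OF g(1), of _ _ 1]; auto simp: indicator_def)+
  have *: "\<bar>v (x, b) - v (x, a)\<bar> \<le> (LBINT p. \<bar>zext l g p\<bar>)" if "- l \<le> a" "a < b" "b \<le> l" for a b
  proof -
    have "\<bar>v (x, b) - v (x, a)\<bar> \<le> (LBINT y. \<bar>w (x, y) * indicator {a<..<b} y\<bar>)"
      unfolding v_increment[OF x that] by (rule integral_abs_bound)
    also have "\<dots> \<le> (LBINT y. \<bar>w (x, y)\<bar>)"
    proof (rule integral_mono)
      show "integrable lborel (\<lambda>y. \<bar>w (x, y) * indicator {a<..<b} y\<bar>)"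
        by (intro integrable_abs integrable_real_mult_indicator w) auto
    qed (use w in \<open>auto simp: indicator_def\<close>)
    finally show ?thesis using w(2) by simp
  qed
  consider "a < b" | "b < a" | "a = b" by linarith
  then show ?thesis using *[of a b] *[of b a] ab by cases (auto simp: abs_minus_commute)
qed

lemma v_slice_integrable: "integrable lborel (\<lambda>y. v (x, y))"
proof -
  obtain M where M: "M \<ge> 0" "\<And>p. \<bar>v p\<bar> \<le> M" using v_bounded by blast
  have "integrable lborel (\<lambda>y. indicator {-l..l} y * v (x, y))"
    by (rule integrable_mult_bounded[OF integrable_indicator_interval(2) _ M(2)]) (auto intro: borel_measurable_slices)
  also have "(\<lambda>y. indicator {-l..l} y * v (x, y)) = (\<lambda>y. v (x, y))"
  proof
    show "indicator {-l..l} y * v (x, y) = v (x, y)" for y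
      using outside[of "(x, y)"] by (cases "y \<in> {-l..l}") (auto simp: Omc_def)
  qed
  finally show ?thesis .
qed

text \<open>\<open>v_moment_x\<close> speaks of test functions only, so the bound is proved for
  tests and then carried to the indicator of (-l, l). The factor pi bounds the Green kernel.\<close>

lemma v_mean:
  assumes x: "x \<in> {0<..<pi}"
  shows "\<bar>LBINT y. v (x, y) * indicator {-l<..<l} y\<bar> \<le> pi * (LBINT p. \<bar>zext l h p\<bar>)"
proof (rule integral_mult_indicator_lim[OF v_slice_integrable])
  have jm: "(\<lambda>s. indicator {0<..<pi} x * (indicator {0<..<pi} s * (x * s / pi - min x s))) \<in> borel_measurable borel"
    by measurable
  have Z: "integrable lborel (\<lambda>y. Z (x, y))" "(LBINT y. \<bar>Z (x, y)\<bar>) \<le> pi * (LBINT p. \<bar>zext l h p\<bar>)"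
    unfolding Z_def
    using kernel_int_slice(1,2)[OF h(1), of "\<lambda>x s. indicator {0<..<pi} x * (indicator {0<..<pi} s * (x * s / pi - min x s))" x pi,
      OF jm Green_kernel_bound] by simp_all
  fix \<zeta> assume \<zeta>: "test1 (-l) l \<zeta>" "\<forall>y. \<bar>\<zeta> y\<bar> \<le> 1"
  have i: "integrable lborel (\<lambda>y. Z (x, y) * \<zeta> y)"
    by (rule integrable_mult_bounded[OF Z(1), of _ 1]) (use \<zeta>(2) test1_measurable[OF \<zeta>(1)] in auto)
  have "\<bar>LBINT y. v (x, y) * \<zeta> y\<bar> \<le> (LBINT y. \<bar>Z (x, y) * \<zeta> y\<bar>)"
    unfolding v_moment_x[OF x \<zeta>(1)] by (rule integral_abs_bound)
  also have "\<dots> \<le> (LBINT y. \<bar>Z (x, y)\<bar>)"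
    by (rule integral_mono[OF integrable_abs[OF i] integrable_abs[OF Z(1)]])
      (use \<zeta>(2) in \<open>auto simp: abs_mult mult_left_le\<close>)
  finally show "\<bar>LBINT y. v (x, y) * \<zeta> y\<bar> \<le> pi * (LBINT p. \<bar>zext l h p\<bar>)" using Z(2) by simp
qed (use l in auto)

text \<open>Averaging v (x, y) - v (x, t) over t in (-l, l) splits the value into a mean and an
  oscillation. In pi / (2 l), pi bounds the Green kernel and 2 l is the height of the
  rectangle.\<close>

lemma v_sup_bound:
  "\<bar>v p\<bar> \<le> (LBINT p. \<bar>zext l g p\<bar>) + pi / (2 * l) * (LBINT p. \<bar>zext l h p\<bar>)"
proof -
  define N1 N2 where "N1 = (LBINT p. \<bar>zext l g p\<bar>)" and "N2 = (LBINT p. \<bar>zext l h p\<bar>)"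
  have N: "N1 \<ge> 0" "N2 \<ge> 0" by (simp_all add: N1_def N2_def)
  have *: "norm (v p) \<le> N1 + pi / (2 * l) * N2" if p: "p \<in> Om l" for p
  proof -
    obtain x y where xy: "p = (x, y)" "x \<in> {0<..<pi}" "y \<in> {-l<..<l}" using p by (auto simp: Om_def)
    have i1: "integrable lborel (\<lambda>t. v (x, t) * indicator {-l<..<l} t)"
      by (intro integrable_real_mult_indicator v_slice_integrable) auto
    have i0: "integrable lborel (indicator {-l<..<l} :: real \<Rightarrow> real)" by (rule integrable_indicator_interval)
    have i2: "integrable lborel (\<lambda>t. (v (x, y) - v (x, t)) * indicator {-l<..<l} t)"
      unfolding left_diff_distrib using i0 i1 by auto
    have "(LBINT t. (v (x, y) - v (x, t)) * indicator {-l<..<l} t)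
      = v (x, y) * (2 * l) - (LBINT t. v (x, t) * indicator {-l<..<l} t)"
      unfolding left_diff_distrib using i0 i1 l by (subst Bochner_Integration.integral_diff) auto
    moreover have "\<bar>LBINT t. (v (x, y) - v (x, t)) * indicator {-l<..<l} t\<bar> \<le> N1 * (2 * l)"
    proof -
      have "\<bar>LBINT t. (v (x, y) - v (x, t)) * indicator {-l<..<l} t\<bar>
        \<le> (LBINT t. \<bar>(v (x, y) - v (x, t)) * indicator {-l<..<l} t\<bar>)" by (rule integral_abs_bound)
      also have "\<dots> \<le> (LBINT t. N1 * indicator {-l<..<l} t)"
      proof (rule integral_mono[OF integrable_abs[OF i2]])
        show "\<bar>(v (x, y) - v (x, t)) * indicator {-l<..<l} t\<bar> \<le> N1 * indicator {-l<..<l} t" for t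
          using v_oscillation[OF xy(2), of t y] xy(3) by (cases "t \<in> {-l<..<l}") (auto simp: N1_def)
      qed (use i0 in auto)
      also have "\<dots> = N1 * (2 * l)" using l by simp
      finally show ?thesis .
    qed
    moreover have "\<bar>LBINT t. v (x, t) * indicator {-l<..<l} t\<bar> \<le> pi * N2"
      unfolding N2_def by (rule v_mean[OF xy(2)])
    ultimately have "\<bar>v (x, y) * (2 * l)\<bar> \<le> N1 * (2 * l) + pi * N2" by linarith
    then have "\<bar>v (x, y)\<bar> * (2 * l) \<le> N1 * (2 * l) + pi * N2" using l by (simp add: abs_mult)
    then show ?thesis using l by (simp add: xy field_simps)
  qed
  show ?thesis
  proof (cases "p \<in> Omc l")
    case True
    \<comment> \<open>The closed rectangle, including the edges y = l and y = -l, is reached from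
      the open one by continuity.\<close>
    have "norm (v p) \<le> N1 + pi / (2 * l) * N2"
      by (rule continuous_on_closure_norm_le[of "Om l" v]) (use * True cont closure_Om[OF l] in auto)
    then show ?thesis by (simp add: N1_def N2_def)
  qed (use outside N l in \<open>simp add: N1_def N2_def\<close>)
qed

text \<open>On every vertical line inside the rectangle v is the primitive of w with initial value v
  (x, -l), so the claim reduces to one-dimensional integration by parts.\<close>

lemma weak_deriv_y: "weak_deriv l [True] v w"
  unfolding weak_deriv_iff
proof (intro allI impI)
  fix \<phi> assume \<phi>: "test_fun l \<phi>"
  have sm: "smooth_fun \<phi>" using \<phi> by (simp add: test_fun_def)
  have e: "iter_pd [True] \<phi> = pd True \<phi>" "iter_pd [] \<phi> = \<phi>" by (simp_all add: iter_pd_def)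
  have c: "continuous_on UNIV (pd True \<phi>)" using test_fun_continuous[OF \<phi>, of "[True]"] by (simp add: e)
  have i1: "integrable lborel (\<lambda>p. zext l v p * pd True \<phi> p)"
    using integrable_zext_test[OF L2_integrable[OF L2_v] \<phi>, of "[True]"] by (simp add: e)
  have i2: "integrable lborel (\<lambda>p. zext l w p * \<phi> p)"
    using integrable_zext_test[OF L2_integrable[OF L2_w] \<phi>, of "[]"] by (simp add: e)
  have "(LBINT y. zext l v (x, y) * pd True \<phi> (x, y)) = - (LBINT y. zext l w (x, y) * \<phi> (x, y))" for x
  proof (cases "x \<in> {0<..<pi}")
    case True
    have zw: "zext l w (x, y) = w (x, y)" for y
      using True kernel_int_slice(3)[OF g(1), of "\<lambda>x s. indicator {..<x} s" x 1 y]
      by (cases "y \<in> {-l<..<l}") (auto simp: zext_def Om_def w_def indicator_def)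
    have wi: "integrable lborel (\<lambda>y. w (x, y))"
      unfolding w_def by (rule kernel_int_slice(1)[OF g(1), of _ _ 1]) (auto simp: indicator_def)
    have wi': "integrable lborel (\<lambda>y. zext l w (x, y))" unfolding zw by (rule wi)
    have "(LBINT y. zext l v (x, y) * pd True \<phi> (x, y))
      = (LBINT y. indicator {-l<..<l} y * (v (x, y) * pd True \<phi> (x, y)))"
      using True by (intro Bochner_Integration.integral_cong) (auto simp: zext_def Om_def indicator_def)
    also have "\<dots> = - (LBINT y. zext l w (x, y) * \<phi> (x, y))"
    proof (rule integral_by_parts_primitive[where c="v (x, -l)"])
      show "AE y in lborel. y \<in> {-l<..<l} \<longrightarrow> v (x, y) = v (x, -l) + (LBINT s. zext l w (x, s) * indicator {..<y} s)"
      proof (intro AE_I2 impI)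
        fix y assume y: "y \<in> {-l<..<l}"
        have "(LBINT s. zext l w (x, s) * indicator {..<y} s) = (LBINT s. w (x, s) * indicator {-l<..<y} s)"
          using True y by (intro Bochner_Integration.integral_cong) (auto simp: zext_def Om_def indicator_def)
        then show "v (x, y) = v (x, -l) + (LBINT s. zext l w (x, s) * indicator {..<y} s)"
          using v_increment[OF True, of "-l" y] y by simp
      qed
      show "continuous_on UNIV (\<lambda>y. pd True \<phi> (x, y))"
        by (rule continuous_on_compose2[OF c]) (auto intro!: continuous_intros)
      show "(\<lambda>y. v (x, y)) \<in> borel_measurable borel" by (rule borel_measurable_slices) simp
    qed (use l wi' in \<open>auto simp: zext_outside Om_def smooth_fun_partial(2)[OF sm] test_fun_outside[OF \<phi>]\<close>)
    finally show ?thesis .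
  next
    case False
    then have "zext l f (x, y) = 0" for f y by (intro zext_outside) (auto simp: Om_def)
    then show ?thesis by simp
  qed
  then show "(LBINT p. zext l v p * iter_pd [True] \<phi> p) = (-1) ^ length [True] * (LBINT p. zext l w p * \<phi> p)"
    unfolding e using lborel_Fubini(1)[OF i1] lborel_Fubini(1)[OF i2] by simp
qed

lemma v_eq_Z: "AE p in lborel. zext l v p = zext l Z p"
proof (rule AE_eq_of_tensor_tests[OF L2_v L2_Z])
  fix \<eta> \<zeta> assume t: "test1 0 pi \<eta>" "test1 (-l) l \<zeta>"
  have "(LBINT y. v (x, y) * \<zeta> y) * \<eta> x = (LBINT y. zext l Z (x, y) * \<zeta> y) * \<eta> x" for x
  proof (cases "x \<in> {0<..<pi}")
    case True
    have "zext l Z (x, y) * \<zeta> y = Z (x, y) * \<zeta> y" for y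
      using test1_outside[OF t(2), of y] True by (cases "y \<in> {-l<..<l}") (auto simp: zext_def Om_def)
    then show ?thesis using v_moment_x[OF True t(2)] by (simp only:)
  qed (use test1_outside[OF t(1)] in simp)
  then show "(LBINT p. zext l v p * tensor \<eta> \<zeta> p) = (LBINT p. zext l Z p * tensor \<eta> \<zeta> p)"
    unfolding tensor_Fubini_v[OF t] tensor_Fubini[OF L2_Z t] by (simp only:)
qed

text \<open>v is known to equal Z only almost everywhere, and Z is a primitive of
  \<open>\<omega>\<close> on almost every horizontal line. Hence v is exchanged for Z under the
  plane integral before any slice is integrated by parts.\<close>

lemma weak_deriv_x: "weak_deriv l [False] v \<omega>"
  unfolding weak_deriv_iff
proof (intro allI impI)
  fix \<phi> assume \<phi>: "test_fun l \<phi>"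
  have sm: "smooth_fun \<phi>" using \<phi> by (simp add: test_fun_def)
  have e: "iter_pd [False] \<phi> = pd False \<phi>" "iter_pd [] \<phi> = \<phi>" by (simp_all add: iter_pd_def)
  have c: "continuous_on UNIV (pd False \<phi>)" using test_fun_continuous[OF \<phi>, of "[False]"] by (simp add: e)
  have i1: "integrable lborel (\<lambda>p. zext l f p * pd False \<phi> p)" if "L2 l f" for f
    using integrable_zext_test[OF L2_integrable[OF that] \<phi>, of "[False]"] by (simp add: e)
  have i2: "integrable lborel (\<lambda>p. zext l \<omega> p * \<phi> p)"
    using integrable_zext_test[OF L2_integrable[OF L2_\<omega>] \<phi>, of "[]"] by (simp add: e)
  have "(LBINT p. zext l v p * pd False \<phi> p) = (LBINT p. zext l Z p * pd False \<phi> p)"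
    by (rule integral_cong_AE) (use i1[OF L2_v] i1[OF L2_Z] v_eq_Z in auto)
  also have "\<dots> = (LBINT y. (LBINT x. zext l Z (x, y) * pd False \<phi> (x, y)))"
    by (rule lborel_Fubini(2)[OF i1[OF L2_Z]])
  also have "\<dots> = (LBINT y. - (LBINT x. zext l \<omega> (x, y) * \<phi> (x, y)))"
  proof (rule integral_cong_AE)
    show "(\<lambda>y. LBINT x. zext l Z (x, y) * pd False \<phi> (x, y)) \<in> borel_measurable lborel"
      using lborel_Fubini(6)[OF i1[OF L2_Z]] by auto
    show "(\<lambda>y. - (LBINT x. zext l \<omega> (x, y) * \<phi> (x, y))) \<in> borel_measurable lborel"
      using lborel_Fubini(6)[OF i2] by auto
    show "AE y in lborel. (LBINT x. zext l Z (x, y) * pd False \<phi> (x, y)) = - (LBINT x. zext l \<omega> (x, y) * \<phi> (x, y))"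
      using lborel_Fubini(4)[OF L2_integrable[OF L2_\<omega>]] lborel_Fubini(4)[OF L2_integrable[OF h(1)]]
    proof eventually_elim
      case (elim y)
      show ?case
      proof (cases "y \<in> {-l<..<l}")
        case True
        have "(LBINT x. zext l Z (x, y) * pd False \<phi> (x, y))
          = (LBINT x. indicator {0<..<pi} x * (zext l Z (x, y) * pd False \<phi> (x, y)))"
          by (intro Bochner_Integration.integral_cong) (auto simp: zext_def Om_def indicator_def)
        also have "\<dots> = - (LBINT x. zext l \<omega> (x, y) * \<phi> (x, y))"
        proof (rule integral_by_parts_primitive[where c=0])
          show "AE x in lborel. x \<in> {0<..<pi} \<longrightarrow> zext l Z (x, y) = 0 + (LBINT s. zext l \<omega> (s, y) * indicator {..<x} s)"
          proof (intro AE_I2 impI)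
            fix x assume x: "x \<in> {0<..<pi}"
            have z\<omega>: "zext l \<omega> (s, y) = indicator {0<..<pi} s *
              (LBINT t. zext l h (t, y) * (indicator {0<..<pi} t * (t / pi - indicator {s<..} t)))" for s
              using True by (simp add: zext_def Om_def \<omega>_def kernel_int_def indicator_def)
            have "zext l Z (x, y) = (LBINT s. zext l h (s, y) * (indicator {0<..<pi} s * (x * s / pi - min x s)))"
              using x True by (simp add: zext_inside Om_def Z_def kernel_int_def)
            also have "\<dots> = (LBINT s. zext l \<omega> (s, y) * indicator {..<x} s)"
              unfolding z\<omega> by (rule Green_kernel_primitive[OF elim(2)]) (use x in auto)
            finally show "zext l Z (x, y) = 0 + (LBINT s. zext l \<omega> (s, y) * indicator {..<x} s)" by simp
          qed
          show "continuous_on UNIV (\<lambda>x. pd False \<phi> (x, y))"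
            by (rule continuous_on_compose2[OF c]) (auto intro!: continuous_intros)
          show "(\<lambda>x. zext l Z (x, y)) \<in> borel_measurable borel"
            by (rule borel_measurable_slices) (use L2_Z in \<open>simp add: L2_iff\<close>)
        qed (use elim in \<open>auto simp: zext_def Om_def smooth_fun_partial(1)[OF sm] test_fun_outside[OF \<phi>]\<close>)
        finally show ?thesis .
      qed (auto simp: zext_def Om_def)
    qed
  qed
  also have "\<dots> = - (LBINT p. zext l \<omega> p * \<phi> p)" using lborel_Fubini(2)[OF i2] by simp
  finally show "(LBINT p. zext l v p * iter_pd [False] \<phi> p) = (-1) ^ length [False] * (LBINT p. zext l \<omega> p * \<phi> p)"
    by (simp add: e)
qed

end

section \<open>Completeness of the energy space\<close>

definition sqn :: "real \<Rightarrow> (real \<times> real \<Rightarrow> real) \<Rightarrow> real" where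
  "sqn l g = (LBINT p. (zext l g p)\<^sup>2)"

lemma sqn_nonneg: "sqn l g \<ge> 0"
  by (simp add: sqn_def)

lemma zext_diff: "zext l (\<lambda>p. g p - h p) p = zext l g p - zext l h p"
  by (simp add: zext_def algebra_simps)

lemma L2_diff: "L2 l g \<Longrightarrow> L2 l h \<Longrightarrow> L2 l (\<lambda>p. g p - h p)"
  using L2_lincomb[of l g h 1 "-1"] by simp

lemma L1_le_sqn:
  assumes "L2 l g"
  shows "(LBINT p. \<bar>zext l g p\<bar>) \<le> sqrt (measure lborel (Om l) * sqn l g)"
  using L1_le_L2[OF assms] by (intro real_le_rsqrt) (simp add: sqn_def)

lemma sqn_cong_AE:
  assumes "L2 l g" "L2 l h" "AE p in lborel. zext l g p = zext l h p"
  shows "sqn l g = sqn l h"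
  unfolding sqn_def by (rule integral_cong_AE) (use assms in \<open>auto simp: L2_iff\<close>)

text \<open>Riesz--Fischer: a rapidly converging subsequence converges almost everywhere, and Fatou's
  lemma turns this into convergence in the mean.\<close>
lemma L2_complete:
  assumes g: "\<And>n. L2 l (g n)"
    and cauchy: "\<And>e. e > 0 \<Longrightarrow> \<exists>N. \<forall>m\<ge>N. \<forall>n\<ge>N. sqn l (\<lambda>p. g m p - g n p) < e"
  obtains G where "L2 l G" "(\<lambda>n. sqn l (\<lambda>p. g n p - G p)) \<longlonglongrightarrow> 0"
proof -
  \<comment> \<open>The rate (1/4)^j for squared norms bounds the L1 norms of consecutive
    differences by a multiple of the summable (1/2)^j.\<close>
  have "\<exists>N. \<forall>m\<ge>N. \<forall>n\<ge>N. sqn l (\<lambda>p. g m p - g n p) < (1/4) ^ j" for j :: nat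
    by (rule cauchy) simp
  then obtain N :: "nat \<Rightarrow> nat" where N: "\<And>j m n. m \<ge> N j \<Longrightarrow> n \<ge> N j \<Longrightarrow> sqn l (\<lambda>p. g m p - g n p) < (1/4) ^ j"
    by metis
  \<comment> \<open>The partial sums of N dominate every N i with i \<le> j, although N itself need
    not be monotone.\<close>
  define k where "k j = (\<Sum>i\<le>j. N i)" for j
  have kN: "N i \<le> k j" if "i \<le> j" for i j
    unfolding k_def by (rule member_le_sum) (use that in auto)
  define u where "u j = zext l (g (k j))" for j
  have um [measurable]: "u j \<in> borel_measurable borel" for j using g by (simp add: u_def L2_iff)
  have gm [measurable]: "zext l (g n) \<in> borel_measurable borel" for n using g by (simp add: L2_iff)
  define d where "d j p = u (Suc j) p - u j p" for j p
  have dz: "d j p = zext l (\<lambda>p. g (k (Suc j)) p - g (k j) p) p" for j p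
    by (simp add: d_def u_def zext_diff)
  have di: "integrable lborel (d j)" for j
    unfolding dz[abs_def] by (rule L2_integrable[OF L2_diff[OF g g]])
  define \<mu> where "\<mu> = measure lborel (Om l)"
  have \<mu>0: "\<mu> \<ge> 0" by (simp add: \<mu>_def)
  have dn: "(LBINT p. \<bar>d j p\<bar>) \<le> sqrt \<mu> * (1/2) ^ j" for j
  proof -
    have "(LBINT p. \<bar>d j p\<bar>) \<le> sqrt (\<mu> * sqn l (\<lambda>p. g (k (Suc j)) p - g (k j) p))"
      unfolding dz[abs_def] \<mu>_def by (rule L1_le_sqn[OF L2_diff[OF g g]])
    also have "\<dots> \<le> sqrt (\<mu> * (1/4) ^ j)"
      using N[of j "k (Suc j)" "k j"] kN[of j j] kN[of j "Suc j"] \<mu>0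
      by (intro real_sqrt_le_mono mult_left_mono) auto
    also have "\<dots> = sqrt \<mu> * sqrt ((1/2) ^ j * (1/2) ^ j)"
      by (simp add: real_sqrt_mult flip: power_mult_distrib)
    finally show ?thesis by simp
  qed
  have "AE p in lborel. (\<Sum>j. ennreal \<bar>d j p\<bar>) \<noteq> \<infinity>"
  proof (rule nn_integral_noteq_infinite)
    have "(\<integral>\<^sup>+p. (\<Sum>j. ennreal \<bar>d j p\<bar>) \<partial>lborel) = (\<Sum>j. \<integral>\<^sup>+p. ennreal \<bar>d j p\<bar> \<partial>lborel)"
      by (rule nn_integral_suminf) (use di in auto)
    also have "\<dots> = (\<Sum>j. ennreal (LBINT p. \<bar>d j p\<bar>))"
      using di by (intro suminf_cong nn_integral_eq_integral) auto
    also have "\<dots> \<le> (\<Sum>j. ennreal (sqrt \<mu> * (1/2) ^ j))"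
      by (intro suminf_le ennreal_leI dn) auto
    also have "\<dots> < \<infinity>"
    proof -
      have s: "summable (\<lambda>j. sqrt \<mu> * (1/2) ^ j)" by (intro summable_mult summable_geometric) simp
      show ?thesis by (subst suminf_ennreal2[OF _ s]) (use \<mu>0 in auto)
    qed
    finally show "(\<integral>\<^sup>+p. (\<Sum>j. ennreal \<bar>d j p\<bar>) \<partial>lborel) \<noteq> \<infinity>" by simp
  qed (use di in measurable)
  then have conv: "AE p in lborel. convergent (\<lambda>j. u j p)"
  proof eventually_elim
    case (elim p)
    have "summable (\<lambda>j. \<bar>d j p\<bar>)" using elim by (intro summable_suminf_not_top) auto
    then have "summable (\<lambda>j. d j p)" by (rule summable_rabs_cancel)
    then have "convergent (\<lambda>n. \<Sum>j<n. d j p)" by (simp add: summable_iff_convergent)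
    moreover have "(\<Sum>j<n. d j p) = u n p - u 0 p" for n unfolding d_def by (rule sum_lessThan_telescope[of "\<lambda>j. u j p"])
    ultimately have "convergent (\<lambda>n. u n p - u 0 p)" by simp
    then have "convergent (\<lambda>n. (u n p - u 0 p) + u 0 p)" by (intro convergent_add convergent_const)
    then show ?case by simp
  qed
  \<comment> \<open>Where the subsequence diverges, \<open>lim\<close> has an unspecified value, but
    this happens only on a null set.\<close>
  define G where "G p = lim (\<lambda>j. u j p)" for p
  have Gm [measurable]: "G \<in> borel_measurable borel" unfolding G_def by measurable
  have G0: "zext l G p = G p" for p
  proof (cases "p \<in> Om l")
    case False
    then have "u j p = 0" for j by (simp add: u_def zext_outside)
    then have "G p = 0" by (simp add: G_def)
    then show ?thesis using False by (simp add: zext_outside)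
  qed (simp add: zext_inside)
  have fatou: "(\<integral>\<^sup>+p. ennreal ((zext l (g n) p - G p)\<^sup>2) \<partial>lborel) \<le> ennreal ((1/4) ^ i)" if n: "n \<ge> N i" for n i
  proof -
    have "(\<integral>\<^sup>+p. ennreal ((zext l (g n) p - G p)\<^sup>2) \<partial>lborel)
      = (\<integral>\<^sup>+p. liminf (\<lambda>j. ennreal ((zext l (g n) p - u j p)\<^sup>2)) \<partial>lborel)"
    proof (rule nn_integral_cong_AE)
      show "AE p in lborel. ennreal ((zext l (g n) p - G p)\<^sup>2) = liminf (\<lambda>j. ennreal ((zext l (g n) p - u j p)\<^sup>2))"
        using conv
      proof eventually_elim
        case (elim p)
        then have "(\<lambda>j. u j p) \<longlonglongrightarrow> G p" unfolding G_def by (simp add: convergent_LIMSEQ_iff)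
        then have "(\<lambda>j. ennreal ((zext l (g n) p - u j p)\<^sup>2)) \<longlonglongrightarrow> ennreal ((zext l (g n) p - G p)\<^sup>2)"
          by (intro tendsto_ennrealI tendsto_intros)
        then show ?case by (intro lim_imp_Liminf[symmetric]) simp_all
      qed
    qed
    also have "\<dots> \<le> liminf (\<lambda>j. \<integral>\<^sup>+p. ennreal ((zext l (g n) p - u j p)\<^sup>2) \<partial>lborel)"
      by (rule nn_integral_liminf) measurable
    also have "\<dots> \<le> ennreal ((1/4) ^ i)"
    proof (rule Liminf_le)
      show "\<forall>\<^sub>F j in sequentially. (\<integral>\<^sup>+p. ennreal ((zext l (g n) p - u j p)\<^sup>2) \<partial>lborel) \<le> ennreal ((1/4) ^ i)"
        unfolding eventually_sequentially
      proof (intro exI[of _ i] allI impI)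
        fix j assume j: "i \<le> j"
        have "(\<integral>\<^sup>+p. ennreal ((zext l (g n) p - u j p)\<^sup>2) \<partial>lborel) = ennreal (sqn l (\<lambda>p. g n p - g (k j) p))"
          unfolding sqn_def u_def zext_diff[symmetric]
          using L2_diff[OF g g] by (intro nn_integral_eq_integral) (auto simp: L2_iff)
        also have "\<dots> \<le> ennreal ((1/4) ^ i)"
          using N[OF n kN[OF j]] by (intro ennreal_leI) simp
        finally show "(\<integral>\<^sup>+p. ennreal ((zext l (g n) p - u j p)\<^sup>2) \<partial>lborel) \<le> ennreal ((1/4) ^ i)" .
      qed
    qed simp
    finally show ?thesis .
  qed
  have int: "integrable lborel (\<lambda>p. (zext l (\<lambda>p. g n p - G p) p)\<^sup>2)" if "n \<ge> N i" for n i
    unfolding zext_diff G0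
  proof (rule integrableI_nonneg)
    show "(\<integral>\<^sup>+p. ennreal ((zext l (g n) p - G p)\<^sup>2) \<partial>lborel) < \<infinity>"
      using fatou[OF that] by (rule le_less_trans) simp
  qed auto
  \<comment> \<open>Fatou controls g n - G, not G; square integrability of G follows by subtracting
    from g (N 0).\<close>
  have "L2 l (\<lambda>p. g (N 0) p - G p)"
    unfolding L2_iff using int[of 0 "N 0"] by (simp add: zext_diff[abs_def] G0)
  from L2_diff[OF g[of "N 0"] this] have GL2: "L2 l G" by simp
  have le: "sqn l (\<lambda>p. g n p - G p) \<le> (1/4) ^ i" if "n \<ge> N i" for n i
  proof -
    have "ennreal (sqn l (\<lambda>p. g n p - G p)) = (\<integral>\<^sup>+p. ennreal ((zext l (g n) p - G p)\<^sup>2) \<partial>lborel)"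
      unfolding sqn_def using int[OF that] by (subst nn_integral_eq_integral[symmetric]) (auto simp: zext_diff G0)
    also have "\<dots> \<le> ennreal ((1/4) ^ i)" by (rule fatou[OF that])
    finally show ?thesis by simp
  qed
  have "(\<lambda>n. sqn l (\<lambda>p. g n p - G p)) \<longlonglongrightarrow> 0"
  proof (rule LIMSEQ_I)
    fix e :: real assume "e > 0"
    then obtain i where i: "(1/4) ^ i < e" using real_arch_pow_inv[of e "1/4"] by auto
    show "\<exists>no. \<forall>n\<ge>no. norm (sqn l (\<lambda>p. g n p - G p) - 0) < e"
      by (intro exI[of _ "N i"] allI impI) (use le[of i] i sqn_nonneg in \<open>fastforce intro: le_less_trans\<close>)
  qed
  with GL2 show ?thesis by (rule that)
qed

text \<open>Test functions are bounded and the rectangle has finite measure, so L2 convergence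
  implies the L1 convergence that testing needs.\<close>

lemma L2_limit_test:
  assumes g: "\<And>n. L2 l (g n)" "L2 l G" "(\<lambda>n. sqn l (\<lambda>p. g n p - G p)) \<longlonglongrightarrow> 0" and \<phi>: "test_fun l \<phi>"
  shows "(\<lambda>n. LBINT p. zext l (g n) p * iter_pd ds \<phi> p) \<longlonglongrightarrow> (LBINT p. zext l G p * iter_pd ds \<phi> p)"
proof -
  obtain M where M: "M \<ge> 0" "\<And>p. p \<in> Om l \<Longrightarrow> \<bar>iter_pd ds \<phi> p\<bar> \<le> M" by (rule test_fun_bounded[OF \<phi>]) blast
  have i: "integrable lborel (\<lambda>p. zext l f p * iter_pd ds \<phi> p)" if "L2 l f" for f
    by (rule integrable_zext_test[OF L2_integrable[OF that] \<phi>])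
  have bd: "\<bar>(LBINT p. zext l (g n) p * iter_pd ds \<phi> p) - (LBINT p. zext l G p * iter_pd ds \<phi> p)\<bar>
    \<le> M * sqrt (measure lborel (Om l) * sqn l (\<lambda>p. g n p - G p))" for n
  proof -
    have d: "L2 l (\<lambda>p. g n p - G p)" by (rule L2_diff[OF g(1,2)])
    have "(LBINT p. zext l (g n) p * iter_pd ds \<phi> p) - (LBINT p. zext l G p * iter_pd ds \<phi> p)
      = (LBINT p. zext l (\<lambda>p. g n p - G p) p * iter_pd ds \<phi> p)"
      using i[OF g(1)[of n]] i[OF g(2)] by (simp add: zext_diff left_diff_distrib)
    also have "\<bar>\<dots>\<bar> \<le> (LBINT p. \<bar>zext l (\<lambda>p. g n p - G p) p * iter_pd ds \<phi> p\<bar>)" by (rule integral_abs_bound)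
    also have "\<dots> \<le> (LBINT p. M * \<bar>zext l (\<lambda>p. g n p - G p) p\<bar>)"
    proof (rule integral_mono)
      show "\<bar>zext l (\<lambda>p. g n p - G p) p * iter_pd ds \<phi> p\<bar> \<le> M * \<bar>zext l (\<lambda>p. g n p - G p) p\<bar>" for p
        using M(2)[of p] by (cases "p \<in> Om l")
          (auto simp: abs_mult zext_outside mult.commute[of M] intro!: mult_left_mono)
    qed (use integrable_abs[OF i[OF d]] L2_integrable[OF d] in auto)
    also have "\<dots> \<le> M * sqrt (measure lborel (Om l) * sqn l (\<lambda>p. g n p - G p))"
      using L1_le_sqn[OF d] M(1) by (simp add: mult_left_mono)
    finally show ?thesis .
  qed
  have "(\<lambda>n. M * sqrt (measure lborel (Om l) * sqn l (\<lambda>p. g n p - G p))) \<longlonglongrightarrow> M * sqrt (measure lborel (Om l) * 0)"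
    by (intro tendsto_intros g(3))
  then have lim: "(\<lambda>n. M * sqrt (measure lborel (Om l) * sqn l (\<lambda>p. g n p - G p))) \<longlonglongrightarrow> 0" by simp
  show ?thesis
    by (rule LIM_zero_cancel, rule Lim_null_comparison[OF always_eventually lim]) (simp only: real_norm_def bd simp_thms)
qed

lemma weak_deriv_limit:
  assumes "\<And>n. L2 l (u n)" "L2 l U" "(\<lambda>n. sqn l (\<lambda>p. u n p - U p)) \<longlonglongrightarrow> 0"
    and "\<And>n. L2 l (g n)" "L2 l G" "(\<lambda>n. sqn l (\<lambda>p. g n p - G p)) \<longlonglongrightarrow> 0"
    and "\<And>n. weak_deriv l ds (u n) (g n)"
  shows "weak_deriv l ds U G"
  unfolding weak_deriv_iff
proof (intro allI impI)
  fix \<phi> assume \<phi>: "test_fun l \<phi>"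
  have "(\<lambda>n. LBINT p. zext l (u n) p * iter_pd ds \<phi> p) \<longlonglongrightarrow> (LBINT p. zext l U p * iter_pd ds \<phi> p)"
    by (rule L2_limit_test[OF assms(1-3) \<phi>])
  moreover have "(\<lambda>n. (-1) ^ length ds * (LBINT p. zext l (g n) p * iter_pd [] \<phi> p))
    \<longlonglongrightarrow> (-1) ^ length ds * (LBINT p. zext l G p * iter_pd [] \<phi> p)"
    by (intro tendsto_mult tendsto_const L2_limit_test[OF assms(4-6) \<phi>])
  moreover have "(LBINT p. zext l (u n) p * iter_pd ds \<phi> p) = (-1) ^ length ds * (LBINT p. zext l (g n) p * iter_pd [] \<phi> p)" for n
    using assms(7)[of n] \<phi> by (simp add: weak_deriv_iff iter_pd_def)
  ultimately have "(LBINT p. zext l U p * iter_pd ds \<phi> p) = (-1) ^ length ds * (LBINT p. zext l G p * iter_pd [] \<phi> p)"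
    by (simp add: LIMSEQ_unique)
  then show "(LBINT p. zext l U p * iter_pd ds \<phi> p) = (-1) ^ length ds * (LBINT p. zext l G p * \<phi> p)"
    by (simp add: iter_pd_def)
qed

lemma weak_deriv_cong_AE:
  assumes "L2 l g" "L2 l h" "AE p in lborel. zext l g p = zext l h p" "weak_deriv l ds v h"
  shows "weak_deriv l ds v g"
  unfolding weak_deriv_iff
proof (intro allI impI)
  fix \<phi> assume \<phi>: "test_fun l \<phi>"
  have i: "integrable lborel (\<lambda>p. zext l f p * \<phi> p)" if "L2 l f" for f
    using integrable_zext_test[OF L2_integrable[OF that] \<phi>, of "[]"] by (simp add: iter_pd_def)
  have "(LBINT p. zext l g p * \<phi> p) = (LBINT p. zext l h p * \<phi> p)"
    by (rule integral_cong_AE) (use i[OF assms(1)] i[OF assms(2)] assms(3) in auto)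
  then show "(LBINT p. zext l v p * iter_pd ds \<phi> p) = (-1) ^ length ds * (LBINT p. zext l g p * \<phi> p)"
    using assms(4) \<phi> by (simp add: weak_deriv_iff)
qed

section \<open>Chosen weak derivatives and coercivity of the plate energy\<close>

lemma wd_L2: "H2s l v \<Longrightarrow> length ds \<le> 2 \<Longrightarrow> L2 l (wd l ds v)"
  and wd_weak_deriv: "H2s l v \<Longrightarrow> length ds \<le> 2 \<Longrightarrow> weak_deriv l ds v (wd l ds v)"
  unfolding wd_def H2s_def H2_def by (metis (mono_tags, lifting) someI_ex)+

lemma H2s_hinged:
  assumes "l > 0" "H2s l v"
  shows "hinged l v (wd l [False, True] v) (wd l [False, False] v)"
  using assms wd_L2[OF assms(2)] wd_weak_deriv[OF assms(2)]
  by unfold_locales (auto simp: H2s_def)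

lemma H2s_lincomb:
  assumes "H2s l u" "H2s l v" shows "H2s l (\<lambda>p. a * u p + b * v p)"
proof -
  have L: "L2 l u" "L2 l v" using assms by (auto simp: H2s_def H2_def)
  have "\<exists>g. L2 l g \<and> weak_deriv l ds (\<lambda>p. a * u p + b * v p) g" if "length ds \<le> 2" for ds
    using L2_lincomb[OF wd_L2[OF assms(1) that] wd_L2[OF assms(2) that]]
      weak_deriv_lincomb[OF L wd_L2[OF assms(1) that] wd_L2[OF assms(2) that]
        wd_weak_deriv[OF assms(1) that] wd_weak_deriv[OF assms(2) that]] by blast
  then have "H2 l (\<lambda>p. a * u p + b * v p)" unfolding H2_def using L2_lincomb[OF L] by blast
  then show ?thesis using assms unfolding H2s_def by (auto intro!: continuous_intros)
qed

lemma H2s_diff: "H2s l u \<Longrightarrow> H2s l v \<Longrightarrow> H2s l (\<lambda>p. u p - v p)"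
  using H2s_lincomb[of l u v 1 "-1"] by simp

lemma H2s_zero: "H2s l (\<lambda>p. 0)"
proof -
  have "L2 l (\<lambda>p. 0)" by (simp add: L2_iff zext_def)
  moreover have "weak_deriv l ds (\<lambda>p. 0) (\<lambda>p. 0)" for ds by (simp add: weak_deriv_iff zext_def)
  ultimately show ?thesis unfolding H2s_def H2_def by auto
qed

text \<open>\<open>wd\<close> picks a representative by \<open>SOME\<close>, so it is linear only up
  to null sets; uniqueness of weak derivatives gives exactly that.\<close>

lemma wd_lincomb:
  assumes "H2s l u" "H2s l v" "length ds \<le> 2"
  shows "AE p in lborel. zext l (wd l ds (\<lambda>p. a * u p + b * v p)) p = a * zext l (wd l ds u) p + b * zext l (wd l ds v) p"
proof -
  have L: "L2 l u" "L2 l v" using assms by (auto simp: H2s_def H2_def)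
  note w = wd_L2[OF assms(1,3)] wd_L2[OF assms(2,3)] wd_weak_deriv[OF assms(1,3)] wd_weak_deriv[OF assms(2,3)]
  show ?thesis
    using weak_deriv_unique[OF wd_L2[OF H2s_lincomb[OF assms(1,2)] assms(3)] L2_lincomb[OF w(1,2)]
      wd_weak_deriv[OF H2s_lincomb[OF assms(1,2)] assms(3)] weak_deriv_lincomb[OF L w]]
    by (simp add: zext_lincomb)
qed

text \<open>The derivative g of v may be any representative: the chosen one when comparing two
  members of a sequence, the L2 limit when comparing with the limit function.\<close>

lemma sqn_wd_diff:
  assumes "H2s l u" "H2s l v" "length ds \<le> 2" "L2 l g" "weak_deriv l ds v g"
  shows "sqn l (wd l ds (\<lambda>p. u p - v p)) = sqn l (\<lambda>p. wd l ds u p - g p)"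
proof (rule sqn_cong_AE)
  have L: "L2 l u" "L2 l v" using assms by (auto simp: H2s_def H2_def)
  have "weak_deriv l ds (\<lambda>p. 1 * u p + (-1) * v p) (\<lambda>p. 1 * wd l ds u p + (-1) * g p)"
    by (rule weak_deriv_lincomb[OF L wd_L2[OF assms(1,3)] assms(4) wd_weak_deriv[OF assms(1,3)] assms(5)])
  then show "AE p in lborel. zext l (wd l ds (\<lambda>p. u p - v p)) p = zext l (\<lambda>p. wd l ds u p - g p) p"
    using weak_deriv_unique[OF wd_L2[OF H2s_diff[OF assms(1,2)] assms(3)] L2_diff[OF wd_L2[OF assms(1,3)] assms(4)]
      wd_weak_deriv[OF H2s_diff[OF assms(1,2)] assms(3)]] by simp
qed (intro wd_L2 H2s_diff L2_diff assms)+

text \<open>The energy integrand as a bilinear form in the second derivatives xx, yy, xy of two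
  functions, so that pure algebra is separated from integration.\<close>

definition plate :: "real \<Rightarrow> real \<Rightarrow> real \<Rightarrow> real \<Rightarrow> real \<Rightarrow> real \<Rightarrow> real \<Rightarrow> real" where
  "plate \<sigma> a b c a' b' c' = (a + b) * (a' + b') + (1 - \<sigma>) * (2 * c * c' - a * b' - b * a')"

definition plate_density :: "real \<Rightarrow> real \<Rightarrow> (real \<times> real \<Rightarrow> real) \<Rightarrow> (real \<times> real \<Rightarrow> real) \<Rightarrow> real \<times> real \<Rightarrow> real" where
  "plate_density l \<sigma> u v p = plate \<sigma>
     (zext l (wd l [False, False] u) p) (zext l (wd l [True, True] u) p) (zext l (wd l [False, True] u) p)
     (zext l (wd l [False, False] v) p) (zext l (wd l [True, True] v) p) (zext l (wd l [False, True] v) p)"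

lemma H2s_inner_eq: "H2s_inner l \<sigma> u v = (LBINT p. plate_density l \<sigma> u v p)"
  unfolding H2s_inner_def set_lebesgue_integral_def
  by (rule Bochner_Integration.integral_cong) (auto simp: plate_density_def plate_def zext_def indicator_def)

lemma plate_density_integrable:
  assumes "H2s l u" "H2s l v" shows "integrable lborel (plate_density l \<sigma> u v)"
proof -
  have i: "integrable lborel (\<lambda>p. zext l (wd l ds u) p * zext l (wd l ds' v) p)" if "length ds \<le> 2" "length ds' \<le> 2" for ds ds'
    by (rule L2_product_integrable[OF wd_L2[OF assms(1) that(1)] wd_L2[OF assms(2) that(2)]])
  show ?thesis
    unfolding plate_density_def[abs_def] plate_def
    by (simp add: distrib_left distrib_right right_diff_distrib mult.assoc i)
qed

lemma H2s_inner_commute: "H2s_inner l \<sigma> u v = H2s_inner l \<sigma> v u"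
  unfolding H2s_inner_eq by (rule Bochner_Integration.integral_cong) (auto simp: plate_density_def plate_def algebra_simps)

lemma H2s_inner_lincomb:
  assumes "H2s l u" "H2s l v" "H2s l z"
  shows "H2s_inner l \<sigma> (\<lambda>p. a * u p + b * v p) z = a * H2s_inner l \<sigma> u z + b * H2s_inner l \<sigma> v z"
proof -
  have "(LBINT p. plate_density l \<sigma> (\<lambda>p. a * u p + b * v p) z p)
    = (LBINT p. a * plate_density l \<sigma> u z p + b * plate_density l \<sigma> v z p)"
  proof (rule integral_cong_AE)
    have AE: "AE p in lborel. zext l (wd l [x, y] (\<lambda>p. a * u p + b * v p)) p
      = a * zext l (wd l [x, y] u) p + b * zext l (wd l [x, y] v) p" for x y
      by (rule wd_lincomb[OF assms(1,2)]) simp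
    show "AE p in lborel. plate_density l \<sigma> (\<lambda>p. a * u p + b * v p) z p = a * plate_density l \<sigma> u z p + b * plate_density l \<sigma> v z p"
      using AE[of False False] AE[of True True] AE[of False True]
      by eventually_elim (simp add: plate_density_def plate_def algebra_simps)
  qed (use plate_density_integrable[OF H2s_lincomb[OF assms(1,2)] assms(3)]
        plate_density_integrable[OF assms(1,3)] plate_density_integrable[OF assms(2,3)] in auto)
  then show ?thesis unfolding H2s_inner_eq
    using plate_density_integrable[OF assms(1,3)] plate_density_integrable[OF assms(2,3)] by simp
qed

text \<open>With second derivatives a, b, c in the directions xx, yy, xy, the density is a^2 + b^2 +
  2 \<sigma> a b + 2 (1 - \<sigma>) c^2. Its excess over the lower bound is \<sigma> (a + b)^2, and
  its distance to the upper bound is \<sigma> (a - b)^2 + (1 - \<sigma>) (a^2 + b^2) + 2 \<sigma>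
  c^2.\<close>

lemma H2s_inner_bounds:
  assumes "H2s l v" "0 < \<sigma>" "\<sigma> < 1"
  shows "(1 - \<sigma>) * (sqn l (wd l [False, False] v) + sqn l (wd l [True, True] v) + 2 * sqn l (wd l [False, True] v)) \<le> H2s_inner l \<sigma> v v"
    "H2s_inner l \<sigma> v v \<le> 2 * (sqn l (wd l [False, False] v) + sqn l (wd l [True, True] v) + sqn l (wd l [False, True] v))"
proof -
  define a b c where "a = zext l (wd l [False, False] v)" and "b = zext l (wd l [True, True] v)" and "c = zext l (wd l [False, True] v)"
  have i: "integrable lborel (\<lambda>p. (a p)\<^sup>2)" "integrable lborel (\<lambda>p. (b p)\<^sup>2)" "integrable lborel (\<lambda>p. (c p)\<^sup>2)"
    using wd_L2[OF assms(1)] by (auto simp: a_def b_def c_def L2_iff)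
  have s: "sqn l (wd l [False, False] v) = (LBINT p. (a p)\<^sup>2)" "sqn l (wd l [True, True] v) = (LBINT p. (b p)\<^sup>2)"
    "sqn l (wd l [False, True] v) = (LBINT p. (c p)\<^sup>2)" by (simp_all add: a_def b_def c_def sqn_def)
  have d: "plate_density l \<sigma> v v p = (a p)\<^sup>2 + (b p)\<^sup>2 + 2 * \<sigma> * (a p * b p) + 2 * (1 - \<sigma>) * (c p)\<^sup>2" for p
    by (simp add: plate_density_def plate_def a_def b_def c_def algebra_simps power2_eq_square)
  have i0: "integrable lborel (plate_density l \<sigma> v v)" by (rule plate_density_integrable[OF assms(1,1)])
  have lo: "(1 - \<sigma>) * ((a p)\<^sup>2 + (b p)\<^sup>2 + 2 * (c p)\<^sup>2) \<le> plate_density l \<sigma> v v p" for p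
  proof -
    have "0 \<le> \<sigma> * (a p + b p)\<^sup>2" using assms by simp
    then show ?thesis unfolding d by (simp add: algebra_simps power2_eq_square)
  qed
  have hi: "plate_density l \<sigma> v v p \<le> 2 * ((a p)\<^sup>2 + (b p)\<^sup>2 + (c p)\<^sup>2)" for p
  proof -
    have "0 \<le> \<sigma> * (a p - b p)\<^sup>2" "0 \<le> (1 - \<sigma>) * ((a p)\<^sup>2 + (b p)\<^sup>2)" "0 \<le> \<sigma> * (c p)\<^sup>2" using assms by simp_all
    then show ?thesis unfolding d by (simp add: algebra_simps power2_eq_square)
  qed
  have "(LBINT p. (1 - \<sigma>) * ((a p)\<^sup>2 + (b p)\<^sup>2 + 2 * (c p)\<^sup>2)) \<le> H2s_inner l \<sigma> v v"
    unfolding H2s_inner_eq by (rule integral_mono[OF _ i0 lo]) (use i in auto)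
  then show "(1 - \<sigma>) * (sqn l (wd l [False, False] v) + sqn l (wd l [True, True] v) + 2 * sqn l (wd l [False, True] v)) \<le> H2s_inner l \<sigma> v v"
    using i by (simp add: s)
  have "H2s_inner l \<sigma> v v \<le> (LBINT p. 2 * ((a p)\<^sup>2 + (b p)\<^sup>2 + (c p)\<^sup>2))"
    unfolding H2s_inner_eq by (rule integral_mono[OF i0 _ hi]) (use i in auto)
  then show "H2s_inner l \<sigma> v v \<le> 2 * (sqn l (wd l [False, False] v) + sqn l (wd l [True, True] v) + sqn l (wd l [False, True] v))"
    using i by (simp add: s)
qed

text \<open>\<open>v_sup_bound\<close> is in terms of the L1 norms of v_xy and v_xx. Passing to L2
  costs sqrt \<open>\<mu>\<close>, and coercivity costs the root of 1 / (1 - \<sigma>).\<close>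

lemma H2s_sup_bound:
  assumes "l > 0" "0 < \<sigma>" "\<sigma> < 1"
  obtains C where "C \<ge> 0" "\<And>v p. H2s l v \<Longrightarrow> \<bar>v p\<bar> \<le> C * sqrt (H2s_inner l \<sigma> v v)"
proof -
  define \<mu> where "\<mu> = measure lborel (Om l)"
  have \<mu>0: "\<mu> \<ge> 0" by (simp add: \<mu>_def)
  define C where "C = sqrt (\<mu> / (1 - \<sigma>)) * (1 + pi / (2 * l))"
  have "\<bar>v p\<bar> \<le> C * sqrt (H2s_inner l \<sigma> v v)" if v: "H2s l v" for v p
  proof -
    define E where "E = H2s_inner l \<sigma> v v"
    interpret hinged l v "wd l [False, True] v" "wd l [False, False] v" by (rule H2s_hinged[OF assms(1) v])
    have nn: "0 \<le> (1 - \<sigma>) * sqn l (wd l ds v)" for ds using assms sqn_nonneg by simp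
    have "(1 - \<sigma>) * sqn l (wd l [False, False] v) \<le> E" "(1 - \<sigma>) * sqn l (wd l [False, True] v) \<le> E"
      using H2s_inner_bounds(1)[OF v assms(2,3)] nn[of "[False, False]"] nn[of "[True, True]"] nn[of "[False, True]"]
      unfolding E_def distrib_left mult.left_commute[of _ 2] by linarith+
    then have s: "sqn l (wd l [False, False] v) \<le> E / (1 - \<sigma>)" "sqn l (wd l [False, True] v) \<le> E / (1 - \<sigma>)"
      using assms by (simp_all add: pos_le_divide_eq mult.commute)
    have *: "(LBINT p. \<bar>zext l (wd l ds v) p\<bar>) \<le> sqrt (\<mu> / (1 - \<sigma>)) * sqrt E"
      if "L2 l (wd l ds v)" "sqn l (wd l ds v) \<le> E / (1 - \<sigma>)" for ds
    proof -
      have "(LBINT p. \<bar>zext l (wd l ds v) p\<bar>) \<le> sqrt (\<mu> * sqn l (wd l ds v))"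
        unfolding \<mu>_def by (rule L1_le_sqn[OF that(1)])
      also have "\<dots> \<le> sqrt (\<mu> * (E / (1 - \<sigma>)))"
        using that(2) \<mu>0 by (intro real_sqrt_le_mono mult_left_mono)
      also have "\<dots> = sqrt (\<mu> / (1 - \<sigma>)) * sqrt E" by (simp flip: real_sqrt_mult)
      finally show ?thesis .
    qed
    have "\<bar>v p\<bar> \<le> sqrt (\<mu> / (1 - \<sigma>)) * sqrt E + pi / (2 * l) * (sqrt (\<mu> / (1 - \<sigma>)) * sqrt E)"
      using v_sup_bound[of p] *[OF g(1) s(2)] mult_left_mono[OF *[OF h(1) s(1)], of "pi / (2 * l)"] assms by simp
    then show ?thesis by (simp add: C_def E_def algebra_simps)
  qed
  moreover have "C \<ge> 0" using \<mu>0 assms by (simp add: C_def)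
  ultimately show ?thesis using that by blast
qed

text \<open>Coercivity gives L2 limits of the three second derivatives, the sup bound gives a
  uniform limit V of the functions, and weak derivatives are closed under such limits. Of the
  derivatives required by \<open>H2\<close>, the order [True, False] comes from commuting and the
  first ones from the kernels of \<open>hinged\<close>.\<close>

lemma H2s_complete:
  assumes l: "l > 0" and \<sigma>: "0 < \<sigma>" "\<sigma> < 1" and v: "\<And>n. H2s l (v n)"
    and cauchy: "\<And>e. e > 0 \<Longrightarrow> \<exists>N. \<forall>m\<ge>N. \<forall>n\<ge>N. H2s_inner l \<sigma> (\<lambda>p. v m p - v n p) (\<lambda>p. v m p - v n p) < e"
  obtains V where "H2s l V" "(\<lambda>n. H2s_inner l \<sigma> (\<lambda>p. v n p - V p) (\<lambda>p. v n p - V p)) \<longlonglongrightarrow> 0"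
proof -
  obtain C where C: "C \<ge> 0" "\<And>v p. H2s l v \<Longrightarrow> \<bar>v p\<bar> \<le> C * sqrt (H2s_inner l \<sigma> v v)"
    by (rule H2s_sup_bound[OF l \<sigma>]) blast
  have sq_le: "(1 - \<sigma>) * sqn l (wd l ds u) \<le> H2s_inner l \<sigma> u u"
    if "H2s l u" "ds \<in> {[False, False], [True, True], [False, True]}" for u ds
  proof -
    have nn: "0 \<le> (1 - \<sigma>) * sqn l (wd l ds u)" for ds using \<sigma> sqn_nonneg by simp
    show ?thesis
      using H2s_inner_bounds(1)[OF that(1) \<sigma>] nn[of "[False, False]"] nn[of "[True, True]"] nn[of "[False, True]"] that(2)
      unfolding distrib_left mult.left_commute[of _ 2] by auto
  qed
  have ex: "\<exists>G. L2 l G \<and> (\<lambda>n. sqn l (\<lambda>p. wd l ds (v n) p - G p)) \<longlonglongrightarrow> 0"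
    if ds: "ds \<in> {[False, False], [True, True], [False, True]}" for ds
  proof -
    have len: "length ds \<le> 2" using ds by auto
    have c: "\<exists>N. \<forall>m\<ge>N. \<forall>n\<ge>N. sqn l (\<lambda>p. wd l ds (v m) p - wd l ds (v n) p) < e" if "e > 0" for e
    proof -
      have "(1 - \<sigma>) * e > 0" using that \<sigma> by simp
      from cauchy[OF this] obtain N where N: "\<And>m n. m \<ge> N \<Longrightarrow> n \<ge> N \<Longrightarrow>
        H2s_inner l \<sigma> (\<lambda>p. v m p - v n p) (\<lambda>p. v m p - v n p) < (1 - \<sigma>) * e" by blast
      have "sqn l (\<lambda>p. wd l ds (v m) p - wd l ds (v n) p) < e" if "m \<ge> N" "n \<ge> N" for m n
      proof -
        have "(1 - \<sigma>) * sqn l (wd l ds (\<lambda>p. v m p - v n p)) < (1 - \<sigma>) * e"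
          using sq_le[OF H2s_diff[OF v v] ds] N[OF that] by (rule le_less_trans)
        then show ?thesis
          using \<sigma> sqn_wd_diff[OF v v len wd_L2[OF v len] wd_weak_deriv[OF v len], of m n] by simp
      qed
      then show ?thesis by blast
    qed
    show ?thesis by (rule L2_complete[of l "\<lambda>n. wd l ds (v n)", OF wd_L2[OF v len] c]) blast+
  qed
  then have "\<forall>ds\<in>{[False, False], [True, True], [False, True]}.
    \<exists>G. L2 l G \<and> (\<lambda>n. sqn l (\<lambda>p. wd l ds (v n) p - G p)) \<longlonglongrightarrow> 0" by (intro ballI)
  from bchoice[OF this] obtain G where G: "\<And>ds. ds \<in> {[False, False], [True, True], [False, True]} \<Longrightarrow>
    L2 l (G ds) \<and> (\<lambda>n. sqn l (\<lambda>p. wd l ds (v n) p - G ds p)) \<longlonglongrightarrow> 0" by (elim exE) (rule that, erule bspec)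
  have "uniformly_Cauchy_on UNIV v"
    unfolding uniformly_Cauchy_on_def
  proof (intro allI impI)
    fix e :: real assume e: "e > 0"
    \<comment> \<open>C + 1 in place of C covers C = 0 and makes the last estimate strict.\<close>
    have "(e / (C + 1))\<^sup>2 > 0" using e C(1) by simp
    from cauchy[OF this] obtain N where N: "\<And>m n. m \<ge> N \<Longrightarrow> n \<ge> N \<Longrightarrow>
        H2s_inner l \<sigma> (\<lambda>p. v m p - v n p) (\<lambda>p. v m p - v n p) < (e / (C + 1))\<^sup>2" by blast
    have "dist (v m p) (v n p) < e" if "m \<ge> N" "n \<ge> N" for p m n
    proof -
      have "dist (v m p) (v n p) \<le> C * sqrt (H2s_inner l \<sigma> (\<lambda>p. v m p - v n p) (\<lambda>p. v m p - v n p))"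
        unfolding dist_real_def by (rule C(2)[OF H2s_diff[OF v v]])
      also have "\<dots> \<le> C * (e / (C + 1))"
        using N[OF that] e C(1) by (intro mult_left_mono real_le_lsqrt) (auto intro: less_imp_le)
      also have "\<dots> < e" using e C(1) by (simp add: field_simps)
      finally show ?thesis .
    qed
    then show "\<exists>M. \<forall>x\<in>UNIV. \<forall>m\<ge>M. \<forall>n\<ge>M. dist (v m x) (v n x) < e" by blast
  qed
  then obtain V where V: "uniform_limit UNIV v V sequentially"
    using Cauchy_uniformly_convergent uniformly_convergent_on_def by blast
  have Vp: "(\<lambda>n. v n p) \<longlonglongrightarrow> V p" for p by (rule tendsto_uniform_limitI[OF V]) simp
  have cont: "continuous_on (Omc l) V"
    by (rule uniform_limit_theorem[OF always_eventually uniform_limit_on_subset[OF V]]) (use v in \<open>auto simp: H2s_def\<close>)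
  have zero: "V p = 0" if "\<And>n. v n p = 0" for p
    using Vp[of p] unfolding that by (simp add: LIMSEQ_const_iff)
  have out: "V p = 0" if "p \<notin> Omc l" for p
    by (rule zero) (use that v in \<open>unfold H2s_def, blast\<close>)
  have edge: "V (0, y) = 0 \<and> V (pi, y) = 0" if "y \<in> {-l<..<l}" for y
    using zero[of "(0, y)"] zero[of "(pi, y)"] v that by (auto simp: H2s_def)
  have L2v: "L2 l (v n)" for n using v by (simp add: H2s_def H2_def)
  have L2V: "L2 l V" by (rule L2_continuous[OF cont])
  have conv: "(\<lambda>n. sqn l (\<lambda>p. v n p - V p)) \<longlonglongrightarrow> 0"
  proof (rule LIMSEQ_I)
    fix e :: real assume e: "e > 0"
    define \<mu> where "\<mu> = measure lborel (Om l)"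
    have \<mu>: "\<mu> \<ge> 0" by (simp add: \<mu>_def)
    \<comment> \<open>Chosen so that a uniform distance below \<open>\<delta>\<close> gives a
      squared L2 distance below e on a set of measure \<open>\<mu>\<close>.\<close>
    define \<delta> where "\<delta> = sqrt (e / (\<mu> + 1))"
    have \<delta>: "\<delta> > 0" using e \<mu> by (simp add: \<delta>_def)
    have \<delta>2: "\<delta>\<^sup>2 * \<mu> < e" using e \<mu> by (simp add: \<delta>_def field_simps)
    obtain N where N: "\<And>n p. n \<ge> N \<Longrightarrow> dist (v n p) (V p) < \<delta>"
      using uniform_limitD[OF V \<delta>] by (auto simp: eventually_sequentially)
    have "sqn l (\<lambda>p. v n p - V p) < e" if n: "n \<ge> N" for n
    proof -
      have "sqn l (\<lambda>p. v n p - V p) \<le> (LBINT p. \<delta>\<^sup>2 * indicator (Om l) p)"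
        unfolding sqn_def
      proof (rule integral_mono)
        show "integrable lborel (\<lambda>p. (zext l (\<lambda>p. v n p - V p) p)\<^sup>2)"
          using L2_diff[OF L2v L2V] by (simp add: L2_iff)
        show "integrable lborel (\<lambda>p. \<delta>\<^sup>2 * indicator (Om l) p :: real)" using Om_finite by simp
        fix p
        show "(zext l (\<lambda>p. v n p - V p) p)\<^sup>2 \<le> \<delta>\<^sup>2 * indicator (Om l) p"
        proof (cases "p \<in> Om l")
          case True
          have "\<bar>v n p - V p\<bar>\<^sup>2 \<le> \<delta>\<^sup>2" using N[OF n, of p] by (intro power_mono) (auto simp: dist_real_def)
          then show ?thesis using True by (simp add: zext_inside)
        qed (simp add: zext_outside)
      qed
      then show ?thesis using \<delta>2 by (simp add: \<mu>_def)
    qed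
    then show "\<exists>no. \<forall>n\<ge>no. norm (sqn l (\<lambda>p. v n p - V p) - 0) < e"
      using sqn_nonneg by (intro exI[of _ N]) simp
  qed
  have len: "length [a, b] \<le> 2" for a b :: bool by simp
  have wG: "weak_deriv l ds V (G ds)" if "ds \<in> {[False, False], [True, True], [False, True]}" for ds
  proof -
    have "length ds \<le> 2" using that by auto
    then show ?thesis
      using G[OF that] wd_L2[OF v, of ds] wd_weak_deriv[OF v, of ds]
      by (intro weak_deriv_limit[OF L2v L2V conv, of "\<lambda>n. wd l ds (v n)"]) auto
  qed
  have wG': "weak_deriv l [True, False] V (G [False, True])"
  proof (rule weak_deriv_limit[OF L2v L2V conv wd_L2[OF v len]])
    show "weak_deriv l [True, False] (v n) (wd l [False, True] (v n))" for n
      by (rule weak_deriv_cong_AE[OF wd_L2[OF v len] wd_L2[OF v len]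
            weak_deriv_commute[OF wd_L2[OF v len] wd_L2[OF v len] wd_weak_deriv[OF v len] wd_weak_deriv[OF v len]]
            wd_weak_deriv[OF v len]])
  qed (use G[of "[False, True]"] in auto)
  have L2G: "L2 l (G [False, False])" "L2 l (G [True, True])" "L2 l (G [False, True])" using G by auto
  \<comment> \<open>V is not yet known to lie in the space, but its continuity, its zero values and
    the two limit derivatives are all that the locale asks for.\<close>
  interpret V: hinged l V "G [False, True]" "G [False, False]"
    by unfold_locales (use l cont out edge L2G wG in auto)
  have "\<exists>g. L2 l g \<and> weak_deriv l ds V g" if len2: "length ds \<le> 2" for ds
  proof -
    consider "ds = []" | b where "ds = [b]" | b c where "ds = [b, c]"
      using len2 by (cases ds rule: remdups_adj.cases) (auto simp: numeral_2_eq_2)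
    then show ?thesis
    proof cases
      case 1
      have "weak_deriv l [] V V" by (simp add: weak_deriv_iff iter_pd_def)
      then show ?thesis using L2V 1 by blast
    next
      case 2
      have "\<exists>g. L2 l g \<and> weak_deriv l [True] V g" "\<exists>g. L2 l g \<and> weak_deriv l [False] V g"
        by (rule exI, rule conjI[OF V.L2_w V.weak_deriv_y], rule exI, rule conjI[OF V.L2_\<omega> V.weak_deriv_x])
      then show ?thesis unfolding 2 by (cases b) (simp_all only:)
    next
      case 3
      have "\<exists>g. L2 l g \<and> weak_deriv l [False, False] V g" "\<exists>g. L2 l g \<and> weak_deriv l [True, True] V g"
        "\<exists>g. L2 l g \<and> weak_deriv l [False, True] V g" "\<exists>g. L2 l g \<and> weak_deriv l [True, False] V g"
        by (rule exI, rule conjI[OF L2G(1) wG], simp, rule exI, rule conjI[OF L2G(2) wG], simp,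
            rule exI, rule conjI[OF L2G(3) wG], simp, rule exI, rule conjI[OF L2G(3) wG'])
      then show ?thesis unfolding 3 by (cases b; cases c) (simp_all only:)
    qed
  qed
  then have HV: "H2s l V" unfolding H2s_def H2_def using L2V cont out edge by blast
  have "(\<lambda>n. H2s_inner l \<sigma> (\<lambda>p. v n p - V p) (\<lambda>p. v n p - V p)) \<longlonglongrightarrow> 0"
  proof (rule tendsto_sandwich[OF always_eventually always_eventually tendsto_const])
    have d: "H2s l (\<lambda>p. v n p - V p)" for n by (rule H2s_diff[OF v HV])
    have e: "sqn l (wd l ds (\<lambda>p. v n p - V p)) = sqn l (\<lambda>p. wd l ds (v n) p - G ds p)"
      if "ds \<in> {[False, False], [True, True], [False, True]}" for n ds
    proof -
      have "length ds \<le> 2" using that by auto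
      then show ?thesis by (rule sqn_wd_diff[OF v HV _ conjunct1[OF G[OF that]] wG[OF that]])
    qed
    show "\<forall>n. 0 \<le> H2s_inner l \<sigma> (\<lambda>p. v n p - V p) (\<lambda>p. v n p - V p)"
    proof
      fix n
      have "0 \<le> (1 - \<sigma>) * sqn l (wd l [False, False] (\<lambda>p. v n p - V p))" using \<sigma> sqn_nonneg by simp
      also have "\<dots> \<le> H2s_inner l \<sigma> (\<lambda>p. v n p - V p) (\<lambda>p. v n p - V p)" by (rule sq_le[OF d]) simp
      finally show "0 \<le> H2s_inner l \<sigma> (\<lambda>p. v n p - V p) (\<lambda>p. v n p - V p)" .
    qed
    show "\<forall>n. H2s_inner l \<sigma> (\<lambda>p. v n p - V p) (\<lambda>p. v n p - V p) \<le> 2 * (sqn l (\<lambda>p. wd l [False, False] (v n) p - G [False, False] p)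
      + sqn l (\<lambda>p. wd l [True, True] (v n) p - G [True, True] p) + sqn l (\<lambda>p. wd l [False, True] (v n) p - G [False, True] p))"
      using H2s_inner_bounds(2)[OF d \<sigma>] e by simp
    have "(\<lambda>n. 2 * (sqn l (\<lambda>p. wd l [False, False] (v n) p - G [False, False] p)
      + sqn l (\<lambda>p. wd l [True, True] (v n) p - G [True, True] p) + sqn l (\<lambda>p. wd l [False, True] (v n) p - G [False, True] p)))
      \<longlonglongrightarrow> 2 * (0 + 0 + 0)"
      by (intro tendsto_mult tendsto_add tendsto_const conjunct2[OF G]) simp_all
    then show "(\<lambda>n. 2 * (sqn l (\<lambda>p. wd l [False, False] (v n) p - G [False, False] p)
      + sqn l (\<lambda>p. wd l [True, True] (v n) p - G [True, True] p) + sqn l (\<lambda>p. wd l [False, True] (v n) p - G [False, True] p)))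
      \<longlonglongrightarrow> 0" by simp
  qed
  with HV show ?thesis by (rule that)
qed

section \<open>Variational inequalities\<close>

text \<open>Separates the variational argument from the Sobolev facts. Elements are genuine
  functions: \<open>sup_bound\<close> makes the form definite pointwise and turns energy convergence
  into uniform convergence.\<close>

locale energy_space =
  fixes V :: "('a \<Rightarrow> real) \<Rightarrow> bool" and B :: "('a \<Rightarrow> real) \<Rightarrow> ('a \<Rightarrow> real) \<Rightarrow> real" and C :: real
  assumes V_zero: "V (\<lambda>p. 0)"
    and V_lincomb: "V u \<Longrightarrow> V v \<Longrightarrow> V (\<lambda>p. a * u p + b * v p)"
    and B_commute: "B u v = B v u"
    and B_lincomb: "V u \<Longrightarrow> V v \<Longrightarrow> V z \<Longrightarrow> B (\<lambda>p. a * u p + b * v p) z = a * B u z + b * B v z"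
    and B_nonneg: "V v \<Longrightarrow> B v v \<ge> 0"
    and C_nonneg: "C \<ge> 0" and sup_bound: "V v \<Longrightarrow> \<bar>v p\<bar> \<le> C * sqrt (B v v)"
    and complete: "(\<And>n. V (s n)) \<Longrightarrow>
      (\<And>e. e > 0 \<Longrightarrow> \<exists>N. \<forall>m\<ge>N. \<forall>n\<ge>N. B (\<lambda>p. s m p - s n p) (\<lambda>p. s m p - s n p) < e) \<Longrightarrow>
      \<exists>u. V u \<and> (\<lambda>n. B (\<lambda>p. s n p - u p) (\<lambda>p. s n p - u p)) \<longlonglongrightarrow> 0"
begin

lemma V_diff: "V u \<Longrightarrow> V v \<Longrightarrow> V (\<lambda>p. u p - v p)"
  using V_lincomb[of u v 1 "-1"] by simp

lemma V_scale: "V u \<Longrightarrow> V (\<lambda>p. a * u p)"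
  using V_lincomb[of u u a 0] by simp

lemma B_lincomb_right: "V u \<Longrightarrow> V v \<Longrightarrow> V z \<Longrightarrow> B z (\<lambda>p. a * u p + b * v p) = a * B z u + b * B z v"
  using B_lincomb[of u v z a b] by (simp add: B_commute)

lemma B_diff_right: "V u \<Longrightarrow> V v \<Longrightarrow> V z \<Longrightarrow> B z (\<lambda>p. u p - v p) = B z u - B z v"
  using B_lincomb_right[of u v z 1 "-1"] by simp

lemma B_lincomb_self:
  assumes "V u" "V v"
  shows "B (\<lambda>p. a * u p + b * v p) (\<lambda>p. a * u p + b * v p) = a\<^sup>2 * B u u + 2 * a * b * B u v + b\<^sup>2 * B v v"
  using assms by (simp add: B_lincomb B_lincomb_right V_lincomb B_commute[of v u] algebra_simps power2_eq_square)

lemma B_diff_self: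
  assumes "V u" "V v"
  shows "B (\<lambda>p. u p - v p) (\<lambda>p. u p - v p) = B u u - 2 * B u v + B v v"
  using B_lincomb_self[OF assms, of 1 "-1"] by simp

lemma B_Cauchy_Schwarz:
  assumes "V u" "V v" shows "\<bar>B u v\<bar> \<le> sqrt (B v v) * sqrt (B u u)"
proof -
  have "0 \<le> B u u - 2 * t * B u v + t\<^sup>2 * B v v" for t
    using B_nonneg[OF V_lincomb[OF assms, of 1 "-t"]] unfolding B_lincomb_self[OF assms] by simp
  then have "(B u v)\<^sup>2 \<le> B v v * B u u"
    by (rule quadratic_nonneg_imp_discriminant) (rule B_nonneg[OF assms(2)])
  then have "sqrt ((B u v)\<^sup>2) \<le> sqrt (B v v * B u u)" by (rule real_sqrt_le_mono)
  then show ?thesis by (simp add: real_sqrt_mult)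
qed

text \<open>The constant is the C of \<open>sup_bound\<close>, since a functional of norm at most 1
  on continuous functions is bounded by the supremum norm and hence by C times the energy
  norm.\<close>

definition load :: "(('a \<Rightarrow> real) \<Rightarrow> real) \<Rightarrow> bool" where
  "load f \<longleftrightarrow> (\<forall>u v a b. V u \<longrightarrow> V v \<longrightarrow> f (\<lambda>p. a * u p + b * v p) = a * f u + b * f v)
     \<and> (\<forall>u. V u \<longrightarrow> \<bar>f u\<bar> \<le> C * sqrt (B u u))"

lemma load_lincomb: "load f \<Longrightarrow> V u \<Longrightarrow> V v \<Longrightarrow> f (\<lambda>p. a * u p + b * v p) = a * f u + b * f v"
  and load_bound: "load f \<Longrightarrow> V u \<Longrightarrow> \<bar>f u\<bar> \<le> C * sqrt (B u u)"
  by (auto simp: load_def)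

lemma load_diff: "load f \<Longrightarrow> V u \<Longrightarrow> V v \<Longrightarrow> f (\<lambda>p. u p - v p) = f u - f v"
  using load_lincomb[of f u v 1 "-1"] by simp

text \<open>Convexity serves the midpoint and segment arguments, 0 is the test function for the a
  priori bounds, and pointwise closedness suits constraints imposed at points.\<close>

definition constraint_set :: "('a \<Rightarrow> real) set \<Rightarrow> bool" where
  "constraint_set K \<longleftrightarrow> (\<forall>u\<in>K. V u) \<and> (\<lambda>p. 0) \<in> K
     \<and> (\<forall>u\<in>K. \<forall>v\<in>K. \<forall>t. 0 \<le> t \<longrightarrow> t \<le> 1 \<longrightarrow> (\<lambda>p. (1 - t) * u p + t * v p) \<in> K)
     \<and> (\<forall>s u. (\<forall>n. s n \<in> K) \<longrightarrow> V u \<longrightarrow> (\<forall>p. (\<lambda>n. s n p) \<longlonglongrightarrow> u p) \<longrightarrow> u \<in> K)"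

lemma constraint_setD:
  assumes "constraint_set K"
  shows "u \<in> K \<Longrightarrow> V u" "(\<lambda>p. 0) \<in> K"
    "u \<in> K \<Longrightarrow> v \<in> K \<Longrightarrow> 0 \<le> t \<Longrightarrow> t \<le> 1 \<Longrightarrow> (\<lambda>p. (1 - t) * u p + t * v p) \<in> K"
    "(\<And>n. s n \<in> K) \<Longrightarrow> V u \<Longrightarrow> (\<And>p. (\<lambda>n. s n p) \<longlonglongrightarrow> u p) \<Longrightarrow> u \<in> K"
proof -
  show "u \<in> K \<Longrightarrow> V u" "(\<lambda>p. 0) \<in> K"
    "u \<in> K \<Longrightarrow> v \<in> K \<Longrightarrow> 0 \<le> t \<Longrightarrow> t \<le> 1 \<Longrightarrow> (\<lambda>p. (1 - t) * u p + t * v p) \<in> K"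
    using assms by (auto simp: constraint_set_def)
  show "(\<And>n. s n \<in> K) \<Longrightarrow> V u \<Longrightarrow> (\<And>p. (\<lambda>n. s n p) \<longlonglongrightarrow> u p) \<Longrightarrow> u \<in> K"
    using assms unfolding constraint_set_def by blast
qed

definition solves :: "('a \<Rightarrow> real) set \<Rightarrow> (('a \<Rightarrow> real) \<Rightarrow> real) \<Rightarrow> ('a \<Rightarrow> real) \<Rightarrow> bool" where
  "solves K f u \<longleftrightarrow> u \<in> K \<and> (\<forall>\<phi>\<in>K. B u (\<lambda>p. \<phi> p - u p) \<ge> f (\<lambda>p. \<phi> p - u p))"

lemma solves_expand:
  assumes "constraint_set K" "load f" "solves K f u" "\<phi> \<in> K"
  shows "B u \<phi> - B u u \<ge> f \<phi> - f u"
  using assms B_diff_right[of \<phi> u u] load_diff[of f \<phi> u] constraint_setD(1)[OF assms(1)]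
  unfolding solves_def by auto

text \<open>Each solution is a test function for the other; the sum of the inequalities makes the
  energy of the difference nonpositive, and \<open>sup_bound\<close> gives equality at every
  point.\<close>

lemma solves_unique:
  assumes K: "constraint_set K" and f: "load f" and u: "solves K f u" and v: "solves K f v"
  shows "u = v"
proof
  fix p
  have uv: "u \<in> K" "v \<in> K" using u v by (auto simp: solves_def)
  have V: "V u" "V v" using uv constraint_setD(1)[OF K] by auto
  have "B (\<lambda>p. u p - v p) (\<lambda>p. u p - v p) \<le> 0"
    using solves_expand[OF K f u uv(2)] solves_expand[OF K f v uv(1)] B_diff_self[OF V] B_commute[of u v] by simp
  then have "sqrt (B (\<lambda>p. u p - v p) (\<lambda>p. u p - v p)) \<le> 0" by simp
  then have "C * sqrt (B (\<lambda>p. u p - v p) (\<lambda>p. u p - v p)) \<le> 0" using C_nonneg by (rule mult_nonneg_nonpos[rotated])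
  then show "u p = v p" using sup_bound[OF V_diff[OF V], of p] by simp
qed

text \<open>Completing the square in sqrt (B u u) after the load bound.\<close>

lemma energy_bounded_below:
  assumes "load f" "V u" shows "B u u - 2 * f u \<ge> - C\<^sup>2"
proof -
  have "0 \<le> (sqrt (B u u) - C)\<^sup>2" by simp
  also have "\<dots> = B u u - 2 * (C * sqrt (B u u)) + C\<^sup>2"
    using B_nonneg[OF assms(2)] by (simp add: power2_diff)
  finally show ?thesis using load_bound[OF assms] by linarith
qed

text \<open>The parallelogram identity makes a minimising sequence of the energy Cauchy.\<close>
lemma energy_minimiser:
  assumes K: "constraint_set K" and f: "load f"
  obtains u where "u \<in> K" "\<And>v. v \<in> K \<Longrightarrow> B u u - 2 * f u \<le> B v v - 2 * f v"
proof -
  define E where "E u = B u u - 2 * f u" for u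
  define m where "m = Inf (E ` K)"
  have bdd: "bdd_below (E ` K)"
    unfolding E_def by (rule bdd_belowI[of _ "- C\<^sup>2"]) (use energy_bounded_below[OF f] constraint_setD(1)[OF K] in auto)
  have m: "m \<le> E v" if "v \<in> K" for v unfolding m_def using bdd that by (intro cInf_lower) auto
  have "\<exists>u. u \<in> K \<and> E u < m + inverse (real (Suc n))" for n
  proof -
    have "E ` K \<noteq> {}" using constraint_setD(2)[OF K] by blast
    then show ?thesis using cInf_lessD[of "E ` K" "m + inverse (real (Suc n))"] by (auto simp: m_def)
  qed
  then obtain s where s: "\<And>n. s n \<in> K" "\<And>n. E (s n) < m + inverse (real (Suc n))" by metis
  have Vs: "V (s n)" for n using s(1) constraint_setD(1)[OF K] by blast
  have par: "B (\<lambda>p. s i p - s j p) (\<lambda>p. s i p - s j p) \<le> 2 * (inverse (real (Suc i)) + inverse (real (Suc j)))" for i j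
  proof -
    have "(\<lambda>p. (1 - 1/2) * s i p + (1/2) * s j p) \<in> K" by (rule constraint_setD(3)[OF K s(1) s(1)]) auto
    from m[OF this] have "m \<le> (1/4) * B (s i) (s i) + (1/2) * B (s i) (s j) + (1/4) * B (s j) (s j) - f (s i) - f (s j)"
      unfolding E_def B_lincomb_self[OF Vs Vs] load_lincomb[OF f Vs Vs] by (simp add: power2_eq_square)
    then show ?thesis
      using s(2)[of i] s(2)[of j] unfolding E_def distrib_left B_diff_self[OF Vs Vs] by linarith
  qed
  have "\<exists>N. \<forall>i\<ge>N. \<forall>j\<ge>N. B (\<lambda>p. s i p - s j p) (\<lambda>p. s i p - s j p) < e" if "e > 0" for e
  proof -
    from that have "e / 4 > 0" by simp
    from reals_Archimedean[OF this] obtain N where N: "inverse (real (Suc N)) < e / 4" by blast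
    have "B (\<lambda>p. s i p - s j p) (\<lambda>p. s i p - s j p) < e" if "i \<ge> N" "j \<ge> N" for i j
    proof -
      have "inverse (real (Suc i)) \<le> inverse (real (Suc N))" "inverse (real (Suc j)) \<le> inverse (real (Suc N))"
        using that by (auto intro!: le_imp_inverse_le)
      then show ?thesis using par[of i j] N unfolding distrib_left by linarith
    qed
    then show ?thesis by blast
  qed
  from complete[OF Vs this] obtain u where u: "V u" "(\<lambda>n. B (\<lambda>p. s n p - u p) (\<lambda>p. s n p - u p)) \<longlonglongrightarrow> 0" by blast
  define d where "d n = sqrt (B (\<lambda>p. s n p - u p) (\<lambda>p. s n p - u p))" for n
  have d0: "d \<longlonglongrightarrow> 0" using tendsto_real_sqrt[OF u(2)] by (simp add: d_def[abs_def])
  have Vd: "V (\<lambda>p. s n p - u p)" for n by (rule V_diff[OF Vs u(1)])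
  have "(\<lambda>n. s n p) \<longlonglongrightarrow> u p" for p
  proof (rule LIM_zero_cancel, rule Lim_null_comparison[OF always_eventually])
    show "\<forall>n. norm (s n p - u p) \<le> C * d n" using sup_bound[OF Vd] by (simp add: d_def)
    show "(\<lambda>n. C * d n) \<longlonglongrightarrow> 0" using tendsto_mult[OF tendsto_const d0] by simp
  qed
  then have uK: "u \<in> K" by (rule constraint_setD(4)[OF K s(1) u(1)])
  have "E u \<le> m"
  proof (rule LIMSEQ_le_const)
    \<comment> \<open>Expanding B (s n - u) (s n - u) \<ge> 0 compares B u u with B (s n) (s n) up
      to a cross term, which Cauchy-Schwarz bounds by d n.\<close>
    have "E u \<le> m + inverse (real (Suc n)) + 2 * (C * d n) + 2 * (d n * sqrt (B u u))" for n
    proof -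
      have "B (s n) (s n) - B u u \<ge> 2 * B u (s n) - 2 * B u u"
        using B_nonneg[OF Vd, of n] unfolding B_diff_self[OF Vs u(1)] B_commute[of "s n" u] by linarith
      moreover have "\<bar>B u (s n) - B u u\<bar> \<le> d n * sqrt (B u u)"
        using B_Cauchy_Schwarz[OF u(1) Vd, of n] by (simp add: B_diff_right[OF Vs u(1) u(1)] d_def)
      moreover have "\<bar>f (s n) - f u\<bar> \<le> C * d n"
        using load_bound[OF f Vd, of n] by (simp add: load_diff[OF f Vs u(1)] d_def)
      ultimately show ?thesis using s(2)[of n] unfolding E_def by linarith
    qed
    then show "\<exists>N. \<forall>n\<ge>N. E u \<le> m + inverse (real (Suc n)) + 2 * (C * d n) + 2 * (d n * sqrt (B u u))" by blast
    have "(\<lambda>n. m + inverse (real (Suc n)) + 2 * (C * d n) + 2 * (d n * sqrt (B u u)))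
      \<longlonglongrightarrow> m + 0 + 2 * (C * 0) + 2 * (0 * sqrt (B u u))"
      by (intro tendsto_intros LIMSEQ_inverse_real_of_nat d0)
    then show "(\<lambda>n. m + inverse (real (Suc n)) + 2 * (C * d n) + 2 * (d n * sqrt (B u u))) \<longlonglongrightarrow> m" by simp
  qed
  with m have "B u u - 2 * f u \<le> B v v - 2 * f v" if "v \<in> K" for v
    using that unfolding E_def by (meson order_trans)
  with uK show ?thesis by (rule that)
qed

text \<open>First variation at the minimiser: moving by t towards an admissible
  \<open>\<phi>\<close> cannot lower the energy; dividing by t and letting t tend to 0 leaves the
  inequality.\<close>

lemma solves_exists:
  assumes K: "constraint_set K" and f: "load f"
  shows "\<exists>u. solves K f u"
proof -
  obtain u where u: "u \<in> K" "\<And>v. v \<in> K \<Longrightarrow> B u u - 2 * f u \<le> B v v - 2 * f v"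
    by (rule energy_minimiser[OF K f]) blast
  have Vu: "V u" using u(1) constraint_setD(1)[OF K] by blast
  have "B u (\<lambda>p. \<phi> p - u p) \<ge> f (\<lambda>p. \<phi> p - u p)" if \<phi>: "\<phi> \<in> K" for \<phi>
  proof -
    define d where "d p = \<phi> p - u p" for p
    have Vd: "V d" unfolding d_def using V_diff[OF constraint_setD(1)[OF K \<phi>] Vu] .
    have step: "0 \<le> 2 * (B u d - f d) + t * B d d" if t: "0 < t" "t \<le> 1" for t
    proof -
      have "(\<lambda>p. (1 - t) * u p + t * \<phi> p) \<in> K" using constraint_setD(3)[OF K u(1) \<phi>] t by simp
      also have "(\<lambda>p. (1 - t) * u p + t * \<phi> p) = (\<lambda>p. 1 * u p + t * d p)" by (simp add: d_def fun_eq_iff algebra_simps)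
      finally have "B u u - 2 * f u \<le> B u u + 2 * t * B u d + t\<^sup>2 * B d d - 2 * (f u + t * f d)"
        using u(2)[of "\<lambda>p. 1 * u p + t * d p"] unfolding B_lincomb_self[OF Vu Vd] load_lincomb[OF f Vu Vd] by simp
      then have "0 \<le> t * (2 * (B u d - f d) + t * B d d)" by (simp add: algebra_simps power2_eq_square)
      then show ?thesis using t by (simp add: zero_le_mult_iff)
    qed
    have "0 \<le> 2 * (B u d - f d)"
    proof (rule LIMSEQ_le_const)
      have "(\<lambda>n. 2 * (B u d - f d) + inverse (real (Suc n)) * B d d) \<longlonglongrightarrow> 2 * (B u d - f d) + 0 * B d d"
        by (intro tendsto_intros LIMSEQ_inverse_real_of_nat)
      then show "(\<lambda>n. 2 * (B u d - f d) + inverse (real (Suc n)) * B d d) \<longlonglongrightarrow> 2 * (B u d - f d)" by simp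
      show "\<exists>N. \<forall>n\<ge>N. 0 \<le> 2 * (B u d - f d) + inverse (real (Suc n)) * B d d"
        by (intro exI[of _ 0] allI impI step) (auto simp: inverse_le_1_iff)
    qed
    then show ?thesis by (simp add: d_def[abs_def])
  qed
  then show ?thesis using u(1) unfolding solves_def by blast
qed

text \<open>The test function 0 gives B u u \<le> f u \<le> C sqrt (B u u). All bounds are powers of
  C, so they depend neither on the load nor on the constraint set.\<close>

lemma solves_energy_bound:
  assumes K: "constraint_set K" and f: "load f" and u: "solves K f u"
  shows "sqrt (B u u) \<le> C" "B u u \<le> C\<^sup>2" "\<bar>f u\<bar> \<le> C\<^sup>2" "\<bar>u p\<bar> \<le> C\<^sup>2"
proof -
  have Vu: "V u" using u constraint_setD(1)[OF K] by (auto simp: solves_def)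
  have "f (\<lambda>p. 0) = 0" "B u (\<lambda>p. 0) = 0"
    using load_diff[OF f Vu Vu] B_diff_right[OF Vu Vu Vu] by simp_all
  then have "B u u \<le> f u" using solves_expand[OF K f u constraint_setD(2)[OF K]] by simp
  also have "\<dots> \<le> C * sqrt (B u u)" using load_bound[OF f Vu] by linarith
  finally have le: "sqrt (B u u) * sqrt (B u u) \<le> C * sqrt (B u u)" using B_nonneg[OF Vu] by simp
  show s: "sqrt (B u u) \<le> C"
  proof (cases "sqrt (B u u) = 0")
    case False
    then have "0 < sqrt (B u u)" using B_nonneg[OF Vu] by simp
    with le show ?thesis by (simp only: mult_le_cancel_right_pos)
  qed (use C_nonneg in simp)
  then show "B u u \<le> C\<^sup>2" by (rule sqrt_le_D)
  have "C * sqrt (B u u) \<le> C\<^sup>2" unfolding power2_eq_square by (rule mult_left_mono[OF s C_nonneg])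
  then show "\<bar>f u\<bar> \<le> C\<^sup>2" "\<bar>u p\<bar> \<le> C\<^sup>2" using load_bound[OF f Vu] sup_bound[OF Vu, of p] by linarith+
qed

text \<open>Scaling by \<open>1 - \<epsilon>\<close> moves each solution into the other constraint set, so it may be used as a
  test function there.\<close>
lemma solves_stability:
  assumes K: "constraint_set K" "constraint_set L" and f: "load f"
    and u: "solves K f u" and v: "solves L f v" and \<epsilon>: "0 \<le> \<epsilon>"
    and uL: "(\<lambda>p. (1 - \<epsilon>) * u p) \<in> L" and vK: "(\<lambda>p. (1 - \<epsilon>) * v p) \<in> K"
  shows "\<bar>u p - v p\<bar> \<le> 2 * C\<^sup>2 * sqrt \<epsilon>"
proof -
  have V: "V u" "V v" using u v constraint_setD(1) K by (auto simp: solves_def)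
  have scale: "B z (\<lambda>p. (1 - \<epsilon>) * w p) = (1 - \<epsilon>) * B z w" "f (\<lambda>p. (1 - \<epsilon>) * w p) = (1 - \<epsilon>) * f w" if "V w" "V z" for w z
    using B_lincomb_right[OF that(1,1,2), of "1 - \<epsilon>" 0] load_lincomb[OF f that(1,1), of "1 - \<epsilon>" 0] by simp_all
  have 1: "(1 - \<epsilon>) * f v - f u \<le> (1 - \<epsilon>) * B u v - B u u"
    using solves_expand[OF K(1) f u vK] scale[OF V(2,1)] by simp
  have 2: "(1 - \<epsilon>) * f u - f v \<le> (1 - \<epsilon>) * B u v - B v v"
    using solves_expand[OF K(2) f v uL] scale[OF V(1,2)] B_commute[of v u] by simp
  have fb: "f u \<le> C\<^sup>2" "f v \<le> C\<^sup>2" using solves_energy_bound(3)[OF K(1) f u] solves_energy_bound(3)[OF K(2) f v] by linarith+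
  \<comment> \<open>From the nonnegative energy of u + v and the two energy bounds.\<close>
  have bb: "- (2 * B u v) \<le> 2 * C\<^sup>2"
    using B_nonneg[OF V_lincomb[OF V, of 1 1]] solves_energy_bound(2)[OF K(1) f u] solves_energy_bound(2)[OF K(2) f v]
    unfolding B_lincomb_self[OF V] by simp
  \<comment> \<open>The sum of the two tested inequalities: without \<epsilon> the load terms
    cancel, so only terms with the factor \<epsilon> remain on the right.\<close>
  have "B (\<lambda>p. u p - v p) (\<lambda>p. u p - v p) \<le> \<epsilon> * (f u + f v - 2 * B u v)"
    using 1 2 unfolding B_diff_self[OF V] by (simp add: algebra_simps)
  also have "\<dots> \<le> \<epsilon> * (4 * C\<^sup>2)" using fb bb \<epsilon> by (intro mult_left_mono) auto
  finally have "sqrt (B (\<lambda>p. u p - v p) (\<lambda>p. u p - v p)) \<le> sqrt (\<epsilon> * (2 * C)\<^sup>2)"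
    by (intro real_sqrt_le_mono) (simp add: power_mult_distrib)
  also have "\<dots> = sqrt \<epsilon> * (2 * C)" using C_nonneg by (simp add: real_sqrt_mult)
  finally have "C * sqrt (B (\<lambda>p. u p - v p) (\<lambda>p. u p - v p)) \<le> C * (sqrt \<epsilon> * (2 * C))"
    by (rule mult_left_mono[OF _ C_nonneg])
  then show ?thesis using sup_bound[OF V_diff[OF V], of p] by (simp add: power2_eq_square algebra_simps)
qed

end

section \<open>Compactness of the obstacles and the optimal pair\<close>

text \<open>A sum of two suprema is at most \<open>\<kappa>\<close> iff every sum of members is. The
  clause for the values alone corresponds to the 0 inserted among the quotients and covers a
  one-point S, which has no quotients.\<close>

lemma hoelder_norm_le_iff:
  assumes "S \<noteq> {}" "continuous_on S \<psi>"
  shows "in_C0alpha \<alpha> S \<psi> \<and> hoelder_norm \<alpha> S \<psi> \<le> \<kappa> \<longleftrightarrow>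
    (\<forall>z\<in>S. \<bar>\<psi> z\<bar> \<le> \<kappa>) \<and> (\<forall>z\<in>S. \<forall>x\<in>S. \<forall>y\<in>S. x \<noteq> y \<longrightarrow> \<bar>\<psi> z\<bar> + \<bar>\<psi> x - \<psi> y\<bar> / dist x y powr \<alpha> \<le> \<kappa>)"
    (is "?L \<longleftrightarrow> ?R")
proof
  assume L: ?L
  then have b: "bdd_above ((\<lambda>x. \<bar>\<psi> x\<bar>) ` S)" "bdd_above (insert 0 (hoelder_quots \<alpha> S \<psi>))"
    unfolding in_C0alpha_def bdd_above_insert by (auto simp: bounded_real bdd_above_def)
  have *: "\<bar>\<psi> z\<bar> + q \<le> \<kappa>" if "z \<in> S" "q \<in> insert 0 (hoelder_quots \<alpha> S \<psi>)" for z q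
    using cSUP_upper[OF that(1) b(1)] cSup_upper[OF that(2) b(2)] L unfolding hoelder_norm_def by linarith
  show ?R
  proof (intro conjI ballI impI)
    show "\<bar>\<psi> z\<bar> \<le> \<kappa>" if "z \<in> S" for z using *[OF that, of 0] by simp
    show "\<bar>\<psi> z\<bar> + \<bar>\<psi> x - \<psi> y\<bar> / dist x y powr \<alpha> \<le> \<kappa>" if "z \<in> S" "x \<in> S" "y \<in> S" "x \<noteq> y" for x y z
      by (rule *[OF that(1)], unfold hoelder_quots_def) (use that in blast)
  qed
next
  assume R: ?R
  have q: "\<bar>\<psi> z\<bar> + q \<le> \<kappa>" if "z \<in> S" "q \<in> insert 0 (hoelder_quots \<alpha> S \<psi>)" for z q
    using R that by (auto simp: hoelder_quots_def)
  have "bounded (\<psi> ` S)" using R by (auto simp: bounded_real)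
  moreover have "bdd_above (hoelder_quots \<alpha> S \<psi>)"
  proof (rule bdd_aboveI)
    fix q assume "q \<in> hoelder_quots \<alpha> S \<psi>"
    moreover obtain z where "z \<in> S" using assms(1) by blast
    ultimately have "\<bar>\<psi> z\<bar> + q \<le> \<kappa>" using q by blast
    then show "q \<le> \<kappa>" by linarith
  qed
  moreover have "hoelder_norm \<alpha> S \<psi> \<le> \<kappa>"
  proof -
    have "Sup (insert 0 (hoelder_quots \<alpha> S \<psi>)) \<le> \<kappa> - (SUP x\<in>S. \<bar>\<psi> x\<bar>)"
    proof (rule cSup_least)
      fix r assume r: "r \<in> insert 0 (hoelder_quots \<alpha> S \<psi>)"
      have "(SUP x\<in>S. \<bar>\<psi> x\<bar>) \<le> \<kappa> - r"
        by (rule cSUP_least[OF assms(1)]) (use q r in fastforce)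
      then show "r \<le> \<kappa> - (SUP x\<in>S. \<bar>\<psi> x\<bar>)" by linarith
    qed simp
    then show ?thesis by (simp add: hoelder_norm_def)
  qed
  ultimately show ?L using assms(2) by (simp add: in_C0alpha_def)
qed

text \<open>The norm bound without suprema; in this form it visibly survives pointwise
  limits.\<close>

definition hoelder_le :: "real \<Rightarrow> (real \<times> real) set \<Rightarrow> real \<Rightarrow> (real \<times> real \<Rightarrow> real) \<Rightarrow> bool" where
  "hoelder_le \<alpha> S \<kappa> \<psi> \<longleftrightarrow> (\<forall>z\<in>S. \<bar>\<psi> z\<bar> \<le> \<kappa>) \<and>
    (\<forall>z\<in>S. \<forall>x\<in>S. \<forall>y\<in>S. x \<noteq> y \<longrightarrow> \<bar>\<psi> z\<bar> + \<bar>\<psi> x - \<psi> y\<bar> / dist x y powr \<alpha> \<le> \<kappa>)"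

lemma Psi_iff:
  assumes "S \<noteq> {}"
  shows "\<psi> \<in> Psi_plus \<alpha> S \<gamma> \<kappa> \<longleftrightarrow> continuous_on S \<psi> \<and> (\<forall>x\<in>S. \<gamma> \<le> \<psi> x) \<and> hoelder_le \<alpha> S \<kappa> \<psi>"
    "\<psi> \<in> Psi_minus \<alpha> S \<gamma> \<kappa> \<longleftrightarrow> continuous_on S \<psi> \<and> (\<forall>x\<in>S. \<psi> x \<le> - \<gamma>) \<and> hoelder_le \<alpha> S \<kappa> \<psi>"
proof -
  have "in_C0alpha \<alpha> S \<psi> \<and> hoelder_norm \<alpha> S \<psi> \<le> \<kappa> \<longleftrightarrow> hoelder_le \<alpha> S \<kappa> \<psi>" if "continuous_on S \<psi>"
    unfolding hoelder_le_def by (rule hoelder_norm_le_iff[OF assms that])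
  then show "\<psi> \<in> Psi_plus \<alpha> S \<gamma> \<kappa> \<longleftrightarrow> continuous_on S \<psi> \<and> (\<forall>x\<in>S. \<gamma> \<le> \<psi> x) \<and> hoelder_le \<alpha> S \<kappa> \<psi>"
    "\<psi> \<in> Psi_minus \<alpha> S \<gamma> \<kappa> \<longleftrightarrow> continuous_on S \<psi> \<and> (\<forall>x\<in>S. \<psi> x \<le> - \<gamma>) \<and> hoelder_le \<alpha> S \<kappa> \<psi>"
    unfolding Psi_plus_def Psi_minus_def by blast+
qed

lemma hoelder_le_modulus:
  assumes "hoelder_le \<alpha> S \<kappa> \<psi>" "x \<in> S" "y \<in> S"
  shows "\<bar>\<psi> x - \<psi> y\<bar> \<le> \<kappa> * dist x y powr \<alpha>"
proof (cases "x = y")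
  case False
  have "\<bar>\<psi> x\<bar> + \<bar>\<psi> x - \<psi> y\<bar> / dist x y powr \<alpha> \<le> \<kappa>"
    using assms False unfolding hoelder_le_def by blast
  then have "\<bar>\<psi> x - \<psi> y\<bar> / dist x y powr \<alpha> \<le> \<kappa>" by linarith
  then show ?thesis using False by (simp add: pos_divide_le_eq)
qed simp

lemma hoelder_le_limit:
  assumes "\<And>n. hoelder_le \<alpha> S \<kappa> (\<psi> n)" "\<And>x. x \<in> S \<Longrightarrow> (\<lambda>n. \<psi> n x) \<longlonglongrightarrow> g x"
  shows "hoelder_le \<alpha> S \<kappa> g"
  unfolding hoelder_le_def
proof (intro conjI ballI impI)
  show "\<bar>g z\<bar> \<le> \<kappa>" if "z \<in> S" for z
    by (rule LIMSEQ_le_const2[OF tendsto_rabs[OF assms(2)[OF that]]])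
       (use assms(1) that in \<open>auto simp: hoelder_le_def\<close>)
  show "\<bar>g z\<bar> + \<bar>g x - g y\<bar> / dist x y powr \<alpha> \<le> \<kappa>" if S: "z \<in> S" "x \<in> S" "y \<in> S" "x \<noteq> y" for x y z
  proof (rule LIMSEQ_le_const2)
    show "(\<lambda>n. \<bar>\<psi> n z\<bar> + \<bar>\<psi> n x - \<psi> n y\<bar> / dist x y powr \<alpha>) \<longlonglongrightarrow> \<bar>g z\<bar> + \<bar>g x - g y\<bar> / dist x y powr \<alpha>"
      using S by (intro tendsto_intros assms(2)) auto
    show "\<exists>N. \<forall>n\<ge>N. \<bar>\<psi> n z\<bar> + \<bar>\<psi> n x - \<psi> n y\<bar> / dist x y powr \<alpha> \<le> \<kappa>"
      using assms(1) S unfolding hoelder_le_def by blast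
  qed
qed

text \<open>Both sequences are joined into one map to the plane, so that Arzela-Ascoli yields a
  common subsequence. Equicontinuity comes from the shared Hoelder modulus.\<close>

lemma hoelder_le_sequential_compactness:
  fixes \<psi> \<psi>' :: "nat \<Rightarrow> real \<times> real \<Rightarrow> real"
  assumes S: "compact S" and \<alpha>: "\<alpha> > 0"
    and h: "\<And>n. hoelder_le \<alpha> S \<kappa> (\<psi> n)" "\<And>n. hoelder_le \<alpha> S \<kappa>' (\<psi>' n)"
  obtains g g' and k :: "nat \<Rightarrow> nat" where "continuous_on S g" "continuous_on S g'" "strict_mono k"
    "\<And>e. e > 0 \<Longrightarrow> \<exists>N. \<forall>n\<ge>N. \<forall>x\<in>S. \<bar>\<psi> (k n) x - g x\<bar> < e \<and> \<bar>\<psi>' (k n) x - g' x\<bar> < e"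
proof -
  define F where "F n x = (\<psi> n x, \<psi>' n x)" for n x
  have bd: "norm (F n x) \<le> \<kappa> + \<kappa>'" if "x \<in> S" for n x
  proof -
    have "norm (F n x) \<le> \<bar>\<psi> n x\<bar> + \<bar>\<psi>' n x\<bar>" using norm_Pair_le[of "\<psi> n x" "\<psi>' n x"] by (simp add: F_def)
    also have "\<dots> \<le> \<kappa> + \<kappa>'" using h that unfolding hoelder_le_def by (intro add_mono) auto
    finally show ?thesis .
  qed
  have eq: "\<exists>d. 0 < d \<and> (\<forall>n y. y \<in> S \<and> norm (x - y) < d \<longrightarrow> norm (F n x - F n y) < e)" if x: "x \<in> S" and e: "0 < e" for x e
  proof -
    define K where "K = \<bar>\<kappa>\<bar> + \<bar>\<kappa>'\<bar> + 1"
    have K: "K > 0" by (simp add: K_def add_nonneg_pos)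
    \<comment> \<open>Solves K d^\<alpha> = e; the summand 1 in K makes K positive and the final
      estimate strict.\<close>
    define d where "d = (e / K) powr (1 / \<alpha>)"
    have d: "d > 0" using e K by (simp add: d_def)
    have "norm (F n x - F n y) < e" if y: "y \<in> S" "norm (x - y) < d" for n y
    proof -
      have D: "dist x y powr \<alpha> \<le> e / K"
      proof -
        have "dist x y powr \<alpha> \<le> d powr \<alpha>" using y(2) \<alpha> by (intro powr_mono2) (auto simp: dist_norm)
        also have "\<dots> = e / K" using e K \<alpha> by (simp add: d_def powr_powr)
        finally show ?thesis .
      qed
      have "norm (F n x - F n y) \<le> \<bar>\<psi> n x - \<psi> n y\<bar> + \<bar>\<psi>' n x - \<psi>' n y\<bar>"
        using norm_Pair_le[of "\<psi> n x - \<psi> n y" "\<psi>' n x - \<psi>' n y"] by (simp add: F_def)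
      also have "\<dots> \<le> \<kappa> * dist x y powr \<alpha> + \<kappa>' * dist x y powr \<alpha>"
        by (intro add_mono hoelder_le_modulus[OF h(1) x y(1)] hoelder_le_modulus[OF h(2) x y(1)])
      also have "\<dots> \<le> (\<bar>\<kappa>\<bar> + \<bar>\<kappa>'\<bar>) * (dist x y powr \<alpha>)"
        unfolding distrib_right by (intro add_mono mult_right_mono) auto
      also have "\<dots> \<le> (\<bar>\<kappa>\<bar> + \<bar>\<kappa>'\<bar>) * (e / K)" using D by (intro mult_left_mono) auto
      also have "\<dots> < K * (e / K)" using e K by (intro mult_strict_right_mono) (auto simp: K_def)
      also have "\<dots> = e" using K by simp
      finally show ?thesis .
    qed
    then show ?thesis using d by blast
  qed
  obtain G k where G: "continuous_on S G" "strict_mono (k :: nat \<Rightarrow> nat)"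
    "\<And>e. 0 < e \<Longrightarrow> \<exists>N. \<forall>n x. n \<ge> N \<and> x \<in> S \<longrightarrow> norm (F (k n) x - G x) < e"
    by (rule Arzela_Ascoli[OF S bd eq]) blast+
  have "\<exists>N. \<forall>n\<ge>N. \<forall>x\<in>S. \<bar>\<psi> (k n) x - fst (G x)\<bar> < e \<and> \<bar>\<psi>' (k n) x - snd (G x)\<bar> < e" if e: "e > 0" for e
  proof -
    obtain N where N: "\<And>n x. n \<ge> N \<Longrightarrow> x \<in> S \<Longrightarrow> norm (F (k n) x - G x) < e" using G(3)[OF e] by blast
    have "\<bar>\<psi> (k n) x - fst (G x)\<bar> < e \<and> \<bar>\<psi>' (k n) x - snd (G x)\<bar> < e" if "n \<ge> N" "x \<in> S" for n x
    proof -
      have "F (k n) x - G x = (\<psi> (k n) x - fst (G x), \<psi>' (k n) x - snd (G x))" by (simp add: F_def prod_eq_iff)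
      then show ?thesis
        using N[OF that] norm_fst_le[of "\<psi> (k n) x - fst (G x)" "\<psi>' (k n) x - snd (G x)"]
          norm_snd_le[of "\<psi>' (k n) x - snd (G x)" "\<psi> (k n) x - fst (G x)"] by simp
    qed
    then show ?thesis by blast
  qed
  moreover have "continuous_on S (\<lambda>x. fst (G x))" "continuous_on S (\<lambda>x. snd (G x))"
    using G(1) by (auto intro!: continuous_intros)
  ultimately show ?thesis using that[of "\<lambda>x. fst (G x)" "\<lambda>x. snd (G x)" k] G(2) by blast
qed

section \<open>The plate as an energy space, and stability of the worst-case gap\<close>

lemma H2s_energy_space:
  assumes "l > 0" "0 < \<sigma>" "\<sigma> < 1"
  obtains C where "energy_space (H2s l) (H2s_inner l \<sigma>) C"
proof -
  obtain C where C: "C \<ge> 0" "\<And>v p. H2s l v \<Longrightarrow> \<bar>v p\<bar> \<le> C * sqrt (H2s_inner l \<sigma> v v)"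
    by (rule H2s_sup_bound[OF assms]) blast
  have "energy_space (H2s l) (H2s_inner l \<sigma>) C"
  proof
    show "0 \<le> H2s_inner l \<sigma> v v" if "H2s l v" for v
    proof -
      have "0 \<le> (1 - \<sigma>) * (sqn l (wd l [False, False] v) + sqn l (wd l [True, True] v) + 2 * sqn l (wd l [False, True] v))"
        using assms sqn_nonneg by (intro mult_nonneg_nonneg add_nonneg_nonneg) auto
      then show ?thesis using H2s_inner_bounds(1)[OF that assms(2,3)] by linarith
    qed
    show "\<exists>u. H2s l u \<and> (\<lambda>n. H2s_inner l \<sigma> (\<lambda>p. s n p - u p) (\<lambda>p. s n p - u p)) \<longlonglongrightarrow> 0"
      if "\<And>n. H2s l (s n)"
        "\<And>e. e > 0 \<Longrightarrow> \<exists>N. \<forall>m\<ge>N. \<forall>n\<ge>N. H2s_inner l \<sigma> (\<lambda>p. s m p - s n p) (\<lambda>p. s m p - s n p) < e" for s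
      by (rule H2s_complete[OF assms that]) blast+
  qed (fact H2s_zero H2s_lincomb H2s_inner_commute H2s_inner_lincomb C)+
  then show ?thesis by (rule that)
qed

locale plate_problem =
  fixes l \<sigma> C :: real and S :: "(real \<times> real) set"
  assumes l: "l > 0" and energy: "energy_space (H2s l) (H2s_inner l \<sigma>) C"
begin

sublocale energy_space "H2s l" "H2s_inner l \<sigma>" C by (rule energy)

lemma dual_ball_load: "f \<in> dual_ball l \<Longrightarrow> load f"
  unfolding load_def
proof (intro conjI allI impI)
  assume f: "f \<in> dual_ball l"
  show "f (\<lambda>p. a * u p + b * v p) = a * f u + b * f v" if "H2s l u" "H2s l v" for u v a b
    using f that unfolding dual_ball_def H2s_def by blast
  show "\<bar>f u\<bar> \<le> C * sqrt (H2s_inner l \<sigma> u u)" if u: "H2s l u" for u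
  proof -
    have "\<bar>f u\<bar> \<le> (SUP p\<in>Omc l. \<bar>u p\<bar>)" using f u unfolding dual_ball_def H2s_def by blast
    also have "\<dots> \<le> C * sqrt (H2s_inner l \<sigma> u u)"
      by (rule cSUP_least) (use l sup_bound[OF u] in \<open>auto simp: Omc_def\<close>)
    finally show ?thesis .
  qed
qed

lemma dual_ball_nonempty: "dual_ball l \<noteq> {}"
proof -
  have "(\<lambda>u. 0) \<in> dual_ball l"
    unfolding dual_ball_def
  proof (intro CollectI conjI allI impI)
    fix u :: "real \<times> real \<Rightarrow> real" assume "continuous_on (Omc l) u"
    then have "continuous_on (Omc l) (\<lambda>p. \<bar>u p\<bar>)" by (intro continuous_intros)
    then have "compact ((\<lambda>p. \<bar>u p\<bar>) ` Omc l)"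
      by (intro compact_continuous_image) (auto simp: Omc_def intro!: compact_Times)
    then have "bdd_above ((\<lambda>p. \<bar>u p\<bar>) ` Omc l)" by (intro bounded_imp_bdd_above compact_imp_bounded)
    moreover have "(0, 0) \<in> Omc l" using l by (simp add: Omc_def)
    ultimately have "\<bar>u (0, 0)\<bar> \<le> (SUP p\<in>Omc l. \<bar>u p\<bar>)" by (rule cSUP_upper[rotated])
    then show "\<bar>0::real\<bar> \<le> (SUP p\<in>Omc l. \<bar>u p\<bar>)" by linarith
  qed auto
  then show ?thesis by blast
qed

text \<open>The signs of the obstacles make 0 admissible; the other conditions hold because the
  constraint is a pair of inequalities at each point.\<close>

lemma Kset_constraint_set:
  assumes "\<And>x. x \<in> S \<Longrightarrow> \<psi>m x \<le> 0" "\<And>x. x \<in> S \<Longrightarrow> 0 \<le> \<psi>p x"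
  shows "constraint_set (Kset l S \<psi>m \<psi>p)"
  unfolding constraint_set_def
proof (intro conjI ballI allI impI)
  show "(\<lambda>p. 0) \<in> Kset l S \<psi>m \<psi>p" using assms V_zero by (simp add: Kset_def)
  show "H2s l u" if "u \<in> Kset l S \<psi>m \<psi>p" for u using that by (simp add: Kset_def)
  show "(\<lambda>p. (1 - t) * u p + t * v p) \<in> Kset l S \<psi>m \<psi>p"
    if "u \<in> Kset l S \<psi>m \<psi>p" "v \<in> Kset l S \<psi>m \<psi>p" "0 \<le> t" "t \<le> 1" for u v t
    unfolding Kset_def
  proof (intro CollectI conjI ballI)
    show "H2s l (\<lambda>p. (1 - t) * u p + t * v p)" using that by (intro V_lincomb) (auto simp: Kset_def)
    fix x assume x: "x \<in> S"
    have b: "\<psi>m x \<le> u x" "\<psi>m x \<le> v x" "u x \<le> \<psi>p x" "v x \<le> \<psi>p x" using that x by (auto simp: Kset_def)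
    show "(1 - t) * u x + t * v x \<le> \<psi>p x" using convex_bound_le[OF b(3,4), of "1 - t" t] that by simp
    show "\<psi>m x \<le> (1 - t) * u x + t * v x"
      using convex_bound_le[of "- u x" "- \<psi>m x" "- v x" "1 - t" t] b that by simp
  qed
  show "u \<in> Kset l S \<psi>m \<psi>p" if s: "\<forall>n. s n \<in> Kset l S \<psi>m \<psi>p" "H2s l u" "\<forall>p. (\<lambda>n. s n p) \<longlonglongrightarrow> u p" for s u
    unfolding Kset_def
  proof (intro CollectI conjI ballI s(2))
    fix x assume "x \<in> S"
    then have "\<psi>m x \<le> s n x" "s n x \<le> \<psi>p x" for n using s(1) by (auto simp: Kset_def)
    then show "\<psi>m x \<le> u x" "u x \<le> \<psi>p x"
      using LIMSEQ_le_const[of "\<lambda>n. s n x" "u x"] LIMSEQ_le_const2[of "\<lambda>n. s n x" "u x"] s(3) by blast+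
  qed
qed

lemma u_sol_solves:
  assumes "constraint_set (Kset l S \<psi>m \<psi>p)" "f \<in> dual_ball l"
  shows "solves (Kset l S \<psi>m \<psi>p) f (u_sol l \<sigma> S f \<psi>m \<psi>p)"
proof -
  have "\<exists>!u. solves (Kset l S \<psi>m \<psi>p) f u"
    using solves_exists[OF assms(1) dual_ball_load[OF assms(2)]]
      solves_unique[OF assms(1) dual_ball_load[OF assms(2)]] by blast
  from theI'[OF this] show ?thesis unfolding u_sol_def solves_def .
qed

text \<open>Suprema of reals are informative only for bounded sets; this bound, uniform in x and in
  the load, provides boundedness for both \<open>G_f\<close> and \<open>G_psi\<close>.\<close>

lemma gap_bound:
  assumes "constraint_set (Kset l S \<psi>m \<psi>p)" "f \<in> dual_ball l"
  shows "\<bar>u_sol l \<sigma> S f \<psi>m \<psi>p (x, l) - u_sol l \<sigma> S f \<psi>m \<psi>p (x, -l)\<bar> \<le> 2 * C\<^sup>2"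
  using solves_energy_bound(4)[OF assms(1) dual_ball_load[OF assms(2)] u_sol_solves[OF assms], of "(x, l)"]
    solves_energy_bound(4)[OF assms(1) dual_ball_load[OF assms(2)] u_sol_solves[OF assms], of "(x, -l)"]
  by linarith

lemma gap_le_G_f:
  assumes "constraint_set (Kset l S \<psi>m \<psi>p)" "f \<in> dual_ball l" "x \<in> {0..pi}"
  shows "\<bar>u_sol l \<sigma> S f \<psi>m \<psi>p (x, l) - u_sol l \<sigma> S f \<psi>m \<psi>p (x, -l)\<bar> \<le> G_f l \<sigma> S f \<psi>m \<psi>p"
  unfolding G_f_def
  by (rule cSUP_upper[OF assms(3)]) (use gap_bound[OF assms(1,2)] in \<open>auto intro!: bdd_aboveI2\<close>)

lemma G_f_le_G_psi:
  assumes "constraint_set (Kset l S \<psi>m \<psi>p)" "f \<in> dual_ball l"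
  shows "G_f l \<sigma> S f \<psi>m \<psi>p \<le> G_psi l \<sigma> S \<psi>m \<psi>p"
  unfolding G_psi_def
proof (rule cSUP_upper[OF assms(2)], rule bdd_aboveI2)
  show "G_f l \<sigma> S f \<psi>m \<psi>p \<le> 2 * C\<^sup>2" if "f \<in> dual_ball l" for f
    unfolding G_f_def by (rule cSUP_least) (use gap_bound[OF assms(1) that] in auto)
qed

lemma G_psi_nonneg:
  assumes "constraint_set (Kset l S \<psi>m \<psi>p)"
  shows "0 \<le> G_psi l \<sigma> S \<psi>m \<psi>p"
proof -
  obtain f where f: "f \<in> dual_ball l" using dual_ball_nonempty by blast
  have "0 \<in> {0..pi}" by simp
  then show ?thesis using gap_le_G_f[OF assms f, of 0] G_f_le_G_psi[OF assms f] by linarith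
qed

text \<open>The scaling parameter \<delta> / \<open>\<gamma>\<close> is the same for all loads, so
  the estimate for each solution survives the supremum over f.\<close>

lemma G_psi_stability:
  assumes \<gamma>: "\<gamma> > 0" and \<delta>: "0 \<le> \<delta>" "\<delta> \<le> \<gamma>"
    and sep: "\<And>x. x \<in> S \<Longrightarrow> \<psi>m x \<le> - \<gamma> \<and> \<gamma> \<le> \<psi>p x" "\<And>x. x \<in> S \<Longrightarrow> \<psi>m' x \<le> - \<gamma> \<and> \<gamma> \<le> \<psi>p' x"
    and close: "\<And>x. x \<in> S \<Longrightarrow> \<bar>\<psi>m x - \<psi>m' x\<bar> \<le> \<delta> \<and> \<bar>\<psi>p x - \<psi>p' x\<bar> \<le> \<delta>"
  shows "G_psi l \<sigma> S \<psi>m \<psi>p \<le> G_psi l \<sigma> S \<psi>m' \<psi>p' + 4 * C\<^sup>2 * sqrt (\<delta> / \<gamma>)"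
proof -
  define \<epsilon> where "\<epsilon> = \<delta> / \<gamma>"
  have \<epsilon>: "0 \<le> \<epsilon>" "\<epsilon> \<le> 1" "\<epsilon> * \<gamma> = \<delta>" using \<gamma> \<delta> by (auto simp: \<epsilon>_def)
  have scaled: "(\<lambda>p. (1 - \<epsilon>) * u p) \<in> Kset l S \<beta>m \<beta>p"
    if u: "u \<in> Kset l S \<alpha>m \<alpha>p" and a: "\<And>x. x \<in> S \<Longrightarrow> \<alpha>m x \<le> - \<gamma> \<and> \<gamma> \<le> \<alpha>p x"
      and c: "\<And>x. x \<in> S \<Longrightarrow> \<beta>m x \<le> \<alpha>m x + \<delta> \<and> \<alpha>p x - \<delta> \<le> \<beta>p x"
    for u \<alpha>m \<alpha>p \<beta>m \<beta>p
    unfolding Kset_def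
  proof (intro CollectI conjI ballI)
    show "H2s l (\<lambda>p. (1 - \<epsilon>) * u p)" using u by (intro V_scale) (simp add: Kset_def)
    fix x assume x: "x \<in> S"
    have ux: "\<alpha>m x \<le> u x" "u x \<le> \<alpha>p x" using u x by (auto simp: Kset_def)
    have "(1 - \<epsilon>) * u x \<le> (1 - \<epsilon>) * \<alpha>p x" "(1 - \<epsilon>) * \<alpha>m x \<le> (1 - \<epsilon>) * u x"
      using ux \<epsilon> by (auto intro: mult_left_mono)
    \<comment> \<open>The obstacles keep distance \<open>\<gamma>\<close> from 0, so scaling
      tightens each bound by at least \<epsilon> \<open>\<gamma>\<close> = \<delta>, which absorbs
      the displacement of the obstacles.\<close>
    moreover have "\<epsilon> * \<gamma> \<le> \<epsilon> * \<alpha>p x" "\<epsilon> * \<gamma> \<le> \<epsilon> * (- \<alpha>m x)" using a[OF x] \<epsilon>(1) by (intro mult_left_mono; linarith)+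
    ultimately show "(1 - \<epsilon>) * u x \<le> \<beta>p x" "\<beta>m x \<le> (1 - \<epsilon>) * u x"
      using c[OF x] \<epsilon>(3) by (auto simp: left_diff_distrib)
  qed
  have K: "constraint_set (Kset l S \<psi>m \<psi>p)" "constraint_set (Kset l S \<psi>m' \<psi>p')"
    using sep \<gamma> by (auto intro!: Kset_constraint_set order_trans[OF conjunct1[OF sep(1)]] order_trans[OF conjunct1[OF sep(2)]]
        order_trans[OF _ conjunct2[OF sep(1)]] order_trans[OF _ conjunct2[OF sep(2)]])
  have "G_f l \<sigma> S f \<psi>m \<psi>p \<le> G_psi l \<sigma> S \<psi>m' \<psi>p' + 4 * C\<^sup>2 * sqrt (\<delta> / \<gamma>)" if f: "f \<in> dual_ball l" for f
    unfolding G_f_def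
  proof (rule cSUP_least)
    fix x assume x: "x \<in> {0..pi}"
    define u v where "u = u_sol l \<sigma> S f \<psi>m \<psi>p" and "v = u_sol l \<sigma> S f \<psi>m' \<psi>p'"
    have uv: "solves (Kset l S \<psi>m \<psi>p) f u" "solves (Kset l S \<psi>m' \<psi>p') f v"
      unfolding u_def v_def using u_sol_solves K f by auto
    have "(\<lambda>p. (1 - \<epsilon>) * u p) \<in> Kset l S \<psi>m' \<psi>p'"
      by (rule scaled[of u \<psi>m \<psi>p]) (use uv(1) sep(1) close \<delta>(1) in \<open>force simp: solves_def abs_le_iff\<close>)+
    moreover have "(\<lambda>p. (1 - \<epsilon>) * v p) \<in> Kset l S \<psi>m \<psi>p"
      by (rule scaled[of v \<psi>m' \<psi>p']) (use uv(2) sep(2) close \<delta>(1) in \<open>force simp: solves_def abs_le_iff\<close>)+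
    ultimately have *: "\<bar>u p - v p\<bar> \<le> 2 * C\<^sup>2 * sqrt \<epsilon>" for p
      by (rule solves_stability[OF K dual_ball_load[OF f] uv \<epsilon>(1)])
    have "\<bar>v (x, l) - v (x, -l)\<bar> \<le> G_psi l \<sigma> S \<psi>m' \<psi>p'"
      using gap_le_G_f[OF K(2) f x] G_f_le_G_psi[OF K(2) f] unfolding v_def by linarith
    \<comment> \<open>The gap involves two points, each contributing 2 C^2 sqrt \<epsilon>.\<close>
    then have "\<bar>u (x, l) - u (x, -l)\<bar> \<le> G_psi l \<sigma> S \<psi>m' \<psi>p' + 4 * C\<^sup>2 * sqrt \<epsilon>"
      using *[of "(x, l)"] *[of "(x, -l)"] by linarith
    then show "\<bar>u_sol l \<sigma> S f \<psi>m \<psi>p (x, l) - u_sol l \<sigma> S f \<psi>m \<psi>p (x, -l)\<bar>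
      \<le> G_psi l \<sigma> S \<psi>m' \<psi>p' + 4 * C\<^sup>2 * sqrt (\<delta> / \<gamma>)" by (simp add: u_def \<epsilon>_def)
  qed simp
  then show ?thesis unfolding G_psi_def[of l \<sigma> S \<psi>m \<psi>p] by (intro cSUP_least dual_ball_nonempty)
qed

end

section \<open>Limit of a minimising sequence of obstacle pairs\<close>

theorem theorem4p3:
  fixes l \<sigma> \<alpha> \<gamma>m \<gamma>p \<kappa>m \<kappa>p :: real and ObsSet :: "(real \<times> real) set"
  assumes "l > 0" and "0 < \<sigma>" and "\<sigma> < 1"
    and "ObsSet \<subseteq> Omc l" and "ObsSet \<noteq> {}" and "closed ObsSet"
    and "0 < \<alpha>" and "\<alpha> < 1"
    and "0 < \<gamma>m" and "\<gamma>m \<le> \<kappa>m" and "0 < \<gamma>p" and "\<gamma>p \<le> \<kappa>p"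
  shows "\<exists>\<psi>m\<in>Psi_minus \<alpha> ObsSet \<gamma>m \<kappa>m. \<exists>\<psi>p\<in>Psi_plus \<alpha> ObsSet \<gamma>p \<kappa>p.
           \<forall>\<psi>m'\<in>Psi_minus \<alpha> ObsSet \<gamma>m \<kappa>m. \<forall>\<psi>p'\<in>Psi_plus \<alpha> ObsSet \<gamma>p \<kappa>p.
             G_psi l \<sigma> ObsSet \<psi>m \<psi>p \<le> G_psi l \<sigma> ObsSet \<psi>m' \<psi>p'"
proof -
  obtain C where C: "energy_space (H2s l) (H2s_inner l \<sigma>) C" by (rule H2s_energy_space[OF assms(1-3)])
  interpret plate_problem l \<sigma> C ObsSet by (rule plate_problem.intro[OF assms(1) C])
  have "compact (Omc l)" by (auto simp: Omc_def intro!: compact_Times)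
  then have cS: "compact ObsSet" using assms(4,6) by (metis compact_Int_closed inf.absorb_iff2)
  define P where "P = Psi_minus \<alpha> ObsSet \<gamma>m \<kappa>m \<times> Psi_plus \<alpha> ObsSet \<gamma>p \<kappa>p"
  define J where "J q = G_psi l \<sigma> ObsSet (fst q) (snd q)" for q
  \<comment> \<open>The scaling factor acts on the whole function, so one distance must serve both
    the lower and the upper obstacle.\<close>
  define \<gamma> where "\<gamma> = min \<gamma>m \<gamma>p"
  have \<gamma>: "\<gamma> > 0" using assms by (simp add: \<gamma>_def)
  have sep: "fst q x \<le> - \<gamma> \<and> \<gamma> \<le> snd q x" if "q \<in> P" "x \<in> ObsSet" for q x
    using that Psi_iff[OF assms(5)] by (force simp: P_def \<gamma>_def)
  have J0: "0 \<le> J q" if "q \<in> P" for q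
    unfolding J_def
    by (rule G_psi_nonneg, rule Kset_constraint_set) (use sep[OF that] \<gamma> in force)+
  \<comment> \<open>Constant obstacles have zero Hoelder quotients and norms
    \<open>\<gamma>m\<close> and \<open>\<gamma>p\<close>, which are at most
    \<open>\<kappa>m\<close> and \<open>\<kappa>p\<close>.\<close>
  have "((\<lambda>_. - \<gamma>m), (\<lambda>_. \<gamma>p)) \<in> P"
    using assms by (auto simp: P_def Psi_iff hoelder_le_def)
  then have ne: "J ` P \<noteq> {}" by blast
  have bdd: "bdd_below (J ` P)" using J0 by (auto intro!: bdd_belowI2)
  have "\<exists>q. q \<in> P \<and> J q < Inf (J ` P) + inverse (real (Suc n))" for n
    using cInf_lessD[OF ne, of "Inf (J ` P) + inverse (real (Suc n))"] by auto
  then obtain q where q: "\<And>n. q n \<in> P" "\<And>n. J (q n) < Inf (J ` P) + inverse (real (Suc n))" by metis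
  have h: "hoelder_le \<alpha> ObsSet \<kappa>m (fst (q n))" "hoelder_le \<alpha> ObsSet \<kappa>p (snd (q n))" for n
    using q(1)[of n] Psi_iff[OF assms(5)] by (auto simp: P_def mem_Times_iff)
  obtain g g' k where g: "continuous_on ObsSet g" "continuous_on ObsSet g'" "strict_mono (k :: nat \<Rightarrow> nat)"
    "\<And>e. e > 0 \<Longrightarrow> \<exists>N. \<forall>n\<ge>N. \<forall>x\<in>ObsSet. \<bar>fst (q (k n)) x - g x\<bar> < e \<and> \<bar>snd (q (k n)) x - g' x\<bar> < e"
    by (rule hoelder_le_sequential_compactness[OF cS assms(7),
          of \<kappa>m "\<lambda>n. fst (q n)" \<kappa>p "\<lambda>n. snd (q n)", OF h]) blast
  have lim: "(\<lambda>n. fst (q (k n)) x) \<longlonglongrightarrow> g x" "(\<lambda>n. snd (q (k n)) x) \<longlonglongrightarrow> g' x" if "x \<in> ObsSet" for x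
    using g(4) that by (fastforce intro!: LIMSEQ_I)+
  have gP: "(g, g') \<in> P"
  proof -
    have "g x \<le> - \<gamma>m" "\<gamma>p \<le> g' x" if x: "x \<in> ObsSet" for x
    proof -
      have b: "fst (q (k n)) x \<le> - \<gamma>m" "\<gamma>p \<le> snd (q (k n)) x" for n
        using q(1)[of "k n"] Psi_iff[OF assms(5)] x by (auto simp: P_def mem_Times_iff)
      show "g x \<le> - \<gamma>m" by (rule LIMSEQ_le_const2[OF lim(1)[OF x]]) (use b in blast)
      show "\<gamma>p \<le> g' x" by (rule LIMSEQ_le_const[OF lim(2)[OF x]]) (use b in blast)
    qed
    moreover have "hoelder_le \<alpha> ObsSet \<kappa>m g" "hoelder_le \<alpha> ObsSet \<kappa>p g'"
      using hoelder_le_limit[of \<alpha> ObsSet \<kappa>m "\<lambda>n. fst (q (k n))" g, OF h(1) lim(1)]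
        hoelder_le_limit[of \<alpha> ObsSet \<kappa>p "\<lambda>n. snd (q (k n))" g', OF h(2) lim(2)] by blast+
    ultimately show ?thesis using g(1,2) by (simp add: P_def Psi_iff[OF assms(5)])
  qed
  have "J (g, g') \<le> Inf (J ` P)"
  proof (rule field_le_epsilon)
    fix e :: real assume e: "e > 0"
    \<comment> \<open>The second entry makes 4 C^2 sqrt (\<delta> / \<open>\<gamma>\<close>) at most
      e / 2, with C^2 + 1 guarding against C = 0; the first meets the condition \<delta> \<le>
      \<open>\<gamma>\<close> of the stability estimate. The other e / 2 is left for the minimising
      sequence.\<close>
    define \<delta> where "\<delta> = min \<gamma> (\<gamma> * (e / (8 * (C\<^sup>2 + 1)))\<^sup>2)"
    have C1: "C\<^sup>2 + 1 > 0" by (simp add: add_nonneg_pos)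
    have \<delta>: "\<delta> > 0" "\<delta> \<le> \<gamma>" using \<gamma> e C1 by (auto simp: \<delta>_def)
    obtain N where N: "\<And>n x. n \<ge> N \<Longrightarrow> x \<in> ObsSet \<Longrightarrow> \<bar>fst (q (k n)) x - g x\<bar> < \<delta> \<and> \<bar>snd (q (k n)) x - g' x\<bar> < \<delta>"
      using g(4)[OF \<delta>(1)] by blast
    from e have "e / 2 > 0" by simp
    from reals_Archimedean[OF this] obtain M where M: "inverse (real (Suc M)) < e / 2" by blast
    define n where "n = max N M"
    have "J (g, g') \<le> J (q (k n)) + 4 * C\<^sup>2 * sqrt (\<delta> / \<gamma>)"
      unfolding J_def fst_conv snd_conv
    proof (rule G_psi_stability[OF \<gamma> less_imp_le[OF \<delta>(1)] \<delta>(2)])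
      show "g x \<le> - \<gamma> \<and> \<gamma> \<le> g' x" if "x \<in> ObsSet" for x using sep[OF gP that] by simp
      show "fst (q (k n)) x \<le> - \<gamma> \<and> \<gamma> \<le> snd (q (k n)) x" if "x \<in> ObsSet" for x by (rule sep[OF q(1) that])
      show "\<bar>g x - fst (q (k n)) x\<bar> \<le> \<delta> \<and> \<bar>g' x - snd (q (k n)) x\<bar> \<le> \<delta>" if "x \<in> ObsSet" for x
        using N[OF _ that, of n] by (auto simp: n_def abs_minus_commute)
    qed
    moreover have "4 * C\<^sup>2 * sqrt (\<delta> / \<gamma>) \<le> e / 2"
    proof -
      have "\<delta> / \<gamma> \<le> (e / (8 * (C\<^sup>2 + 1)))\<^sup>2" using \<gamma> by (simp add: pos_divide_le_eq \<delta>_def mult.commute)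
      then have "sqrt (\<delta> / \<gamma>) \<le> e / (8 * (C\<^sup>2 + 1))" using e C1 by (intro real_le_lsqrt) auto
      then have "4 * C\<^sup>2 * sqrt (\<delta> / \<gamma>) \<le> 4 * C\<^sup>2 * (e / (8 * (C\<^sup>2 + 1)))" by (intro mult_left_mono) auto
      also have "\<dots> \<le> e / 2" using e C1 by (simp add: field_simps)
      finally show ?thesis .
    qed
    moreover have "J (q (k n)) < Inf (J ` P) + e / 2"
    proof -
      have "n \<le> k n" using g(3) by (rule strict_mono_imp_increasing)
      then have "M \<le> k n" by (simp add: n_def)
      then have "inverse (real (Suc (k n))) \<le> inverse (real (Suc M))" by (intro le_imp_inverse_le) auto
      then show ?thesis using q(2)[of "k n"] M by linarith
    qed
    ultimately show "J (g, g') \<le> Inf (J ` P) + e" by linarith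
  qed
  then have min: "J (g, g') \<le> J q" if "q \<in> P" for q
    using cInf_lower[OF imageI[OF that] bdd] by linarith
  show ?thesis
  proof (intro bexI ballI)
    show "g \<in> Psi_minus \<alpha> ObsSet \<gamma>m \<kappa>m" "g' \<in> Psi_plus \<alpha> ObsSet \<gamma>p \<kappa>p" using gP by (auto simp: P_def)
    show "G_psi l \<sigma> ObsSet g g' \<le> G_psi l \<sigma> ObsSet \<psi>m' \<psi>p'"
      if "\<psi>m' \<in> Psi_minus \<alpha> ObsSet \<gamma>m \<kappa>m" "\<psi>p' \<in> Psi_plus \<alpha> ObsSet \<gamma>p \<kappa>p" for \<psi>m' \<psi>p'
      using min[of "(\<psi>m', \<psi>p')"] that by (simp add: P_def J_def)
  qed
qed

end
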